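(* Let $\{\Delta^\circ_v\},\{\Delta^\bullet_w\}$ be a dimer model (dual dimer in dimension $n=2$) with graph $G\subset T^2$ and dimer Lagrangian $L(\phi^\bullet_w,\phi^\circ_v)\subset(\mathbb C^* )^2$. For a face $f\in F(G)$, let $c=\partial f$ be the boundary cycle of the face, and suppose that $c$ has zero weight. Let $\gamma_c:S^1\to L(\phi^\bullet_w,\phi^\circ_v)$ be a lift of the cycle to the dimer Lagrangian, in the sense that $\arg(\gamma_c)=c$. Then there exists a Lagrangian disk $D_f$ whose boundary is (the lift $\gamma_c$ of) $c$ in $L(\phi^\bullet_w,\phi^\circ_v)$.
   Context: Dual $n$-dimer: two finite collections of $n$-polytopes $\{\Delta^\circ_v\},\{\Delta^\bullet_w\}$ in $\mathbb R^n$ such that (i) within each colour, vertices congruent mod $\mathbb Z^n$ are equal; (ii) the vertex sets of the two colours agree mod $\mathbb Z^n$; (iii) if a vertex $p_1$ of $\Delta^\circ_{v_1}$ corresponds to a vertex $p_2\equiv p_1$ of $\Delta^\bullet_{v_2}$ and the edges of $\Delta^\circ_{v_1}$ at $p_1$ point in directions $e_1,\dots,e_k$, then the edges of $\Delta^\bullet_{v_2}$ at $p_2$ point in directions $-e_1,\dots,-e_k$. The bipartite graph $G\subset T^n=\mathbb R^n/\mathbb Z^n$ has one vertex per polytope and one edge for each vertex shared mod $\mathbb Z^n$ by a $\bullet$ and a $\circ$ polytope. For $n=2$, a dimer is an embedded bipartite graph in $T^2$; $F(G)$ is its set of faces (components of the complement). Dimer Lagrangian: identify $(\mathbb C^* )^n=T^*Q/T^*_{\mathbb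 Z}Q\cong T^*T^n$, $Q=\mathbb R^n$, with coordinates $(q,p)$, $\mathrm{val}(q,p)=q$, $\arg(q,p)=p\in T^n$. Let $\phi^\circ_v(q)=\max_{p\in\Delta^\circ_v}\langle p,q\rangle$ and $\phi^\bullet_w(q)=\min_{p\in\Delta^\bullet_w}\langle p,q\rangle$, let $\tilde\phi$ denote a smoothing by convolution with a kernel of small radius $R$ (shifted so $\tilde\phi(0)=0$), and let $\sigma$ be the graph of $d\tilde\phi$ in $(\mathbb C^* )^n$. For each edge $e=wv$ of $G$, the sections $\sigma^\bullet_w$ and $\sigma^\circ_v$ coincide over the region $U_e$ of points at distance at least $R$ from the complement of the cone where both functions are linear with slope the shared vertex. The dimer Lagrangian $L(\phi^\bullet_w,\phi^\circ_v)$ is the result of Lagrangian surgery of all the sections along all the $U_e$: overlaps are removed and replaced by Lagrangian necks joining $\sigma^\bullet_w$ and $\sigma^\circ_v$ near $\partial U_e$. The image of its argument projection is the union of the polytopes in $T^n$. Weight: orient edges from $\bullet$ to $\circ$. The weight of an edge is $\mathfrak w_e=\int_{\gamma_e}\eta$, where $\eta=q\cdot dp$ and $\gamma_e$ is a lift of $e$ to the dimer Lagrangian; the weight of a cycle $c$ is $\sum_{e\in c}\pm\mathfrak w_e$, with sign $+$ exactly when $c$ traverses $e$ from $\bullet$ to $\circ$. *)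

theory Defs
  imports "HOL-Analysis.Analysis"
begin

section \<open>Smooth maps\<close>

primrec C_k :: "nat \<Rightarrow> 'a::euclidean_space set \<Rightarrow> ('a \<Rightarrow> 'b::real_normed_vector) \<Rightarrow> bool" where
  "C_k 0 S f \<longleftrightarrow> continuous_on S f"
| "C_k (Suc k) S f \<longleftrightarrow>
     f differentiable_on S \<and> (\<forall>i\<in>Basis. C_k k S (\<lambda>x. frechet_derivative f (at x) i))"

text \<open>Only meant for open sets.\<close>

definition smooth_on :: "'a::euclidean_space set \<Rightarrow> ('a \<Rightarrow> 'b::real_normed_vector) \<Rightarrow> bool" where
  "smooth_on S f \<longleftrightarrow> open S \<and> (\<forall>k. C_k k S f)"

text \<open>Paths on \<open>[0,1]\<close> that are smooth up to the end points on each piece of a finite subdivision,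
  and continuous at the break points.\<close>

definition piecewise_smooth_path :: "(real \<Rightarrow> 'b::real_normed_vector) \<Rightarrow> bool" where
  "piecewise_smooth_path \<gamma> \<longleftrightarrow>
     (\<exists>S. finite S \<and>
       (\<forall>a b. 0 \<le> a \<and> a < b \<and> b \<le> 1 \<and> {a<..<b} \<inter> S = {} \<longrightarrow>
          (\<exists>g. smooth_on UNIV g \<and> (\<forall>t\<in>{a..b}. g t = \<gamma> t))))"

section \<open>The algebraic torus as a cotangent bundle\<close>

text \<open>The torus \<open>T\<^sup>n = \<real>\<^sup>n / \<int>\<^sup>n\<close> is realised as the set of complex vectors with unimodular entries;
  \<open>torus p = torus p'\<close> holds iff \<open>p\<close> and \<open>p'\<close> are congruent modulo \<open>\<int>\<^sup>n\<close>.\<close>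

definition torus :: "real ^ 'n \<Rightarrow> complex ^ 'n" where
  "torus p = (\<chi> j. cis (2 * pi * p $ j))"

definition Cstar :: "(complex ^ 'n) set" where
  "Cstar = {z. \<forall>j. z $ j \<noteq> 0}"

text \<open>The coordinates \<open>(q, p)\<close> on \<open>(\<complex>\<^sup>*)\<^sup>n\<close>, with \<open>p\<close> taken modulo \<open>\<int>\<^sup>n\<close>.\<close>

definition from_coords :: "real ^ 'n \<Rightarrow> real ^ 'n \<Rightarrow> complex ^ 'n" where
  "from_coords q p = (\<chi> j. of_real (exp (q $ j)) * cis (2 * pi * p $ j))"

definition val :: "complex ^ 'n \<Rightarrow> real ^ 'n" where
  "val z = (\<chi> j. ln (cmod (z $ j)))"

definition arg_torus :: "complex ^ 'n \<Rightarrow> complex ^ 'n" where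
  "arg_torus z = (\<chi> j. sgn (z $ j))"

text \<open>The differentials of the coordinates at \<open>z\<close>, applied to a tangent vector \<open>a\<close>: here
  \<open>dz\<^sub>j / z\<^sub>j = dq\<^sub>j + 2 \<pi> \<i> dp\<^sub>j\<close>.\<close>

definition dq :: "complex ^ 'n \<Rightarrow> complex ^ 'n \<Rightarrow> real ^ 'n" where
  "dq z a = (\<chi> j. Re (a $ j / z $ j))"

definition dp :: "complex ^ 'n \<Rightarrow> complex ^ 'n \<Rightarrow> real ^ 'n" where
  "dp z a = (\<chi> j. Im (a $ j / z $ j) / (2 * pi))"

definition symp :: "complex ^ 'n \<Rightarrow> complex ^ 'n \<Rightarrow> complex ^ 'n \<Rightarrow> real" where
  "symp z a b = dq z a \<bullet> dp z b - dq z b \<bullet> dp z a"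

text \<open>The integral of \<open>\<eta> = q \<cdot> dp\<close> along a path.\<close>

definition eta_integral :: "(real \<Rightarrow> complex ^ 'n) \<Rightarrow> real" where
  "eta_integral \<gamma> =
     integral {0..1} (\<lambda>t. val (\<gamma> t) \<bullet> dp (\<gamma> t) (vector_derivative \<gamma> (at t)))"

definition Lagrangian_immersion :: "(real ^ 'n) set \<Rightarrow> (real ^ 'n \<Rightarrow> complex ^ 'n) \<Rightarrow> bool" where
  "Lagrangian_immersion A \<Phi> \<longleftrightarrow>
     smooth_on A \<Phi> \<and> \<Phi> ` A \<subseteq> Cstar \<and>
     (\<forall>x\<in>A. inj (frechet_derivative \<Phi> (at x)) \<and>
        (\<forall>a b. symp (\<Phi> x) (frechet_derivative \<Phi> (at x) a) (frechet_derivative \<Phi> (at x) b) = 0))"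

definition Lagrangian_submanifold :: "(complex ^ 'n) set \<Rightarrow> bool" where
  "Lagrangian_submanifold M \<longleftrightarrow>
     (\<forall>z\<in>M. \<exists>B A \<Phi> \<Psi>. open B \<and> z \<in> B \<and> Lagrangian_immersion A \<Phi> \<and>
        homeomorphism A (M \<inter> B) \<Phi> \<Psi>)"

text \<open>\<open>D\<close> is a closed Lagrangian disk whose boundary is the loop \<open>\<gamma>\<close> (parametrised by \<open>[0,1]\<close>).
  It is parametrised by a closed topological disk \<open>K\<close> in the plane.  The parametrisation extends to
  a Lagrangian immersion past the boundary of \<open>K\<close>, except at finitely many boundary points:
  the disk is allowed to have corners because \<open>\<gamma>\<close> may have some; there it is only Lipschitz.
  The interior is embedded; points of the disk are identified only if \<open>\<gamma>\<close> takes the same value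
  twice.\<close>

definition Lagrangian_disk :: "(complex ^ 2) set \<Rightarrow> (real \<Rightarrow> complex ^ 2) \<Rightarrow> bool" where
  "Lagrangian_disk D \<gamma> \<longleftrightarrow>
     (\<exists>K A Z \<Phi> h h' C. homeomorphism (cball (0::complex) 1) K h h' \<and> open A \<and> K \<subseteq> A \<and>
        finite Z \<and> Z \<subseteq> h ` sphere 0 1 \<and>
        C-lipschitz_on A \<Phi> \<and> Lagrangian_immersion (A - Z) \<Phi> \<and>
        (\<forall>x\<in>h ` ball 0 1. \<forall>y\<in>K. \<Phi> x = \<Phi> y \<longrightarrow> x = y) \<and>
        D = \<Phi> ` K \<and>
        (\<forall>t\<in>{0..1}. \<Phi> (h (cis (2 * pi * t))) = \<gamma> t))"

section \<open>Dual dimers\<close>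

definition vertices :: "(real ^ 'n) set \<Rightarrow> (real ^ 'n) set" where
  "vertices \<Delta> = {p. p extreme_point_of \<Delta>}"

definition edge_dirs :: "(real ^ 'n) set \<Rightarrow> real ^ 'n \<Rightarrow> (real ^ 'n) set" where
  "edge_dirs \<Delta> p = {sgn (x - p) | x l. l edge_of \<Delta> \<and> p \<in> l \<and> x \<in> l \<and> x \<noteq> p}"

text \<open>White polytopes \<open>Pw v\<close> for \<open>v \<in> V\<close> and black polytopes \<open>Pb w\<close> for \<open>w \<in> W\<close>.\<close>

definition dual_dimer ::
  "'v set \<Rightarrow> ('v \<Rightarrow> (real ^ 'n) set) \<Rightarrow> 'w set \<Rightarrow> ('w \<Rightarrow> (real ^ 'n) set) \<Rightarrow> bool" where
  "dual_dimer V Pw W Pb \<longleftrightarrow>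
     finite V \<and> finite W \<and>
     (\<forall>v\<in>V. polytope (Pw v) \<and> aff_dim (Pw v) = int CARD('n)) \<and>
     (\<forall>w\<in>W. polytope (Pb w) \<and> aff_dim (Pb w) = int CARD('n)) \<and>
     inj_on torus (\<Union>v\<in>V. vertices (Pw v)) \<and>
     inj_on torus (\<Union>w\<in>W. vertices (Pb w)) \<and>
     torus ` (\<Union>v\<in>V. vertices (Pw v)) = torus ` (\<Union>w\<in>W. vertices (Pb w)) \<and>
     (\<forall>v\<in>V. \<forall>w\<in>W. \<forall>p1\<in>vertices (Pw v). \<forall>p2\<in>vertices (Pb w).
        torus p1 = torus p2 \<longrightarrow> edge_dirs (Pb w) p2 = uminus ` edge_dirs (Pw v) p1)"

text \<open>The edge \<open>(w, p2, v, p1)\<close> joins the black polytope \<open>w\<close> to the white polytope \<open>v\<close> through the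
  vertex \<open>p2\<close> of \<open>Pb w\<close>, which agrees modulo \<open>\<int>\<^sup>n\<close> with the vertex \<open>p1\<close> of \<open>Pw v\<close>.\<close>

type_synonym ('v, 'w, 'n) edge = "'w \<times> (real ^ 'n) \<times> 'v \<times> (real ^ 'n)"

definition edges ::
  "'v set \<Rightarrow> ('v \<Rightarrow> (real ^ 'n) set) \<Rightarrow> 'w set \<Rightarrow> ('w \<Rightarrow> (real ^ 'n) set) \<Rightarrow> ('v, 'w, 'n) edge set" where
  "edges V Pw W Pb =
     {(w, p2, v, p1) | w p2 v p1. w \<in> W \<and> v \<in> V \<and> p2 \<in> vertices (Pb w) \<and> p1 \<in> vertices (Pw v) \<and>
        torus p2 = torus p1}"

text \<open>A realisation of the graph in the torus.  The vertices lie at interior points \<open>xw v\<close>, \<open>xb w\<close> of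
  the polytopes.  The edge \<open>(w, p2, v, p1)\<close> is the image in the torus of the path \<open>\<alpha>\<close> on \<open>[0,1]\<close>,
  which runs inside \<open>Pb w\<close> from \<open>xb w\<close> to \<open>p2\<close>, and then inside the translate of \<open>Pw v\<close> that has
  \<open>p2\<close> as a vertex.\<close>

definition edge_arc ::
  "('v \<Rightarrow> (real ^ 'n) set) \<Rightarrow> ('w \<Rightarrow> (real ^ 'n) set) \<Rightarrow> ('v \<Rightarrow> real ^ 'n) \<Rightarrow> ('w \<Rightarrow> real ^ 'n) \<Rightarrow>
   ('v, 'w, 'n) edge \<Rightarrow> (real \<Rightarrow> real ^ 'n) \<Rightarrow> bool" where
  "edge_arc Pw Pb xw xb e \<alpha> \<longleftrightarrow>
     (case e of (w, p2, v, p1) \<Rightarrow>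
        smooth_on UNIV \<alpha> \<and> (\<forall>t\<in>{0..1}. vector_derivative \<alpha> (at t) \<noteq> 0) \<and>
        \<alpha> 0 = xb w \<and> \<alpha> 1 = xw v + (p2 - p1) \<and>
        (\<exists>s\<in>{0<..<1}. \<alpha> s = p2 \<and> \<alpha> ` {0..<s} \<subseteq> interior (Pb w) \<and>
           \<alpha> ` {s<..1} \<subseteq> (+) (p2 - p1) ` interior (Pw v)))"

text \<open>The realisation is an embedding: edges meet only at common end points, and different edges leave
  a common end point in different directions (no cusps).\<close>

definition embedded_graph ::
  "'v set \<Rightarrow> ('v \<Rightarrow> (real ^ 'n) set) \<Rightarrow> 'w set \<Rightarrow> ('w \<Rightarrow> (real ^ 'n) set) \<Rightarrow>
   ('v \<Rightarrow> real ^ 'n) \<Rightarrow> ('w \<Rightarrow> real ^ 'n) \<Rightarrow> (('v, 'w, 'n) edge \<Rightarrow> real \<Rightarrow> real ^ 'n) \<Rightarrow> bool" where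
  "embedded_graph V Pw W Pb xw xb epath \<longleftrightarrow>
     (\<forall>v\<in>V. xw v \<in> interior (Pw v)) \<and> (\<forall>w\<in>W. xb w \<in> interior (Pb w)) \<and>
     (\<forall>e\<in>edges V Pw W Pb. edge_arc Pw Pb xw xb e (epath e)) \<and>
     (\<forall>(w, p2, v, p1)\<in>edges V Pw W Pb. \<forall>(w', p2', v', p1')\<in>edges V Pw W Pb.
        let e = (w, p2, v, p1); e' = (w', p2', v', p1') in
        (\<forall>t\<in>{0..1}. \<forall>t'\<in>{0..1}. torus (epath e t) = torus (epath e' t') \<longrightarrow>
           e = e' \<and> t = t' \<or> w = w' \<and> t = 0 \<and> t' = 0 \<or> v = v' \<and> t = 1 \<and> t' = 1) \<and>
        (e \<noteq> e' \<and> w = w' \<longrightarrow>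
           sgn (vector_derivative (epath e) (at 0)) \<noteq> sgn (vector_derivative (epath e') (at 0))) \<and>
        (e \<noteq> e' \<and> v = v' \<longrightarrow>
           sgn (vector_derivative (epath e) (at 1)) \<noteq> sgn (vector_derivative (epath e') (at 1))))"

definition graph_set ::
  "('v, 'w, 'n) edge set \<Rightarrow> (('v, 'w, 'n) edge \<Rightarrow> real \<Rightarrow> real ^ 'n) \<Rightarrow> (complex ^ 'n) set" where
  "graph_set E epath = (\<Union>e\<in>E. torus ` epath e ` {0..1})"

definition faces ::
  "('v, 'w, 'n) edge set \<Rightarrow> (('v, 'w, 'n) edge \<Rightarrow> real \<Rightarrow> real ^ 'n) \<Rightarrow> (complex ^ 'n) set set" where
  "faces E epath = components (range torus - graph_set E epath)"

text \<open>A cycle is a list of edges with a direction; \<open>True\<close> means traversed from black to white.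
  \<open>cycle_path epath c\<close> traverses the \<open>i\<close>-th edge while the parameter runs through
  \<open>[i / length c, (i + 1) / length c]\<close>.\<close>

definition step_path ::
  "(('v, 'w, 'n) edge \<Rightarrow> real \<Rightarrow> real ^ 'n) \<Rightarrow> ('v, 'w, 'n) edge \<times> bool \<Rightarrow> real \<Rightarrow> complex ^ 'n" where
  "step_path epath s t = torus (epath (fst s) (if snd s then t else 1 - t))"

definition closed_walk ::
  "('v, 'w, 'n) edge set \<Rightarrow> (('v, 'w, 'n) edge \<Rightarrow> real \<Rightarrow> real ^ 'n) \<Rightarrow>
   (('v, 'w, 'n) edge \<times> bool) list \<Rightarrow> bool" where
  "closed_walk E epath c \<longleftrightarrow>
     c \<noteq> [] \<and> fst ` set c \<subseteq> E \<and>
     (\<forall>i<length c. step_path epath (c ! i) 1 = step_path epath (c ! (Suc i mod length c)) 0)"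

definition cycle_path ::
  "(('v, 'w, 'n) edge \<Rightarrow> real \<Rightarrow> real ^ 'n) \<Rightarrow> (('v, 'w, 'n) edge \<times> bool) list \<Rightarrow> real \<Rightarrow> complex ^ 'n"
  where
  "cycle_path epath c t =
     (let x = real (length c) * t
      in step_path epath (c ! (nat \<lfloor>x\<rfloor> mod length c)) (frac x))"

text \<open>\<open>c\<close> is the boundary cycle of the face \<open>f\<close>: the face is covered by the interior of a closed disk in
  the universal cover \<open>\<real>\<^sup>2\<close>, and \<open>c\<close> is the image of the boundary of this disk.
  In the torus, \<open>c\<close> may pass several times through the same point, e.g. if the graph has one face.\<close>

definition boundary_cycle ::
  "('v, 'w, 2) edge set \<Rightarrow> (('v, 'w, 2) edge \<Rightarrow> real \<Rightarrow> real ^ 2) \<Rightarrow>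
   (complex ^ 2) set \<Rightarrow> (('v, 'w, 2) edge \<times> bool) list \<Rightarrow> bool" where
  "boundary_cycle E epath f c \<longleftrightarrow>
     closed_walk E epath c \<and>
     (\<exists>h :: complex \<Rightarrow> real ^ 2. continuous_on (cball 0 1) h \<and> inj_on h (cball 0 1) \<and>
        torus ` h ` ball 0 1 = f \<and>
        (\<forall>t\<in>{0..1}. torus (h (cis (2 * pi * t))) = cycle_path epath c t))"

section \<open>Dimer Lagrangians\<close>

definition phi_white :: "(real ^ 'n) set \<Rightarrow> real ^ 'n \<Rightarrow> real" where
  "phi_white \<Delta> q = (SUP p\<in>\<Delta>. p \<bullet> q)"

definition phi_black :: "(real ^ 'n) set \<Rightarrow> real ^ 'n \<Rightarrow> real" where
  "phi_black \<Delta> q = (INF p\<in>\<Delta>. p \<bullet> q)"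

definition smoothing_kernel :: "real \<Rightarrow> (real ^ 'n \<Rightarrow> real) \<Rightarrow> bool" where
  "smoothing_kernel R \<rho> \<longleftrightarrow>
     R > 0 \<and> smooth_on UNIV \<rho> \<and> (\<forall>x. \<rho> x \<ge> 0) \<and> (\<forall>x. R \<le> norm x \<longrightarrow> \<rho> x = 0) \<and>
     integral\<^sup>L lborel \<rho> = 1"

definition smoothing :: "(real ^ 'n \<Rightarrow> real) \<Rightarrow> (real ^ 'n \<Rightarrow> real) \<Rightarrow> real ^ 'n \<Rightarrow> real" where
  "smoothing \<rho> \<phi> q =
     (\<integral>x. \<rho> x * \<phi> (q - x) \<partial>lborel) - (\<integral>x. \<rho> x * \<phi> (- x) \<partial>lborel)"

text \<open>The part over \<open>A\<close> of the section \<open>d\<phi>\<close>.\<close>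

definition graph_over :: "(real ^ 'n \<Rightarrow> real) \<Rightarrow> (real ^ 'n) set \<Rightarrow> (complex ^ 'n) set" where
  "graph_over \<phi> A = {from_coords q p | q p. q \<in> A \<and> (GDERIV \<phi> q :> p)}"

text \<open>The region \<open>U\<^sub>e\<close> of the edge \<open>e\<close>.\<close>

definition linear_cone ::
  "('v \<Rightarrow> (real ^ 'n) set) \<Rightarrow> ('w \<Rightarrow> (real ^ 'n) set) \<Rightarrow> ('v, 'w, 'n) edge \<Rightarrow> (real ^ 'n) set" where
  "linear_cone Pw Pb e =
     (case e of (w, p2, v, p1) \<Rightarrow> {q. phi_black (Pb w) q = p2 \<bullet> q \<and> phi_white (Pw v) q = p1 \<bullet> q})"

definition overlap ::
  "('v \<Rightarrow> (real ^ 'n) set) \<Rightarrow> ('w \<Rightarrow> (real ^ 'n) set) \<Rightarrow> real \<Rightarrow> ('v, 'w, 'n) edge \<Rightarrow> (real ^ 'n) set"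
  where
  "overlap Pw Pb R e = {q. \<forall>y. y \<notin> linear_cone Pw Pb e \<longrightarrow> R \<le> dist q y}"

text \<open>A Lagrangian neck \<open>N\<close> of size \<open>\<epsilon>\<close> for the surgery of the sections \<open>d\<phi>\<^sub>0\<close> and \<open>d\<phi>\<^sub>1\<close> along \<open>U\<close>:
  a Lagrangian submanifold homeomorphic to \<open>\<partial>U \<times> (0,1)\<close>, lying over the \<open>\<epsilon>\<close>-neighbourhood of
  \<open>\<partial>U\<close>, whose two ends are the parts of the two sections over a collar
  \<open>\<delta> < dist(q, U) < \<epsilon>\<close>.  As the ends are open in the sections, the neck is glued smoothly
  to them.\<close>

definition Lagrangian_neck ::
  "(real ^ 'n) set \<Rightarrow> (real ^ 'n \<Rightarrow> real) \<Rightarrow> (real ^ 'n \<Rightarrow> real) \<Rightarrow> real \<Rightarrow> (complex ^ 'n) set \<Rightarrow> bool"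
  where
  "Lagrangian_neck U \<phi>\<^sub>0 \<phi>\<^sub>1 \<epsilon> N \<longleftrightarrow>
     Lagrangian_submanifold N \<and>
     (\<forall>z\<in>N. infdist (val z) (frontier U) < \<epsilon>) \<and>
     (\<exists>\<delta> k k'. 0 < \<delta> \<and> \<delta> < \<epsilon> \<and>
        homeomorphism (frontier U \<times> {0<..<1::real}) N k k' \<and>
        k ` (frontier U \<times> {0<..<1/3}) = graph_over \<phi>\<^sub>0 {q. \<delta> < infdist q U \<and> infdist q U < \<epsilon>} \<and>
        k ` (frontier U \<times> {2/3<..<1}) = graph_over \<phi>\<^sub>1 {q. \<delta> < infdist q U \<and> infdist q U < \<epsilon>} \<and>
        (\<forall>z \<in> k ` (frontier U \<times> {1/3..2/3}). infdist (val z) U \<le> \<delta>))"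

text \<open>\<open>L\<close> is obtained from the sections by removing the \<open>\<epsilon>\<close>-neighbourhoods of all the \<open>U\<^sub>e\<close> and
  gluing in a neck for each edge.  Distinct overlap regions of one polytope have distance at least
  \<open>2 R\<close>, so the bound \<open>\<epsilon> < R\<close> keeps the necks at different edges apart.\<close>

definition dimer_Lagrangian ::
  "'v set \<Rightarrow> ('v \<Rightarrow> (real ^ 'n) set) \<Rightarrow> 'w set \<Rightarrow> ('w \<Rightarrow> (real ^ 'n) set) \<Rightarrow>
   real \<Rightarrow> (real ^ 'n \<Rightarrow> real) \<Rightarrow> (complex ^ 'n) set \<Rightarrow> bool" where
  "dimer_Lagrangian V Pw W Pb R \<rho> L \<longleftrightarrow>
     (\<exists>\<epsilon> N. 0 < \<epsilon> \<and> \<epsilon> < R \<and>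
        (\<forall>(w, p2, v, p1)\<in>edges V Pw W Pb.
           Lagrangian_neck (overlap Pw Pb R (w, p2, v, p1))
             (smoothing \<rho> (phi_black (Pb w))) (smoothing \<rho> (phi_white (Pw v)))
             \<epsilon> (N (w, p2, v, p1))) \<and>
        L = (\<Union>w\<in>W. graph_over (smoothing \<rho> (phi_black (Pb w)))
               {q. \<forall>p2 v p1. (w, p2, v, p1) \<in> edges V Pw W Pb \<longrightarrow>
                     \<epsilon> \<le> infdist q (overlap Pw Pb R (w, p2, v, p1))})
          \<union> (\<Union>v\<in>V. graph_over (smoothing \<rho> (phi_white (Pw v)))
               {q. \<forall>w p2 p1. (w, p2, v, p1) \<in> edges V Pw W Pb \<longrightarrow>
                     \<epsilon> \<le> infdist q (overlap Pw Pb R (w, p2, v, p1))})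
          \<union> (\<Union>e\<in>edges V Pw W Pb. N e))"

section \<open>Lifts and weights\<close>

definition lifts_to :: "(complex ^ 'n) set \<Rightarrow> (real \<Rightarrow> complex ^ 'n) \<Rightarrow> (real \<Rightarrow> complex ^ 'n) \<Rightarrow> bool" where
  "lifts_to L c \<gamma> \<longleftrightarrow>
     piecewise_smooth_path \<gamma> \<and> (\<forall>t\<in>{0..1}. \<gamma> t \<in> L \<and> arg_torus (\<gamma> t) = c t)"

text \<open>\<open>\<ww> e\<close> is the integral of \<open>\<eta>\<close> over any lift of the edge \<open>e\<close>, oriented from black to white.\<close>

definition edge_weights ::
  "('v, 'w, 'n) edge set \<Rightarrow> (('v, 'w, 'n) edge \<Rightarrow> real \<Rightarrow> real ^ 'n) \<Rightarrow> (complex ^ 'n) set \<Rightarrow>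
   (('v, 'w, 'n) edge \<Rightarrow> real) \<Rightarrow> bool" where
  "edge_weights E epath L \<ww> \<longleftrightarrow>
     (\<forall>e\<in>E. \<forall>\<gamma>. lifts_to L (\<lambda>t. torus (epath e t)) \<gamma> \<longrightarrow> \<ww> e = eta_integral \<gamma>)"

definition cycle_weight ::
  "(('v, 'w, 'n) edge \<Rightarrow> real) \<Rightarrow> (('v, 'w, 'n) edge \<times> bool) list \<Rightarrow> real" where
  "cycle_weight \<ww> c = (\<Sum>(e, b)\<leftarrow>c. if b then \<ww> e else - \<ww> e)"

end

theory Submission
  imports Defs
begin

text \<open>The disk is the graph \<open>q = \<nabla>F(p)\<close> over the lift of the closed face to the universal cover, for a
  function \<open>F\<close> whose gradient on the boundary is prescribed by \<open>val \<circ> \<gamma>\<close>; it is Lagrangian because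
  the Hessian is symmetric, and the torus is injective on the lifted open face.  On the boundary,
  \<open>F\<close> has to be a primitive of \<open>q \<cdot> dp\<close> along \<open>\<gamma>\<close>, which is single-valued because the weight of
  the cycle vanishes.  Along a smooth arc \<open>F\<close> is extended by its first-order Taylor expansion in the
  normal direction.  At a corner the expansions of the two arcs have the same 1-jet and, as there
  are no cusps, can be blended by a cutoff that depends only on the angle: this leaves \<open>\<nabla>F\<close>
  Lipschitz at the corner and smooth elsewhere.  Finitely many such local extensions are glued
  by cutoff functions, since all of them have the same 1-jet along the loop.\<close>

section \<open>Calculus of smooth maps\<close>

text \<open>Every time \<open>t\<close> of the loop is treated as a corner with two one-sided germs,
  one leaving and one run backwards, with nonzero tangents \<open>u\<close>, \<open>v\<close> and
  \<open>sgn u \<noteq> sgn v\<close>; inside an edge simply \<open>v = - u\<close>. Break points of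
  the lift in the middle of an edge are thereby handled like vertices of the graph, and compactness
  of the loop leaves finitely many exceptional points.

  The regularity C^{1,1} is dictated by \<open>Lagrangian_disk\<close>: the disk is the image of p
  under p -> (grad F p, p), so a Lipschitz gradient is exactly what a corner may have. An angular
  cutoff is singular at the corner, but it multiplies the difference of two expansions, which
  vanishes there to second order and absorbs the singularity.

  The map \<open>h\<close> of the closed disk is merely continuous. The smoothness of the lifted
  loop comes from the edges: over each step of the walk the loop is a translate of the smooth path
  of that edge, because two lifts of one path to the universal cover differ by a constant.\<close>

lemma C_k_cong:
  assumes "open S" "\<And>x. x \<in> S \<Longrightarrow> f x = g x"
  shows "C_k k S f \<longleftrightarrow> C_k k S g"
  using assms(2)
proof (induction k arbitrary: f g)
  case 0
  then show ?case by (auto intro: continuous_on_cong)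
next
  case (Suc k)
  have der: "(f has_derivative D) (at x) \<longleftrightarrow> (g has_derivative D) (at x)" if "x \<in> S" for x D
    using Suc.prems assms(1) that
    by (metis has_derivative_transform_within_open)
  have "f differentiable_on S \<longleftrightarrow> g differentiable_on S"
    unfolding differentiable_on_eq_differentiable_at[OF assms(1)] differentiable_def using der by auto
  moreover have fr: "frechet_derivative f (at x) = frechet_derivative g (at x)" if "x \<in> S" for x
    unfolding frechet_derivative_def using der[OF that] by simp
  moreover have "C_k k S (\<lambda>x. frechet_derivative f (at x) i) \<longleftrightarrow>
      C_k k S (\<lambda>x. frechet_derivative g (at x) i)" for i
    by (intro Suc.IH) (auto simp: fr)
  ultimately show ?case by simp
qed

lemma C_k_SucI:
  assumes "open S" "\<And>x. x \<in> S \<Longrightarrow> (f has_derivative f' x) (at x)"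
    "\<And>i. i \<in> Basis \<Longrightarrow> C_k k S (\<lambda>x. f' x i)"
  shows "C_k (Suc k) S f"
proof -
  have "f differentiable_on S"
    unfolding differentiable_on_eq_differentiable_at[OF assms(1)] differentiable_def
    using assms(2) by auto
  moreover have "C_k k S (\<lambda>x. frechet_derivative f (at x) i)" if "i \<in> Basis" for i
    using assms(3)[OF that] C_k_cong[OF assms(1), of "\<lambda>x. f' x i" "\<lambda>x. frechet_derivative f (at x) i" k]
      frechet_derivative_at[OF assms(2)] by auto
  ultimately show ?thesis by simp
qed

lemma C_k_Suc_has_derivative:
  assumes "open S" "C_k (Suc k) S f" "x \<in> S"
  shows "(f has_derivative frechet_derivative f (at x)) (at x)"
  using assms differentiable_on_eq_differentiable_at[OF assms(1)] frechet_derivative_works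
  by auto

lemma C_k_Suc: "C_k (Suc k) S f \<Longrightarrow> C_k k S f"
  by (induction k arbitrary: f) (auto simp: differentiable_imp_continuous_on)

lemma C_k_subset: "C_k k S f \<Longrightarrow> T \<subseteq> S \<Longrightarrow> C_k k T f"
  by (induction k arbitrary: f) (auto intro: continuous_on_subset differentiable_on_subset)

lemma C_k_local:
  assumes "open S" "\<And>x. x \<in> S \<Longrightarrow> \<exists>T. open T \<and> x \<in> T \<and> C_k k T f"
  shows "C_k k S f"
  using assms(2)
proof (induction k arbitrary: f)
  case 0
  then have "isCont f x" if "x \<in> S" for x
    using that by (metis C_k.simps(1) continuous_on_eq_continuous_at)
  then show ?case by (simp add: continuous_at_imp_continuous_on)
next
  case (Suc k)
  have "f differentiable (at x)" if "x \<in> S" for x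
    using Suc.prems[OF that] differentiable_on_eq_differentiable_at by auto
  then have "f differentiable_on S"
    using differentiable_on_eq_differentiable_at[OF assms(1)] by auto
  moreover have "C_k k S (\<lambda>x. frechet_derivative f (at x) i)" if "i \<in> Basis" for i
    using Suc.prems that by (intro Suc.IH) fastforce
  ultimately show ?case by simp
qed

lemma C_k_const: "C_k k S (\<lambda>x. c)"
proof (induction k arbitrary: c)
  case (Suc k)
  show ?case using Suc by auto
qed auto

lemma C_k_bounded_linear:
  assumes "bounded_linear A" "open S" "C_k k S f"
  shows "C_k k S (\<lambda>x. A (f x))"
  using assms(3)
proof (induction k arbitrary: f)
  case 0
  then show ?case using bounded_linear.continuous_on[OF assms(1)] by simp
next
  case (Suc k)
  show ?case
  proof (rule C_k_SucI[OF assms(2)])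
    show "((\<lambda>x. A (f x)) has_derivative (\<lambda>v. A (frechet_derivative f (at x) v))) (at x)"
      if "x \<in> S" for x
      using bounded_linear.has_derivative[OF assms(1) C_k_Suc_has_derivative[OF assms(2) Suc.prems that]] .
    show "C_k k S (\<lambda>x. A (frechet_derivative f (at x) i))" if "i \<in> Basis" for i
      using Suc.prems that by (intro Suc.IH) auto
  qed
qed

lemma C_k_id: "open S \<Longrightarrow> C_k k S (\<lambda>x. x)"
proof (cases k)
  case (Suc j)
  assume "open S"
  then show ?thesis unfolding Suc
    by (intro C_k_SucI[where f' = "\<lambda>x v. v"]) (auto intro: C_k_const)
qed auto

lemma C_k_add:
  assumes "open S" "C_k k S f" "C_k k S g"
  shows "C_k k S (\<lambda>x. f x + g x)"
  using assms(2,3)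
proof (induction k arbitrary: f g)
  case 0
  then show ?case by (auto intro: continuous_on_add)
next
  case (Suc k)
  show ?case
    by (rule C_k_SucI[OF assms(1)], rule has_derivative_add
        [OF C_k_Suc_has_derivative[OF assms(1) Suc.prems(1)] C_k_Suc_has_derivative[OF assms(1) Suc.prems(2)]])
      (use Suc in auto)
qed

lemma C_k_bilinear:
  assumes "bounded_bilinear B" "open S" "C_k k S f" "C_k k S g"
  shows "C_k k S (\<lambda>x. B (f x) (g x))"
  using assms(3,4)
proof (induction k arbitrary: f g)
  case 0
  then show ?case using bounded_bilinear.continuous_on[OF assms(1)] by auto
next
  case (Suc k)
  have C: "C_k k S f" "C_k k S g" using Suc.prems C_k_Suc by blast+
  show ?case
    by (rule C_k_SucI[OF assms(2)], rule bounded_bilinear.FDERIV[OF assms(1)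
        C_k_Suc_has_derivative[OF assms(2) Suc.prems(1)] C_k_Suc_has_derivative[OF assms(2) Suc.prems(2)]])
      (use Suc C in \<open>auto intro!: C_k_add[OF assms(2)]\<close>)
qed

lemma C_k_sum:
  assumes "open S" "\<And>i. i \<in> I \<Longrightarrow> C_k k S (f i)"
  shows "C_k k S (\<lambda>x. \<Sum>i\<in>I. f i x)"
  using assms(2)
  by (induction I rule: infinite_finite_induct) (auto intro!: C_k_const C_k_add[OF assms(1)])

lemma linear_Basis_expansion:
  assumes "linear f"
  shows "f w = (\<Sum>j\<in>Basis. (w \<bullet> j) *\<^sub>R f j)"
proof -
  have "f w = f (\<Sum>j\<in>Basis. (w \<bullet> j) *\<^sub>R j)"
    by (simp only: euclidean_representation)
  also have "\<dots> = (\<Sum>j\<in>Basis. (w \<bullet> j) *\<^sub>R f j)"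
    by (simp only: linear_sum[OF assms] linear_scale[OF assms])
  finally show ?thesis .
qed

text \<open>\<open>C_k\<close> speaks of derivatives along \<open>Basis\<close> only, so the chain
  rule is expanded in coordinates: each factor \<open>?f' (g x) j\<close> is again a composition
  with the same \<open>g\<close>. Hence the induction generalises over \<open>f\<close>
  alone.\<close>

lemma C_k_compose:
  fixes g :: "'a::euclidean_space \<Rightarrow> 'b::euclidean_space"
  assumes "open S" "open T" "g ` S \<subseteq> T" "C_k k T f" "C_k k S g"
  shows "C_k k S (\<lambda>x. f (g x))"
  using assms(4,5)
proof (induction k arbitrary: f)
  case 0
  then show ?case using assms(3) by (auto intro: continuous_on_compose2)
next
  case (Suc k)
  let ?f' = "\<lambda>y. frechet_derivative f (at y)" and ?g' = "\<lambda>x. frechet_derivative g (at x)"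
  show ?case
  proof (rule C_k_SucI[OF assms(1)])
    fix x assume x: "x \<in> S"
    show "((\<lambda>x. f (g x)) has_derivative (\<lambda>v. \<Sum>j\<in>Basis. (?g' x v \<bullet> j) *\<^sub>R ?f' (g x) j)) (at x)"
    proof -
      have f: "(f has_derivative ?f' (g x)) (at (g x))"
        by (rule C_k_Suc_has_derivative[OF assms(2) Suc.prems(1)]) (use x assms(3) in auto)
      have "(\<lambda>v. ?f' (g x) (?g' x v)) = (\<lambda>v. \<Sum>j\<in>Basis. (?g' x v \<bullet> j) *\<^sub>R ?f' (g x) j)"
        by (rule ext, rule linear_Basis_expansion[OF has_derivative_linear[OF f]])
      then show ?thesis
        using has_derivative_compose[OF C_k_Suc_has_derivative[OF assms(1) Suc.prems(2) x] f]
        by (simp only:)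
    qed
  next
    fix i :: 'a assume i: "i \<in> Basis"
    have "C_k k S (\<lambda>x. ?f' (g x) j)" if "j \<in> Basis" for j
      using Suc.prems(1) that C_k_Suc[OF Suc.prems(2)] by (intro Suc.IH) auto
    then show "C_k k S (\<lambda>x. \<Sum>j\<in>Basis. (?g' x i \<bullet> j) *\<^sub>R ?f' (g x) j)"
      using Suc.prems(2) i
      by (intro C_k_sum[OF assms(1)] C_k_bilinear[OF bounded_bilinear_scaleR assms(1)]
          C_k_bounded_linear[OF bounded_linear_inner_left assms(1)]) auto
  qed
qed

section \<open>Smooth maps on open sets and their closure properties\<close>

lemma smooth_on_open: "smooth_on S f \<Longrightarrow> open S"
  by (simp add: smooth_on_def)

lemma smooth_on_cong:
  "open S \<Longrightarrow> (\<And>x. x \<in> S \<Longrightarrow> f x = g x) \<Longrightarrow> smooth_on S f \<longleftrightarrow> smooth_on S g"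
  unfolding smooth_on_def using C_k_cong by blast

lemma smooth_on_subset: "smooth_on S f \<Longrightarrow> open T \<Longrightarrow> T \<subseteq> S \<Longrightarrow> smooth_on T f"
  unfolding smooth_on_def using C_k_subset by blast

lemma smooth_on_local:
  assumes "open S" "\<And>x. x \<in> S \<Longrightarrow> \<exists>T. x \<in> T \<and> smooth_on T f"
  shows "smooth_on S f"
  unfolding smooth_on_def using assms
  by (auto intro!: C_k_local[OF assms(1)] simp: smooth_on_def)

lemma smooth_on_has_derivative:
  "smooth_on S f \<Longrightarrow> x \<in> S \<Longrightarrow> (f has_derivative frechet_derivative f (at x)) (at x)"
  unfolding smooth_on_def using C_k_Suc_has_derivative by blast

lemma smooth_on_continuous_on: "smooth_on S f \<Longrightarrow> continuous_on S f"
  unfolding smooth_on_def by (metis C_k.simps(1))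

lemma smooth_on_derivI:
  assumes "open S" "\<And>x. x \<in> S \<Longrightarrow> (f has_derivative f' x) (at x)"
    "\<And>i. i \<in> Basis \<Longrightarrow> smooth_on S (\<lambda>x. f' x i)"
  shows "smooth_on S f"
proof -
  have "C_k k S f" for k
    by (rule C_k_Suc, rule C_k_SucI[OF assms(1,2)]) (use assms(3) in \<open>auto simp: smooth_on_def\<close>)
  then show ?thesis using assms(1) by (simp add: smooth_on_def)
qed

text \<open>For functions that solve a differential equation: if \<open>f'\<close> is built from
  \<open>f\<close> without loss of regularity, every round gains one derivative. Reciprocals, the
  norm, \<open>exp\<close>, \<open>cis\<close> and inverse functions become smooth in this
  way.\<close>

lemma smooth_on_bootstrap:
  assumes "open S" "\<And>x. x \<in> S \<Longrightarrow> (f has_derivative f' x) (at x)"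
    "\<And>i k. i \<in> Basis \<Longrightarrow> C_k k S f \<Longrightarrow> C_k k S (\<lambda>x. f' x i)"
  shows "smooth_on S f"
proof -
  have "C_k k S f" for k
  proof (induction k)
    case 0
    show ?case
      using assms(2) by (auto intro!: continuous_at_imp_continuous_on has_derivative_continuous)
  next
    case (Suc k)
    show ?case by (rule C_k_SucI[OF assms(1,2)]) (use assms(3) Suc in auto)
  qed
  then show ?thesis using assms(1) by (simp add: smooth_on_def)
qed

lemma smooth_on_const: "open S \<Longrightarrow> smooth_on S (\<lambda>x. c)"
  by (simp add: smooth_on_def C_k_const)

lemma smooth_on_id: "open S \<Longrightarrow> smooth_on S (\<lambda>x. x)"
  by (simp add: smooth_on_def C_k_id)

lemma smooth_on_bounded_linear:
  "bounded_linear A \<Longrightarrow> smooth_on S f \<Longrightarrow> smooth_on S (\<lambda>x. A (f x))"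
  by (auto simp: smooth_on_def intro: C_k_bounded_linear)

lemma smooth_on_bilinear:
  "bounded_bilinear B \<Longrightarrow> smooth_on S f \<Longrightarrow> smooth_on S g \<Longrightarrow> smooth_on S (\<lambda>x. B (f x) (g x))"
  by (auto simp: smooth_on_def intro: C_k_bilinear)

lemma smooth_on_add: "smooth_on S f \<Longrightarrow> smooth_on S g \<Longrightarrow> smooth_on S (\<lambda>x. f x + g x)"
  by (auto simp: smooth_on_def intro: C_k_add)

lemma smooth_on_minus: "smooth_on S f \<Longrightarrow> smooth_on S (\<lambda>x. - f x)"
  by (rule smooth_on_bounded_linear[OF bounded_linear_minus[OF bounded_linear_ident]])

lemma smooth_on_diff: "smooth_on S f \<Longrightarrow> smooth_on S g \<Longrightarrow> smooth_on S (\<lambda>x. f x - g x)"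
  using smooth_on_add[OF _ smooth_on_minus, of S f g] by simp

lemma smooth_on_sum:
  "open S \<Longrightarrow> (\<And>i. i \<in> I \<Longrightarrow> smooth_on S (f i)) \<Longrightarrow> smooth_on S (\<lambda>x. \<Sum>i\<in>I. f i x)"
  by (auto simp: smooth_on_def intro: C_k_sum)

lemmas smooth_on_mult = smooth_on_bilinear[OF bounded_bilinear_mult]
lemmas smooth_on_scaleR = smooth_on_bilinear[OF bounded_bilinear_scaleR]
lemmas smooth_on_inner = smooth_on_bilinear[OF bounded_bilinear_inner]

lemma smooth_on_compose:
  fixes g :: "'a::euclidean_space \<Rightarrow> 'b::euclidean_space"
  shows "smooth_on T f \<Longrightarrow> smooth_on S g \<Longrightarrow> g ` S \<subseteq> T \<Longrightarrow> smooth_on S (\<lambda>x. f (g x))"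
  unfolding smooth_on_def using C_k_compose by blast

lemma smooth_on_frechet_derivative:
  assumes "smooth_on S f"
  shows "smooth_on S (\<lambda>x. frechet_derivative f (at x) v)"
proof -
  have *: "smooth_on S (\<lambda>x. frechet_derivative f (at x) i)" if "i \<in> Basis" for i
    unfolding smooth_on_def
  proof (intro conjI allI)
    show "C_k k S (\<lambda>x. frechet_derivative f (at x) i)" for k
      using assms that C_k.simps(2)[of k S f] unfolding smooth_on_def by blast
  qed (use assms in \<open>simp add: smooth_on_def\<close>)
  have lin: "linear (frechet_derivative f (at x))" if "x \<in> S" for x
    using has_derivative_linear[OF smooth_on_has_derivative[OF assms that]] .
  have "frechet_derivative f (at x) v = (\<Sum>i\<in>Basis. (v \<bullet> i) *\<^sub>R frechet_derivative f (at x) i)"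
    if "x \<in> S" for x
    by (rule linear_Basis_expansion[OF lin[OF that]])
  then have eq: "smooth_on S (\<lambda>x. frechet_derivative f (at x) v) \<longleftrightarrow>
      smooth_on S (\<lambda>x. \<Sum>i\<in>Basis. (v \<bullet> i) *\<^sub>R frechet_derivative f (at x) i)"
    by (rule smooth_on_cong[OF smooth_on_open[OF assms]])
  show ?thesis
    unfolding eq using smooth_on_open[OF assms]
    by (intro smooth_on_sum smooth_on_scaleR smooth_on_const *)
qed

lemma smooth_on_has_vector_derivative:
  assumes "smooth_on S f" "x \<in> S"
  shows "(f has_vector_derivative vector_derivative f (at x)) (at x)"
  using smooth_on_has_derivative[OF assms] differentiableI vector_derivative_works by blast

lemma smooth_on_vector_derivative:
  assumes "smooth_on S f"
  shows "smooth_on S (\<lambda>x. vector_derivative f (at x))"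
proof -
  have eq: "frechet_derivative f (at x) 1 = vector_derivative f (at x)" if "x \<in> S" for x
    using fun_cong[OF frechet_derivative_at[OF smooth_on_has_vector_derivative
        [OF assms that, unfolded has_vector_derivative_def]], of 1] by simp
  show ?thesis
    by (rule iffD1[OF smooth_on_cong[OF smooth_on_open[OF assms] eq] smooth_on_frechet_derivative[OF assms]])
qed

lemma smooth_on_vector_derivI:
  assumes "open S" "\<And>x. x \<in> S \<Longrightarrow> (f has_vector_derivative f' x) (at x)" "smooth_on S f'"
  shows "smooth_on S f"
  by (rule smooth_on_derivI[OF assms(1) assms(2)[unfolded has_vector_derivative_def]])
    (use assms(3) in auto)

section \<open>Smoothness of the elementary functions\<close>

lemma smooth_on_inverse_real: "smooth_on (- {0::real}) inverse"
proof (rule smooth_on_bootstrap)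
  fix k assume "C_k k (- {0::real}) inverse"
  then show "C_k k (- {0}) (\<lambda>x::real. - (inverse x * i * inverse x))" for i
    by (intro C_k_bounded_linear[OF bounded_linear_minus[OF bounded_linear_ident]]
        C_k_bilinear[OF bounded_bilinear_mult] C_k_const) auto
qed (auto intro!: has_derivative_inverse')

lemma smooth_on_inverse:
  fixes f :: "'a::euclidean_space \<Rightarrow> real"
  assumes "smooth_on S f" "\<And>x. x \<in> S \<Longrightarrow> f x \<noteq> 0"
  shows "smooth_on S (\<lambda>x. inverse (f x))"
  by (rule smooth_on_compose[OF smooth_on_inverse_real assms(1)]) (use assms(2) in auto)

lemma smooth_on_divide:
  fixes f g :: "'a::euclidean_space \<Rightarrow> real"
  assumes "smooth_on S f" "smooth_on S g" "\<And>x. x \<in> S \<Longrightarrow> g x \<noteq> 0"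
  shows "smooth_on S (\<lambda>x. f x / g x)"
  unfolding divide_inverse by (intro smooth_on_mult smooth_on_inverse assms)

lemma smooth_on_norm: "smooth_on (- {0::'a::euclidean_space}) norm"
proof (rule smooth_on_bootstrap)
  fix k i assume C: "C_k k (- {0::'a}) norm"
  have "C_k k (- {0::'a}) (\<lambda>x. inverse (norm x))"
    by (rule C_k_compose[where T = "- {0}", OF _ _ _ _ C])
      (use smooth_on_inverse_real in \<open>auto simp: smooth_on_def\<close>)
  then show "C_k k (- {0}) (\<lambda>x::'a. i \<bullet> sgn x)"
    unfolding sgn_div_norm divide_inverse
    by (intro C_k_bilinear[OF bounded_bilinear_inner] C_k_bilinear[OF bounded_bilinear_scaleR]
        C_k_const C_k_id) auto
qed (auto intro!: has_derivative_norm)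

lemma smooth_on_exp: "smooth_on UNIV (exp :: real \<Rightarrow> real)"
  by (rule smooth_on_bootstrap[where f' = "\<lambda>x h. exp x * h"])
    (auto intro!: C_k_bilinear[OF bounded_bilinear_mult] C_k_const
      simp: has_field_derivative_def[symmetric])

lemma smooth_on_ln: "smooth_on {0<..} (ln :: real \<Rightarrow> real)"
proof (rule smooth_on_derivI[where f' = "\<lambda>x. (*) (inverse x)"])
  show "smooth_on {0<..} (\<lambda>x::real. inverse x * i)" for i
    by (intro smooth_on_mult smooth_on_const smooth_on_subset[OF smooth_on_inverse_real]) auto
qed (auto simp: has_field_derivative_def[symmetric] intro!: DERIV_ln)

lemma smooth_on_cis: "smooth_on UNIV cis"
proof (rule smooth_on_bootstrap)
  show "(cis has_derivative (\<lambda>h. h *\<^sub>R (\<i> * cis x))) (at x)" for x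
    using has_derivative_cis[of "\<lambda>x. x" "\<lambda>x. x" x UNIV] by (simp add: mult.assoc)
  show "C_k k UNIV (\<lambda>x. i *\<^sub>R (\<i> * cis x))" if "C_k k UNIV cis" for i k
    using that by (intro C_k_bounded_linear[OF bounded_linear_scaleR_right]
        C_k_bounded_linear[OF bounded_linear_mult_right] open_UNIV)
qed auto

lemma bounded_linear_axis: "bounded_linear (\<lambda>y::'b::real_normed_vector. axis j y :: 'b ^ 'i)"
proof (rule bounded_linear_intro[where K = 1])
  show "norm (axis j y :: 'b ^ 'i) \<le> norm y * 1" for y :: 'b
  proof -
    have "(norm ((axis j y :: 'b ^ 'i) $ i))\<^sup>2 = (if i = j then (norm y)\<^sup>2 else 0)" for i
      by (simp add: axis_def)
    then show ?thesis by (simp add: norm_vec_def L2_set_def)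
  qed
qed (auto simp: axis_def vec_eq_iff)

lemma vec_lambda_eq_sum_axis: "(\<chi> j. f j) = (\<Sum>j\<in>UNIV. axis j (f j :: 'b::real_normed_vector))"
  by (simp add: vec_eq_iff axis_def sum.delta)

lemma smooth_on_vec:
  fixes f :: "'i::finite \<Rightarrow> 'a::euclidean_space \<Rightarrow> 'b::real_normed_vector"
  assumes "open S" "\<And>j. smooth_on S (f j)"
  shows "smooth_on S (\<lambda>x. \<chi> j. f j x)"
  unfolding vec_lambda_eq_sum_axis
  by (intro smooth_on_sum smooth_on_bounded_linear[OF bounded_linear_axis] assms)

lemma smooth_on_vec_nth: "smooth_on S f \<Longrightarrow> smooth_on S (\<lambda>x. f x $ j)"
  by (rule smooth_on_bounded_linear[OF bounded_linear_vec_nth])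

subsection \<open>A smooth step\<close>

text \<open>The polynomial parameter closes the family under differentiation, so that one induction
  proves all members smooth; \<open>exp_recip 1\<close> is the classical flat function
  exp(-1/t).\<close>

definition exp_recip :: "real poly \<Rightarrow> real \<Rightarrow> real" where
  "exp_recip p t = (if t > 0 then poly p (1 / t) * exp (- (1 / t)) else 0)"

lemma exp_recip_tendsto_0: "((\<lambda>t. poly p (1 / t) * exp (- (1 / t))) \<longlongrightarrow> 0) (at_right (0::real))"
proof -
  have 1: "((\<lambda>x::real. x ^ i / exp x) \<longlongrightarrow> 0) at_top" for i
    by (rule tendsto_power_div_exp_0)
  have "((\<lambda>x::real. \<Sum>i\<le>degree p. coeff p i * (x ^ i / exp x)) \<longlongrightarrow> (\<Sum>i\<le>degree p. coeff p i * 0)) at_top"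
    by (intro tendsto_sum tendsto_mult 1 tendsto_const)
  then have "((\<lambda>x::real. poly p x * exp (- x)) \<longlongrightarrow> 0) at_top"
    by (simp add: poly_altdef sum_distrib_right exp_minus divide_inverse mult.assoc)
  from filterlim_compose[OF this filterlim_inverse_at_top_right] show ?thesis
    by (simp add: inverse_eq_divide)
qed

text \<open>With x = 1/t one has d/dt = - x^2 d/dx, which turns p e^(-x) into x^2 (p - p') e^(-x);
  the factor \<open>[:0, 0, 1:]\<close> is x^2. At 0 the right-hand difference quotient is x p(x)
  e^(-x), which tends to 0 as well.\<close>

lemma has_real_derivative_exp_recip:
  "(exp_recip p has_real_derivative exp_recip ([:0, 0, 1:] * (p - pderiv p)) t) (at t)"
proof -
  consider "t > 0" | "t < 0" | "t = 0" by linarith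
  then show ?thesis
  proof cases
    case 1
    have "((\<lambda>t. poly p (1 / t) * exp (- (1 / t))) has_real_derivative
        exp_recip ([:0, 0, 1:] * (p - pderiv p)) t) (at t)"
      using 1 by (auto intro!: derivative_eq_intros simp: exp_recip_def field_simps power2_eq_square)
    then show ?thesis
      by (rule has_field_derivative_transform_within_open[where S = "{0<..}"])
        (use 1 in \<open>auto simp: exp_recip_def\<close>)
  next
    case 2
    have "((\<lambda>t. 0) has_real_derivative 0) (at t)" by simp
    then have "(exp_recip p has_real_derivative 0) (at t)"
      by (rule has_field_derivative_transform_within_open[where S = "{..<0}"])
        (use 2 in \<open>auto simp: exp_recip_def\<close>)
    then show ?thesis using 2 by (simp add: exp_recip_def)
  next
    case 3
    have "((\<lambda>h. exp_recip p h / h) \<longlongrightarrow> 0) (at 0)"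
    proof (rule filterlim_split_at)
      show "((\<lambda>h. exp_recip p h / h) \<longlongrightarrow> 0) (at_left 0)"
        by (rule tendsto_eventually) (auto simp: eventually_at_filter exp_recip_def)
      have "((\<lambda>t. poly ([:0, 1:] * p) (1 / t) * exp (- (1 / t))) \<longlongrightarrow> 0) (at_right (0::real))"
        by (rule exp_recip_tendsto_0)
      then show "((\<lambda>h. exp_recip p h / h) \<longlongrightarrow> 0) (at_right 0)"
        by (rule Lim_transform_eventually) (auto simp: eventually_at_filter exp_recip_def)
    qed
    then show ?thesis using 3 by (simp add: has_field_derivative_iff exp_recip_def)
  qed
qed

lemma smooth_on_exp_recip: "smooth_on UNIV (exp_recip p)"
proof -
  have "C_k k UNIV (exp_recip p)" for k
  proof (induction k arbitrary: p)
    case 0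
    show ?case
      using has_real_derivative_exp_recip[THEN DERIV_continuous]
      by (simp add: continuous_at_imp_continuous_on)
  next
    case (Suc k)
    show ?case
      by (rule C_k_SucI[OF open_UNIV has_real_derivative_exp_recip[unfolded has_field_derivative_def]])
        (use Suc in \<open>auto intro!: C_k_bilinear[OF bounded_bilinear_mult] C_k_const\<close>)
  qed
  then show ?thesis by (simp add: smooth_on_def)
qed

definition smooth_step :: "real \<Rightarrow> real" where
  "smooth_step t = exp_recip 1 t / (exp_recip 1 t + exp_recip 1 (1 - t))"

lemma exp_recip_1: "exp_recip 1 t \<ge> 0" "exp_recip 1 t > 0 \<longleftrightarrow> t > 0" "exp_recip 1 t = 0 \<longleftrightarrow> t \<le> 0"
  by (auto simp: exp_recip_def)

lemma smooth_on_smooth_step: "smooth_on UNIV smooth_step"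
  unfolding smooth_step_def
proof (intro smooth_on_divide smooth_on_add smooth_on_exp_recip)
  show s: "smooth_on UNIV (\<lambda>t. exp_recip 1 (1 - t))"
    by (rule smooth_on_compose[OF smooth_on_exp_recip])
      (auto intro!: smooth_on_diff smooth_on_const smooth_on_id)
  show "exp_recip 1 t + exp_recip 1 (1 - t) \<noteq> 0" for t
    using exp_recip_1[of t] exp_recip_1[of "1 - t"] by linarith
qed

lemma smooth_step_eq: "t \<le> 0 \<Longrightarrow> smooth_step t = 0" "t \<ge> 1 \<Longrightarrow> smooth_step t = 1"
  using exp_recip_1[of t] exp_recip_1[of "1 - t"] by (auto simp: smooth_step_def)

lemma smooth_bump:
  fixes z :: "'a::euclidean_space"
  assumes "0 < r"
  obtains \<beta> :: "'a \<Rightarrow> real" where "smooth_on UNIV \<beta>"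
    "\<And>p. p \<in> ball z (r / 4) \<Longrightarrow> \<beta> p = 1" "\<And>p. p \<notin> ball z (r / 2) \<Longrightarrow> \<beta> p = 0"
proof
  \<comment> \<open>The squared distance is smooth at \<open>z\<close> too. The quotient is
    nonpositive outside radius r/2 and at least 3/2 inside radius r/4.\<close>
  let ?s = "\<lambda>p. smooth_step ((r\<^sup>2 / 4 - (p - z) \<bullet> (p - z)) / (r\<^sup>2 / 8))"
  show "smooth_on UNIV ?s"
    by (intro smooth_on_compose[OF smooth_on_smooth_step] smooth_on_divide smooth_on_diff
        smooth_on_inner smooth_on_const smooth_on_id) (use assms in auto)
  fix p
  show "?s p = 1" if "p \<in> ball z (r / 4)"
  proof (rule smooth_step_eq)
    have "norm (p - z) < r / 4" using that by (simp add: dist_norm norm_minus_commute)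
    then have "(norm (p - z))\<^sup>2 \<le> (r / 4)\<^sup>2" by (intro power_mono) auto
    then show "1 \<le> (r\<^sup>2 / 4 - (p - z) \<bullet> (p - z)) / (r\<^sup>2 / 8)"
      using assms by (simp add: field_simps power2_norm_eq_inner power_divide)
        (use inner_ge_zero[of "p - z"] in linarith)
  qed
  show "?s p = 0" if "p \<notin> ball z (r / 2)"
  proof (rule smooth_step_eq)
    have "r / 2 \<le> norm (p - z)" using that by (simp add: dist_norm norm_minus_commute)
    then have "(r / 2)\<^sup>2 \<le> (norm (p - z))\<^sup>2" using assms by (intro power_mono) auto
    then show "(r\<^sup>2 / 4 - (p - z) \<bullet> (p - z)) / (r\<^sup>2 / 8) \<le> 0"
      using assms by (simp add: field_simps power2_norm_eq_inner power_divide divide_le_0_iff)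
  qed
qed

section \<open>Functions with locally Lipschitz gradient\<close>

definition grad :: "('a::euclidean_space \<Rightarrow> real) \<Rightarrow> 'a \<Rightarrow> 'a" where
  "grad f p = (\<Sum>i\<in>Basis. frechet_derivative f (at p) i *\<^sub>R i)"

lemma grad_eqI:
  assumes "GDERIV f p :> D"
  shows "grad f p = D"
proof -
  have "frechet_derivative f (at p) = (\<lambda>h. h \<bullet> D)"
    using assms frechet_derivative_at unfolding gderiv_def by metis
  then show ?thesis using euclidean_representation[of D] by (simp add: grad_def inner_commute)
qed

lemma GDERIV_grad:
  assumes "smooth_on S f" "p \<in> S"
  shows "GDERIV f p :> grad f p"
proof -
  let ?D = "frechet_derivative f (at p)"
  have d: "(f has_derivative ?D) (at p)" using smooth_on_has_derivative[OF assms] .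
  have "?D = (\<lambda>h. h \<bullet> grad f p)"
  proof
    fix h
    have "?D h = (\<Sum>j\<in>Basis. (h \<bullet> j) *\<^sub>R ?D j)"
      by (rule linear_Basis_expansion[OF has_derivative_linear[OF d]])
    also have "\<dots> = h \<bullet> grad f p"
      by (simp add: grad_def inner_sum_right mult.commute)
    finally show "?D h = h \<bullet> grad f p" .
  qed
  then show ?thesis using d by (simp add: gderiv_def)
qed

lemma smooth_on_grad: "smooth_on S f \<Longrightarrow> smooth_on S (grad f)"
  unfolding grad_def
  by (intro smooth_on_sum smooth_on_scaleR smooth_on_frechet_derivative smooth_on_const)
    (auto dest: smooth_on_open)

lemma norm_linear_le:
  assumes "linear f"
  shows "norm (f v) \<le> (\<Sum>i\<in>Basis. norm (f i)) * norm v"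
proof -
  have "norm (f v) = norm (\<Sum>i\<in>Basis. (v \<bullet> i) *\<^sub>R f i)"
    using linear_Basis_expansion[OF assms, of v] by (rule arg_cong)
  also have "\<dots> \<le> (\<Sum>i\<in>Basis. \<bar>v \<bullet> i\<bar> * norm (f i))"
    by (rule order_trans[OF norm_sum]) simp
  also have "\<dots> \<le> (\<Sum>i\<in>Basis. norm v * norm (f i))"
    by (intro sum_mono mult_right_mono Basis_le_norm) auto
  finally show ?thesis by (simp add: sum_distrib_left mult.commute)
qed

lemma smooth_on_derivative_bound:
  assumes "smooth_on S f" "compact K" "K \<subseteq> S"
  obtains C where "0 \<le> C" "\<And>p v. p \<in> K \<Longrightarrow> norm (frechet_derivative f (at p) v) \<le> C * norm v"
proof -
  have "continuous_on K (\<lambda>p. \<Sum>i\<in>Basis. norm (frechet_derivative f (at p) i))"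
    using smooth_on_continuous_on[OF smooth_on_frechet_derivative[OF assms(1)]] assms(3)
    by (intro continuous_intros) (auto intro: continuous_on_subset)
  then have "bounded ((\<lambda>p. \<Sum>i\<in>Basis. norm (frechet_derivative f (at p) i)) ` K)"
    using assms(2) compact_continuous_image compact_imp_bounded by blast
  then obtain C where C: "\<And>p. p \<in> K \<Longrightarrow> (\<Sum>i\<in>Basis. norm (frechet_derivative f (at p) i)) \<le> C"
    unfolding bounded_iff by (force dest: abs_le_D1)
  show ?thesis
  proof (rule that[of "max C 0"])
    fix p v assume p: "p \<in> K"
    have "linear (frechet_derivative f (at p))"
      using has_derivative_linear[OF smooth_on_has_derivative[OF assms(1)]] p assms(3) by auto
    then have "norm (frechet_derivative f (at p) v) \<le>
        (\<Sum>i\<in>Basis. norm (frechet_derivative f (at p) i)) * norm v"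
      by (rule norm_linear_le)
    also have "\<dots> \<le> max C 0 * norm v"
      using C[OF p] by (intro mult_right_mono) auto
    finally show "norm (frechet_derivative f (at p) v) \<le> max C 0 * norm v" .
  qed simp
qed

lemma lipschitz_on_convex_derivative:
  assumes "convex X" "\<And>x. x \<in> X \<Longrightarrow> (f has_derivative f' x) (at x)"
    "\<And>x v. x \<in> X \<Longrightarrow> norm (f' x v) \<le> C * norm v" "0 \<le> C"
  shows "C-lipschitz_on X f"
  by (rule bounded_derivative_imp_lipschitz[OF _ assms(1)])
    (use assms in \<open>auto intro: has_derivative_at_withinI onorm_bound\<close>)

text \<open>A segment through the centre is split there, and the third estimate is used on both
  halves, whose lengths add up. Any other segment stays where \<open>f\<close> is differentiable, so
  the mean value inequality applies.\<close>

lemma lipschitz_on_punctured_ball: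
  fixes f :: "'a::euclidean_space \<Rightarrow> 'b::real_normed_vector"
  assumes "\<And>x. x \<in> ball z r \<Longrightarrow> x \<noteq> z \<Longrightarrow> (f has_derivative f' x) (at x)"
    "\<And>x v. x \<in> ball z r \<Longrightarrow> x \<noteq> z \<Longrightarrow> norm (f' x v) \<le> C * norm v"
    "\<And>x. x \<in> ball z r \<Longrightarrow> norm (f x - f z) \<le> C * norm (x - z)" "0 \<le> C"
  shows "C-lipschitz_on (ball z r) f"
proof (rule lipschitz_onI)
  fix x y assume xy: "x \<in> ball z r" "y \<in> ball z r"
  show "dist (f x) (f y) \<le> C * dist x y"
  proof (cases "z \<in> closed_segment x y")
    case True
    then have "dist x y = norm (x - z) + norm (y - z)"
      using between_mem_segment[of x y z] between[of x y z] by (simp add: dist_norm norm_minus_commute)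
    moreover have "dist (f x) (f y) \<le> norm (f x - f z) + norm (f y - f z)"
      by (metis dist_norm dist_triangle2)
    ultimately show ?thesis using assms(3)[OF xy(1)] assms(3)[OF xy(2)] by (simp add: distrib_left)
  next
    case False
    have sub: "closed_segment x y \<subseteq> ball z r" using xy by (simp add: closed_segment_subset)
    have "C-lipschitz_on (closed_segment x y) f"
      by (rule lipschitz_on_convex_derivative[where f' = f']) (use False sub assms in \<open>auto simp: subset_iff\<close>)
    then show ?thesis by (rule lipschitz_onD) auto
  qed
qed (rule assms(4))

section \<open>Locally Lipschitz maps and functions of class C^{1,1}\<close>

definition loc_lipschitz_on :: "'a::metric_space set \<Rightarrow> ('a \<Rightarrow> 'b::metric_space) \<Rightarrow> bool" where
  "loc_lipschitz_on S f \<longleftrightarrow> (\<forall>p\<in>S. \<exists>r>0. \<exists>C. C-lipschitz_on (ball p r) f)"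

lemma loc_lipschitz_onE:
  assumes "loc_lipschitz_on S f" "p \<in> S"
  obtains r C where "0 < r" "\<And>s. s \<le> r \<Longrightarrow> C-lipschitz_on (ball p s) f"
  using assms unfolding loc_lipschitz_on_def by (meson lipschitz_on_subset subset_ball)

lemma smooth_on_loc_lipschitz_on:
  assumes "smooth_on S f"
  shows "loc_lipschitz_on S f"
  unfolding loc_lipschitz_on_def
proof
  fix p assume "p \<in> S"
  then obtain r where r: "0 < r" "cball p r \<subseteq> S"
    using smooth_on_open[OF assms] open_contains_cball by blast
  obtain C where C: "0 \<le> C" "\<And>q v. q \<in> cball p r \<Longrightarrow> norm (frechet_derivative f (at q) v) \<le> C * norm v"
    using smooth_on_derivative_bound[OF assms compact_cball r(2)] by blast
  have "C-lipschitz_on (ball p r) f"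
    by (rule lipschitz_on_convex_derivative[where f' = "\<lambda>x. frechet_derivative f (at x)"])
      (use C r(2) smooth_on_has_derivative[OF assms] in \<open>auto simp: subset_iff\<close>)
  then show "\<exists>r>0. \<exists>C. C-lipschitz_on (ball p r) f" using r(1) by blast
qed

lemma loc_lipschitz_on_add:
  fixes f g :: "'a::metric_space \<Rightarrow> 'b::real_normed_vector"
  assumes "loc_lipschitz_on S f" "loc_lipschitz_on S g"
  shows "loc_lipschitz_on S (\<lambda>p. f p + g p)"
  unfolding loc_lipschitz_on_def
proof
  fix p assume p: "p \<in> S"
  obtain r C where 1: "0 < r" "\<And>s. s \<le> r \<Longrightarrow> C-lipschitz_on (ball p s) f"
    by (rule loc_lipschitz_onE[OF assms(1) p]) blast
  obtain r' C' where 2: "0 < r'" "\<And>s. s \<le> r' \<Longrightarrow> C'-lipschitz_on (ball p s) g"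
    by (rule loc_lipschitz_onE[OF assms(2) p]) blast
  have "(C + C')-lipschitz_on (ball p (min r r')) (\<lambda>p. f p + g p)"
    by (intro lipschitz_on_add 1 2) auto
  then show "\<exists>r>0. \<exists>C. C-lipschitz_on (ball p r) (\<lambda>p. f p + g p)"
    using 1(1) 2(1) by (meson min_less_iff_conj)
qed

lemma loc_lipschitz_on_scaleR:
  fixes f :: "'a::metric_space \<Rightarrow> real" and g :: "'a \<Rightarrow> 'b::real_normed_vector"
  assumes "loc_lipschitz_on S f" "loc_lipschitz_on S g"
  shows "loc_lipschitz_on S (\<lambda>p. f p *\<^sub>R g p)"
  unfolding loc_lipschitz_on_def
proof
  fix p assume p: "p \<in> S"
  obtain r C where 1: "0 < r" "\<And>s. s \<le> r \<Longrightarrow> C-lipschitz_on (ball p s) f"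
    by (rule loc_lipschitz_onE[OF assms(1) p]) blast
  obtain r' C' where 2: "0 < r'" "\<And>s. s \<le> r' \<Longrightarrow> C'-lipschitz_on (ball p s) g"
    by (rule loc_lipschitz_onE[OF assms(2) p]) blast
  \<comment> \<open>A radius of at most 1 turns the Lipschitz constants into additive bounds for
    \<open>f\<close> and \<open>g\<close> on the ball.\<close>
  define s where "s = min 1 (min r r')"
  have s: "0 < s" "s \<le> 1" "s \<le> r" "s \<le> r'" using 1(1) 2(1) by (auto simp: s_def)
  note f = 1(2)[OF s(3)] and g = 2(2)[OF s(4)]
  have C: "0 \<le> C" "0 \<le> C'" using f g lipschitz_on_nonneg by blast+
  have bf: "\<bar>f x\<bar> \<le> \<bar>f p\<bar> + C" and bg: "norm (g x) \<le> norm (g p) + C'" if "x \<in> ball p s" for x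
  proof -
    have "C * dist x p \<le> C * 1" "C' * dist x p \<le> C' * 1"
      using that s C by (intro mult_left_mono; simp add: dist_commute)+
    moreover have "dist (f x) (f p) \<le> C * dist x p" "dist (g x) (g p) \<le> C' * dist x p"
      using lipschitz_onD[OF f that, of p] lipschitz_onD[OF g that, of p] s by auto
    moreover have "norm (g x) \<le> norm (g p) + dist (g x) (g p)"
      by (metis add.commute dist_norm norm_triangle_sub)
    ultimately show "\<bar>f x\<bar> \<le> \<bar>f p\<bar> + C" "norm (g x) \<le> norm (g p) + C'"
      by (auto simp: dist_real_def)
  qed
  have "((\<bar>f p\<bar> + C) * C' + (norm (g p) + C') * C)-lipschitz_on (ball p s) (\<lambda>p. f p *\<^sub>R g p)"
  proof (rule lipschitz_onI)
    fix x y assume xy: "x \<in> ball p s" "y \<in> ball p s"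
    have "f x *\<^sub>R g x - f y *\<^sub>R g y = f x *\<^sub>R (g x - g y) + (f x - f y) *\<^sub>R g y"
      by (simp add: algebra_simps)
    then have "dist (f x *\<^sub>R g x) (f y *\<^sub>R g y) \<le> \<bar>f x\<bar> * dist (g x) (g y) + dist (f x) (f y) * norm (g y)"
      unfolding dist_norm by (metis norm_triangle_ineq norm_scaleR real_norm_def)
    also have "\<dots> \<le> (\<bar>f p\<bar> + C) * (C' * dist x y) + (C * dist x y) * (norm (g p) + C')"
      using lipschitz_onD[OF f xy] lipschitz_onD[OF g xy] bf[OF xy(1)] bg[OF xy(2)] C
      by (intro add_mono mult_mono) auto
    finally show "dist (f x *\<^sub>R g x) (f y *\<^sub>R g y) \<le>
        ((\<bar>f p\<bar> + C) * C' + (norm (g p) + C') * C) * dist x y"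
      by (simp add: algebra_simps)
  qed (use C in auto)
  then show "\<exists>r>0. \<exists>C. C-lipschitz_on (ball p r) (\<lambda>p. f p *\<^sub>R g p)" using s(1) by blast
qed

lemma loc_lipschitz_on_continuous_on:
  assumes "loc_lipschitz_on S f"
  shows "continuous_on S f"
proof (rule continuous_at_imp_continuous_on, rule)
  fix p assume "p \<in> S"
  then obtain r C where "0 < r" "C-lipschitz_on (ball p r) f"
    using assms unfolding loc_lipschitz_on_def by blast
  then show "isCont f p"
    by (meson centre_in_ball continuous_on_eq_continuous_at lipschitz_on_continuous_on open_ball)
qed

text \<open>Class C^{1,1}, smooth off \<open>Z\<close>. These are the properties that make p -> (G
  p, p) locally Lipschitz everywhere and smooth away from the corners. The gradient is carried as a
  separate argument so that piecewise formulas for it can be stated and combined directly.\<close>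

definition C11_on :: "'a::euclidean_space set \<Rightarrow> 'a set \<Rightarrow> ('a \<Rightarrow> real) \<Rightarrow> ('a \<Rightarrow> 'a) \<Rightarrow> bool" where
  "C11_on S Z F G \<longleftrightarrow> open S \<and> smooth_on (S - Z) F \<and> (\<forall>p\<in>S. GDERIV F p :> G p) \<and>
     loc_lipschitz_on S G"

lemma C11_on_loc_lipschitz_on:
  assumes "C11_on S Z F G"
  shows "loc_lipschitz_on S F"
  unfolding loc_lipschitz_on_def
proof
  fix p assume p: "p \<in> S"
  have G: "continuous_on S G" using assms loc_lipschitz_on_continuous_on by (auto simp: C11_on_def)
  obtain r where r: "0 < r" "cball p r \<subseteq> S"
    using p assms open_contains_cball unfolding C11_on_def by blast
  have "bounded (G ` cball p r)"
    by (intro compact_imp_bounded compact_continuous_image continuous_on_subset[OF G] r) auto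
  then obtain C where C: "\<And>q. q \<in> cball p r \<Longrightarrow> norm (G q) \<le> C"
    unfolding bounded_iff by blast
  have "C-lipschitz_on (ball p r) F"
  proof (rule lipschitz_on_convex_derivative[where f' = "\<lambda>q h. h \<bullet> G q"])
    show "0 \<le> C" using C[of p] r(1) by (auto intro: order_trans[OF norm_ge_zero])
    fix q assume q: "q \<in> ball p r"
    then have "q \<in> S" using r(2) by auto
    then show "(F has_derivative (\<lambda>h. h \<bullet> G q)) (at q)"
      using assms unfolding C11_on_def gderiv_def by blast
    show "norm (v \<bullet> G q) \<le> C * norm v" for v
    proof -
      have "norm (v \<bullet> G q) \<le> norm (G q) * norm v"
        using Cauchy_Schwarz_ineq2[of v "G q"] by (simp add: mult.commute)
      also have "\<dots> \<le> C * norm v"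
        using C[of q] q by (intro mult_right_mono) auto
      finally show ?thesis .
    qed
  qed simp
  then show "\<exists>r>0. \<exists>C. C-lipschitz_on (ball p r) F" using r(1) by blast
qed

lemma C11_on_smooth:
  assumes "smooth_on S F" "open (S - Z)"
  shows "C11_on S Z F (grad F)"
  using assms GDERIV_grad smooth_on_loc_lipschitz_on[OF smooth_on_grad] smooth_on_subset smooth_on_open
  unfolding C11_on_def by (metis Diff_subset)

lemma C11_on_mono:
  assumes "C11_on S Z F G" "open T" "T \<subseteq> S" "Z \<subseteq> Z'" "open (T - Z')"
  shows "C11_on T Z' F G"
  using assms unfolding C11_on_def loc_lipschitz_on_def
  by (auto intro: smooth_on_subset[where S = "S - Z"])

lemma C11_on_add:
  assumes "C11_on S Z F G" "C11_on S Z F' G'"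
  shows "C11_on S Z (\<lambda>p. F p + F' p) (\<lambda>p. G p + G' p)"
  using assms unfolding C11_on_def
  by (auto intro: smooth_on_add GDERIV_add loc_lipschitz_on_add)

lemma C11_on_mult:
  assumes "C11_on S Z F G" "C11_on S Z F' G'"
  shows "C11_on S Z (\<lambda>p. F p * F' p) (\<lambda>p. F p *\<^sub>R G' p + F' p *\<^sub>R G p)"
  using assms C11_on_loc_lipschitz_on[OF assms(1)] C11_on_loc_lipschitz_on[OF assms(2)]
  unfolding C11_on_def
  by (auto intro: smooth_on_mult GDERIV_mult loc_lipschitz_on_add loc_lipschitz_on_scaleR)

lemma C11_on_local:
  assumes "open S" "open (S - Z)"
    "\<And>p. p \<in> S \<Longrightarrow> \<exists>T F' G'. p \<in> T \<and> C11_on T Z F' G' \<and> (\<forall>q\<in>T. F q = F' q \<and> G q = G' q)"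
  shows "C11_on S Z F G"
  unfolding C11_on_def
proof (intro conjI ballI)
  show "smooth_on (S - Z) F"
  proof (rule smooth_on_local[OF assms(2)])
    fix p assume p: "p \<in> S - Z"
    then obtain T F' G' where T: "p \<in> T" "C11_on T Z F' G'" "\<forall>q\<in>T. F q = F' q \<and> G q = G' q"
      using assms(3)[of p] by auto
    then have "smooth_on (T - Z) F'" by (simp add: C11_on_def)
    then have "smooth_on (T - Z) F"
      using T(3) smooth_on_cong[of "T - Z" F F'] smooth_on_open by auto
    then show "\<exists>T. p \<in> T \<and> smooth_on T F" using T(1) p by blast
  qed
next
  fix p assume p: "p \<in> S"
  then obtain T F' G' where T: "p \<in> T" "C11_on T Z F' G'" "\<forall>q\<in>T. F q = F' q \<and> G q = G' q"
    using assms(3)[of p] by auto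
  then have "(F' has_derivative (\<lambda>h. h \<bullet> G p)) (at p)" "open T" by (auto simp: C11_on_def gderiv_def)
  then show "GDERIV F p :> G p"
    unfolding gderiv_def using T by (metis has_derivative_transform_within_open)
next
  show "loc_lipschitz_on S G" unfolding loc_lipschitz_on_def
  proof
    fix p assume p: "p \<in> S"
    then obtain T F' G' where T: "p \<in> T" "C11_on T Z F' G'" "\<forall>q\<in>T. F q = F' q \<and> G q = G' q"
      using assms(3)[of p] by auto
    then have L: "loc_lipschitz_on T G'" and "open T" by (auto simp: C11_on_def)
    obtain r C where r: "0 < r" "\<And>s. s \<le> r \<Longrightarrow> C-lipschitz_on (ball p s) G'"
      by (rule loc_lipschitz_onE[OF L T(1)]) blast
    obtain s where s: "0 < s" "ball p s \<subseteq> T" using T(1) \<open>open T\<close> open_contains_ball by blast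
    have "C-lipschitz_on (ball p (min r s)) G"
      by (rule lipschitz_on_transform[OF r(2)]) (use T(3) s in auto)
    then show "\<exists>r>0. \<exists>C. C-lipschitz_on (ball p r) G" using r(1) s(1) by (meson min_less_iff_conj)
  qed
qed (rule assms(1))

section \<open>Interpolation at a corner\<close>

text \<open>Differentiating \<open>hom\<close> in \<open>w\<close> produces a factor
  \<open>l\<close> on the left; dividing by it lowers the degree of homogeneity from -k to -(k +
  1).\<close>

lemma homogeneous_derivative:
  assumes g: "smooth_on (- {0}) g"
    and hom: "\<And>l w. 0 < l \<Longrightarrow> w \<noteq> 0 \<Longrightarrow> g (l *\<^sub>R w) = (1 / l ^ k) *\<^sub>R g w"
    and l: "0 < l" "w \<noteq> 0"
  shows "frechet_derivative g (at (l *\<^sub>R w)) v = (1 / l ^ Suc k) *\<^sub>R frechet_derivative g (at w) v"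
proof -
  let ?D = "\<lambda>w. frechet_derivative g (at w)"
  have d: "(g has_derivative ?D w) (at w)" if "w \<noteq> 0" for w
    using smooth_on_has_derivative[OF g] that by simp
  have lw: "l *\<^sub>R w \<noteq> 0" using l by simp
  have "((\<lambda>w. l *\<^sub>R w) has_derivative (\<lambda>v. l *\<^sub>R v)) (at w)"
    by (auto intro!: derivative_eq_intros)
  from has_derivative_compose[OF this d[OF lw]]
  have "((\<lambda>w. g (l *\<^sub>R w)) has_derivative (\<lambda>v. ?D (l *\<^sub>R w) (l *\<^sub>R v))) (at w)" .
  moreover have "((\<lambda>w. g (l *\<^sub>R w)) has_derivative (\<lambda>v. (1 / l ^ k) *\<^sub>R ?D w v)) (at w)"
    by (rule has_derivative_transform_within_open[where s = "- {0}" and f = "\<lambda>w. (1 / l ^ k) *\<^sub>R g w"])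
      (use l hom d in \<open>auto intro!: has_derivative_scaleR_right\<close>)
  ultimately have "(\<lambda>v. ?D (l *\<^sub>R w) (l *\<^sub>R v)) = (\<lambda>v. (1 / l ^ k) *\<^sub>R ?D w v)"
    by (rule has_derivative_unique)
  then have "l *\<^sub>R ?D (l *\<^sub>R w) v = (1 / l ^ k) *\<^sub>R ?D w v"
    using linear_scale[OF has_derivative_linear[OF d[OF lw]]] by metis
  then have "(1 / l) *\<^sub>R (l *\<^sub>R ?D (l *\<^sub>R w) v) = (1 / l) *\<^sub>R ((1 / l ^ k) *\<^sub>R ?D w v)" by simp
  then show ?thesis using l by simp
qed

text \<open>The product in the conclusion is constant along rays, hence controlled by its values on
  the compact unit sphere.\<close>

lemma homogeneous_bound:
  fixes g :: "'a::euclidean_space \<Rightarrow> 'b::real_normed_vector"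
  assumes "continuous_on (- {0}) g"
    and hom: "\<And>l w. 0 < l \<Longrightarrow> w \<noteq> 0 \<Longrightarrow> g (l *\<^sub>R w) = (1 / l ^ k) *\<^sub>R g w"
  obtains B where "0 \<le> B" "\<And>w. w \<noteq> 0 \<Longrightarrow> norm (g w) * norm w ^ k \<le> B"
proof -
  have "bounded (g ` sphere 0 1)"
    by (intro compact_imp_bounded compact_continuous_image continuous_on_subset[OF assms(1)]) auto
  then obtain B where B: "\<And>w. w \<in> sphere 0 1 \<Longrightarrow> norm (g w) \<le> B"
    unfolding bounded_iff by blast
  show ?thesis
  proof (rule that[of "max B 0"])
    fix w :: 'a assume w: "w \<noteq> 0"
    have "g (norm w *\<^sub>R sgn w) = (1 / norm w ^ k) *\<^sub>R g (sgn w)"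
      using w by (intro hom) (auto simp: sgn_zero_iff)
    moreover have n: "norm w *\<^sub>R sgn w = w" using w by (simp add: sgn_div_norm)
    ultimately have "norm (g w) = norm ((1 / norm w ^ k) *\<^sub>R g (sgn w))" unfolding n by simp
    then have "norm (g w) * norm w ^ k = norm (g (sgn w))" using w by simp
    also have "\<dots> \<le> B" using w by (intro B) (simp add: norm_sgn)
    finally show "norm (g w) * norm w ^ k \<le> max B 0" by simp
  qed simp
qed

lemma homogeneous_derivative_bound:
  assumes g: "smooth_on (- {0}) g"
    and hom: "\<And>l w. 0 < l \<Longrightarrow> w \<noteq> 0 \<Longrightarrow> g (l *\<^sub>R w) = (1 / l ^ k) *\<^sub>R g w"
  obtains B where "0 \<le> B"
    "\<And>w v. w \<noteq> 0 \<Longrightarrow> norm (frechet_derivative g (at w) v) * norm w ^ Suc k \<le> B * norm v"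
proof -
  let ?D = "\<lambda>w. frechet_derivative g (at w)"
  have "\<exists>B\<ge>0. \<forall>w. w \<noteq> 0 \<longrightarrow> norm (?D w i) * norm w ^ Suc k \<le> B" for i
    using homogeneous_bound[of "\<lambda>w. ?D w i" "Suc k"]
      smooth_on_continuous_on[OF smooth_on_frechet_derivative[OF g]]
      homogeneous_derivative[OF g hom] by metis
  then obtain B where B: "\<And>i. 0 \<le> B i" "\<And>i w. w \<noteq> 0 \<Longrightarrow> norm (?D w i) * norm w ^ Suc k \<le> B i"
    by metis
  show ?thesis
  proof (rule that[of "\<Sum>i\<in>Basis. B i"])
    fix w v :: 'a assume w: "w \<noteq> 0"
    have "norm (?D w v) * norm w ^ Suc k \<le> ((\<Sum>i\<in>Basis. norm (?D w i)) * norm v) * norm w ^ Suc k"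
      using smooth_on_has_derivative[OF g] w
      by (intro mult_right_mono norm_linear_le has_derivative_linear) auto
    also have "\<dots> = (\<Sum>i\<in>Basis. norm (?D w i) * norm w ^ Suc k) * norm v"
      by (simp add: sum_distrib_right sum_distrib_left mult_ac)
    also have "\<dots> \<le> (\<Sum>i\<in>Basis. B i) * norm v"
      using B(2)[OF w] by (intro mult_right_mono sum_mono) auto
    finally show "norm (?D w v) * norm w ^ Suc k \<le> (\<Sum>i\<in>Basis. B i) * norm v" .
  qed (simp add: sum_nonneg B(1))
qed

text \<open>The cutoff depends on e.w/|w| alone, so it is homogeneous of degree 0; its gradient has
  degree -1 and the derivative of the gradient degree -2. This accounts for the powers of
  \<open>norm w\<close> in the three bounds.\<close>

lemma angular_cutoff:
  fixes e :: "'a::euclidean_space"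
  assumes "0 < c"
  obtains \<theta> :: "'a \<Rightarrow> real" and B where "smooth_on (- {0}) \<theta>" "0 \<le> B"
    "\<And>w. c * norm w < e \<bullet> w \<Longrightarrow> \<theta> w = 1 \<and> grad \<theta> w = 0"
    "\<And>w. e \<bullet> w < - c * norm w \<Longrightarrow> \<theta> w = 0 \<and> grad \<theta> w = 0"
    "\<And>w. w \<noteq> 0 \<Longrightarrow> \<bar>\<theta> w\<bar> \<le> B"
    "\<And>w. w \<noteq> 0 \<Longrightarrow> norm (grad \<theta> w) * norm w \<le> B"
    "\<And>w v. w \<noteq> 0 \<Longrightarrow> norm (frechet_derivative (grad \<theta>) (at w) v) * (norm w)\<^sup>2 \<le> B * norm v"
proof -
  \<comment> \<open>The affine map sends -c to 0 and c to 1, the values at which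
    \<open>smooth_step\<close> becomes constant.\<close>
  define \<theta> where "\<theta> w = smooth_step ((e \<bullet> w / norm w + c) / (2 * c))" for w :: 'a
  have s: "smooth_on (- {0}) \<theta>" unfolding \<theta>_def
    by (intro smooth_on_compose[OF smooth_on_smooth_step] smooth_on_divide smooth_on_add
        smooth_on_inner smooth_on_const smooth_on_id smooth_on_norm) (use assms in auto)
  have hom: "\<theta> (l *\<^sub>R w) = (1 / l ^ 0) *\<^sub>R \<theta> w" if "0 < l" "w \<noteq> 0" for l w
    using that by (simp add: \<theta>_def)
  have hom1: "grad \<theta> (l *\<^sub>R w) = (1 / l ^ 1) *\<^sub>R grad \<theta> w" if "0 < l" "w \<noteq> 0" for l w
    using homogeneous_derivative[OF s hom that]
    by (simp add: grad_def scaleR_sum_right)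
  obtain B0 where B0: "0 \<le> B0" "\<And>w. w \<noteq> 0 \<Longrightarrow> norm (\<theta> w) * norm w ^ 0 \<le> B0"
    using homogeneous_bound[OF smooth_on_continuous_on[OF s] hom] by blast
  obtain B1 where B1: "0 \<le> B1" "\<And>w. w \<noteq> 0 \<Longrightarrow> norm (grad \<theta> w) * norm w ^ 1 \<le> B1"
    using homogeneous_bound[OF smooth_on_continuous_on[OF smooth_on_grad[OF s]] hom1] by blast
  obtain B2 where B2: "0 \<le> B2"
    "\<And>w v. w \<noteq> 0 \<Longrightarrow> norm (frechet_derivative (grad \<theta>) (at w) v) * norm w ^ Suc 1 \<le> B2 * norm v"
    using homogeneous_derivative_bound[OF smooth_on_grad[OF s] hom1] by blast
  \<comment> \<open>Both cones are open, so a constant value on them forces the gradient to vanish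
    there.\<close>
  have const: "\<theta> w = a \<and> grad \<theta> w = 0" if "open T" "w \<in> T" "\<And>w. w \<in> T \<Longrightarrow> \<theta> w = a" for w T a
  proof -
    have "(\<theta> has_derivative (\<lambda>h. 0)) (at w)"
      by (rule has_derivative_transform_within_open[OF has_derivative_const[of a] that(1,2)])
        (simp add: that(3))
    then show ?thesis using that by (auto simp: gderiv_def intro!: grad_eqI)
  qed
  show ?thesis
  proof (rule that[OF s])
    show "0 \<le> B0 + B1 + B2" using B0 B1 B2 by simp
    show "\<theta> w = 1 \<and> grad \<theta> w = 0" if "c * norm w < e \<bullet> w" for w
    proof (rule const[of "{w. c * norm w < e \<bullet> w}"])
      fix w assume w: "w \<in> {w. c * norm w < e \<bullet> w}"
      then have "0 < norm w" using assms by auto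
      then have "c < e \<bullet> w / norm w" using w by (simp add: field_simps)
      then show "\<theta> w = 1" unfolding \<theta>_def using assms by (intro smooth_step_eq) (simp add: field_simps)
    qed (use that in \<open>auto intro!: open_Collect_less continuous_intros\<close>)
    show "\<theta> w = 0 \<and> grad \<theta> w = 0" if "e \<bullet> w < - c * norm w" for w
    proof (rule const[of "{w. e \<bullet> w < - c * norm w}"])
      fix w assume w: "w \<in> {w. e \<bullet> w < - c * norm w}"
      then have "0 < norm w" using assms by auto
      then have "e \<bullet> w / norm w < - c" using w by (simp add: field_simps)
      then show "\<theta> w = 0" unfolding \<theta>_def using assms by (intro smooth_step_eq) (simp add: field_simps)
    qed (use that in \<open>auto intro!: open_Collect_less continuous_intros\<close>)
    show "\<bar>\<theta> w\<bar> \<le> B0 + B1 + B2" if "w \<noteq> 0" for w using B0(2)[OF that] B1(1) B2(1) by simp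
    show "norm (grad \<theta> w) * norm w \<le> B0 + B1 + B2" if "w \<noteq> 0" for w
      using B1(2)[OF that] B0(1) B2(1) by simp
    show "norm (frechet_derivative (grad \<theta>) (at w) v) * (norm w)\<^sup>2 \<le> (B0 + B1 + B2) * norm v"
      if "w \<noteq> 0" for w v
    proof -
      have "B2 * norm v \<le> (B0 + B1 + B2) * norm v" using B0 B1 by (intro mult_right_mono) auto
      then show ?thesis using B2(2)[OF that, of v] by (simp add: power2_eq_square)
    qed
  qed
qed

text \<open>With r = |p - z|, the vanishing 1-jet gives f = O(r^2) and grad f = O(r), while the
  first two derivatives of the cutoff are O(1/r) and O(1/r^2). All four terms in the derivative of
  the gradient of the product are therefore bounded.\<close>

lemma corner_blend:
  fixes z e :: "'a::euclidean_space"
  assumes f: "smooth_on (ball z r) f" "f z = 0" "grad f z = 0" and "0 < r" "0 < c"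
  obtains H G where "C11_on (ball z (r / 2)) {z} H G" "H z = 0" "G z = 0"
    "\<And>p. c * norm (p - z) < e \<bullet> (p - z) \<Longrightarrow> H p = f p \<and> G p = grad f p"
    "\<And>p. e \<bullet> (p - z) < - c * norm (p - z) \<Longrightarrow> H p = 0 \<and> G p = 0"
proof -
  obtain \<theta> B where \<theta>: "smooth_on (- {0}) \<theta>" "0 \<le> B"
    "\<And>w. c * norm w < e \<bullet> w \<Longrightarrow> \<theta> w = 1 \<and> grad \<theta> w = 0"
    "\<And>w. e \<bullet> w < - c * norm w \<Longrightarrow> \<theta> w = 0 \<and> grad \<theta> w = 0"
    "\<And>w. w \<noteq> 0 \<Longrightarrow> \<bar>\<theta> w\<bar> \<le> B"
    "\<And>w. w \<noteq> 0 \<Longrightarrow> norm (grad \<theta> w) * norm w \<le> B"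
    "\<And>w v. w \<noteq> 0 \<Longrightarrow> norm (frechet_derivative (grad \<theta>) (at w) v) * (norm w)\<^sup>2 \<le> B * norm v"
    by (rule angular_cutoff[OF assms(5), of e]) (rule that; assumption)
  \<comment> \<open>A bound on the Hessian of \<open>f\<close> needs a compact set inside the open
    ball, hence half the radius.\<close>
  obtain M where M: "0 \<le> M"
    "\<And>p v. p \<in> cball z (r / 2) \<Longrightarrow> norm (frechet_derivative (grad f) (at p) v) \<le> M * norm v"
    using smooth_on_derivative_bound[OF smooth_on_grad[OF f(1)], of "cball z (r / 2)"] assms(4)
    by (auto simp: subset_iff)
  have sub: "p \<in> ball z r" if "p \<in> ball z (r / 2)" for p using that assms(4) by auto
  have Gf: "norm (grad f p) \<le> M * norm (p - z)" if "p \<in> ball z (r / 2)" for p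
  proof -
    have "M-lipschitz_on (ball z (r / 2)) (grad f)"
      by (rule lipschitz_on_convex_derivative[where f' = "\<lambda>p. frechet_derivative (grad f) (at p)"])
        (use M smooth_on_has_derivative[OF smooth_on_grad[OF f(1)]] sub in auto)
    from lipschitz_onD[OF this that, of z] show ?thesis using assms(3,4) by (simp add: dist_norm)
  qed
  have Ff: "\<bar>f p\<bar> \<le> M * (norm (p - z))\<^sup>2" if "p \<in> ball z (r / 2)" for p
  proof -
    let ?s = "norm (p - z)"
    have in_ball: "q \<in> ball z (r / 2)" if "q \<in> cball z ?s" for q
      using that \<open>p \<in> ball z (r / 2)\<close> by (simp add: dist_norm norm_minus_commute)
    \<comment> \<open>On this ball the gradient is at most \<open>M * ?s\<close>; the mean value
      inequality from \<open>z\<close> to \<open>p\<close> then gives the quadratic bound.\<close>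
    have "(M * ?s)-lipschitz_on (cball z ?s) f"
    proof (rule lipschitz_on_convex_derivative[where f' = "\<lambda>q h. h \<bullet> grad f q"])
      fix q assume q: "q \<in> cball z ?s"
      show "(f has_derivative (\<lambda>h. h \<bullet> grad f q)) (at q)"
        using GDERIV_grad[OF f(1) sub[OF in_ball[OF q]]] by (simp add: gderiv_def)
      have "norm (grad f q) \<le> M * ?s"
        using Gf[OF in_ball[OF q]] q M(1)
        by (auto simp: dist_norm norm_minus_commute intro: order_trans mult_left_mono)
      then show "norm (v \<bullet> grad f q) \<le> M * ?s * norm v" for v
        using Cauchy_Schwarz_ineq2[of v "grad f q"] mult_right_mono[of "norm (grad f q)" "M * ?s" "norm v"]
        by (simp add: mult.commute)
    qed (use M in auto)
    from lipschitz_onD[OF this, of p z] show ?thesis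
      using f(2) by (simp add: dist_norm norm_minus_commute power2_eq_square mult_ac)
  qed
  define H where "H p = \<theta> (p - z) * f p" for p
  define G where "G p = \<theta> (p - z) *\<^sub>R grad f p + f p *\<^sub>R grad \<theta> (p - z)" for p
  have shift: "smooth_on (ball z (r / 2) - {z}) (\<lambda>p. p - z)"
    by (intro smooth_on_diff smooth_on_id smooth_on_const) auto
  have fs: "smooth_on (ball z (r / 2) - {z}) f"
    by (rule smooth_on_subset[OF f(1)]) (use sub in auto)
  have \<theta>s: "smooth_on (ball z (r / 2) - {z}) (\<lambda>p. \<theta> (p - z))"
    by (rule smooth_on_compose[OF \<theta>(1) shift]) auto
  have Hs: "smooth_on (ball z (r / 2) - {z}) H" unfolding H_def by (rule smooth_on_mult[OF \<theta>s fs])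
  have Gs: "smooth_on (ball z (r / 2) - {z}) G" unfolding G_def
    by (intro smooth_on_add smooth_on_scaleR \<theta>s fs smooth_on_grad[OF fs]
        smooth_on_compose[OF smooth_on_grad[OF \<theta>(1)] shift]) auto
  have shiftd: "((\<lambda>p. p - z) has_derivative (\<lambda>h. h)) (at p)" for p
    by (auto intro!: derivative_eq_intros)
  have \<theta>d: "((\<lambda>p. \<theta> (p - z)) has_derivative (\<lambda>h. h \<bullet> grad \<theta> (p - z))) (at p)" if "p \<noteq> z" for p
    using has_derivative_compose[OF shiftd] GDERIV_grad[OF \<theta>(1), of "p - z"] that
    unfolding gderiv_def by force
  have fd: "(f has_derivative (\<lambda>h. h \<bullet> grad f p)) (at p)" if "p \<in> ball z (r / 2)" for p
    using GDERIV_grad[OF f(1) sub[OF that]] by (simp add: gderiv_def)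
  have Gd: "(G has_derivative (\<lambda>h.
      (\<theta> (p - z) *\<^sub>R frechet_derivative (grad f) (at p) h + (h \<bullet> grad \<theta> (p - z)) *\<^sub>R grad f p) +
      (f p *\<^sub>R frechet_derivative (grad \<theta>) (at (p - z)) h + (h \<bullet> grad f p) *\<^sub>R grad \<theta> (p - z)))) (at p)"
    if p: "p \<in> ball z (r / 2)" "p \<noteq> z" for p
  proof -
    have g\<theta>: "((\<lambda>p. grad \<theta> (p - z)) has_derivative frechet_derivative (grad \<theta>) (at (p - z))) (at p)"
      using has_derivative_compose[OF shiftd, of "grad \<theta>"]
        smooth_on_has_derivative[OF smooth_on_grad[OF \<theta>(1)], of "p - z"] p by force
    show ?thesis unfolding G_def
      by (intro has_derivative_add has_derivative_scaleR \<theta>d fd g\<theta> p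
          smooth_on_has_derivative[OF smooth_on_grad[OF f(1)]] sub)
  qed
  have GB: "norm (G p) \<le> 2 * B * M * norm (p - z)" if p: "p \<in> ball z (r / 2)" "p \<noteq> z" for p
  proof -
    let ?n = "norm (p - z)"
    have "norm (G p) \<le> \<bar>\<theta> (p - z)\<bar> * norm (grad f p) + \<bar>f p\<bar> * norm (grad \<theta> (p - z))"
      unfolding G_def by (rule order_trans[OF norm_triangle_ineq]) simp
    also have "\<dots> \<le> B * (M * ?n) + M * ?n\<^sup>2 * norm (grad \<theta> (p - z))"
      using p \<theta>(5)[of "p - z"] \<theta>(2) by (intro add_mono mult_mono Gf mult_right_mono Ff) auto
    also have "\<dots> = B * (M * ?n) + M * ?n * (norm (grad \<theta> (p - z)) * ?n)"
      by (simp add: power2_eq_square)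
    also have "\<dots> \<le> B * (M * ?n) + M * ?n * B"
      using p \<theta>(6)[of "p - z"] M(1) \<theta>(2) by (intro add_mono mult_left_mono) auto
    finally show ?thesis by (simp add: mult_ac)
  qed
  have Gz: "G z = 0" "H z = 0" using f by (auto simp: G_def H_def)
  \<comment> \<open>The derivative of \<open>G\<close> has four terms, each of norm at most
    \<open>B * M * norm h\<close>.\<close>
  have lip: "(4 * B * M)-lipschitz_on (ball z (r / 2)) G"
  proof (rule lipschitz_on_punctured_ball[OF Gd])
    show "norm (G p - G z) \<le> 4 * B * M * norm (p - z)" if "p \<in> ball z (r / 2)" for p
    proof (cases "p = z")
      case False
      have "0 \<le> 2 * B * M * norm (p - z)" using M(1) \<theta>(2) by simp
      then show ?thesis using GB[OF that False] Gz by simp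
    qed simp
    show "0 \<le> 4 * B * M" using M(1) \<theta>(2) by simp
    fix p h assume p: "p \<in> ball z (r / 2)" "p \<noteq> z"
    let ?n = "norm (p - z)"
    have n: "0 < ?n" using p by simp
    have 1: "norm (\<theta> (p - z) *\<^sub>R frechet_derivative (grad f) (at p) h) \<le> B * (M * norm h)"
      unfolding norm_scaleR using p \<theta>(5)[of "p - z"] \<theta>(2) M(2)[of p h] by (intro mult_mono) auto
    have 2: "norm ((h \<bullet> grad \<theta> (p - z)) *\<^sub>R grad f p) \<le> B * (M * norm h)"
    proof -
      have "norm ((h \<bullet> grad \<theta> (p - z)) *\<^sub>R grad f p) \<le> (norm h * norm (grad \<theta> (p - z))) * (M * ?n)"
        unfolding norm_scaleR by (intro mult_mono Cauchy_Schwarz_ineq2 Gf p(1)) auto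
      also have "\<dots> = (norm (grad \<theta> (p - z)) * ?n) * (M * norm h)" by simp
      also have "\<dots> \<le> B * (M * norm h)" using p \<theta>(6)[of "p - z"] \<theta>(2) M(1) by (intro mult_right_mono) auto
      finally show ?thesis .
    qed
    have 3: "norm (f p *\<^sub>R frechet_derivative (grad \<theta>) (at (p - z)) h) \<le> B * (M * norm h)"
    proof -
      have "norm (f p *\<^sub>R frechet_derivative (grad \<theta>) (at (p - z)) h) \<le>
          (M * ?n\<^sup>2) * norm (frechet_derivative (grad \<theta>) (at (p - z)) h)"
        unfolding norm_scaleR real_norm_def by (intro mult_right_mono Ff p(1)) auto
      also have "\<dots> = M * (norm (frechet_derivative (grad \<theta>) (at (p - z)) h) * ?n\<^sup>2)" by simp
      also have "\<dots> \<le> M * (B * norm h)" using p \<theta>(7)[of "p - z" h] M(1) by (intro mult_left_mono) auto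
      finally show ?thesis by (simp add: mult_ac)
    qed
    have 4: "norm ((h \<bullet> grad f p) *\<^sub>R grad \<theta> (p - z)) \<le> B * (M * norm h)"
    proof -
      have "norm ((h \<bullet> grad f p) *\<^sub>R grad \<theta> (p - z)) \<le> (norm h * (M * ?n)) * norm (grad \<theta> (p - z))"
        unfolding norm_scaleR real_norm_def
        by (intro mult_right_mono order_trans[OF Cauchy_Schwarz_ineq2] mult_left_mono Gf p(1)) auto
      also have "\<dots> = (norm (grad \<theta> (p - z)) * ?n) * (M * norm h)" by simp
      also have "\<dots> \<le> B * (M * norm h)" using p \<theta>(6)[of "p - z"] \<theta>(2) M(1) by (intro mult_right_mono) auto
      finally show ?thesis .
    qed
    show "norm ((\<theta> (p - z) *\<^sub>R frechet_derivative (grad f) (at p) h + (h \<bullet> grad \<theta> (p - z)) *\<^sub>R grad f p) +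
      (f p *\<^sub>R frechet_derivative (grad \<theta>) (at (p - z)) h + (h \<bullet> grad f p) *\<^sub>R grad \<theta> (p - z)))
      \<le> 4 * B * M * norm h"
      using norm_triangle_mono[OF norm_triangle_mono[OF 1 2] norm_triangle_mono[OF 3 4]] by simp
  qed
  \<comment> \<open>The cutoff need not be continuous at the corner, so the product rule does not
    apply there; the quadratic bound on \<open>f\<close> gives the zero derivative directly.\<close>
  have Hz: "(H has_derivative (\<lambda>h. h \<bullet> 0)) (at z)"
  proof (rule has_derivativeI_sandwich[where e = "r / 2" and H = "\<lambda>p. B * M * norm (p - z)"])
    show "((\<lambda>p. B * M * norm (p - z)) \<longlongrightarrow> 0) (at z)"
      by (rule tendsto_eq_intros | simp)+
    fix p assume p: "p \<noteq> z" "dist p z < r / 2"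
    have "\<bar>H p\<bar> \<le> B * (M * (norm (p - z))\<^sup>2)"
      unfolding H_def abs_mult using p \<theta>(2) \<theta>(5)[of "p - z"]
      by (intro mult_mono Ff) (auto simp: dist_commute)
    then show "norm (H p - H z - (p - z) \<bullet> 0) / norm (p - z) \<le> B * M * norm (p - z)"
      using p Gz by (simp add: divide_le_eq power2_eq_square mult_ac)
  qed (use assms(4) in auto)
  have "C11_on (ball z (r / 2)) {z} H G" unfolding C11_on_def loc_lipschitz_on_def
  proof (intro conjI ballI Hs)
    fix p assume p: "p \<in> ball z (r / 2)"
    show "GDERIV H p :> G p"
    proof (cases "p = z")
      case True
      then show ?thesis using Hz Gz by (simp add: gderiv_def)
    next
      case False
      then show ?thesis unfolding H_def G_def
        by (intro GDERIV_mult) (use fd[OF p] \<theta>d in \<open>auto simp: gderiv_def\<close>)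
    qed
    show "\<exists>s>0. \<exists>C. C-lipschitz_on (ball p s) G"
    proof (cases "p = z")
      case True
      then show ?thesis using lip assms(4) by (intro exI[of _ "r / 2"]) auto
    next
      case False
      then show ?thesis
        using smooth_on_loc_lipschitz_on[OF Gs] p unfolding loc_lipschitz_on_def by auto
    qed
  qed auto
  then show ?thesis
    by (rule that) (use Gz \<theta>(3,4) in \<open>auto simp: H_def G_def\<close>)
qed

section \<open>Extending a function from an arc with prescribed gradient\<close>

text \<open>The inverse solves the equation \<tau>' = 1 / a'(\<tau>), so
  \<open>smooth_on_bootstrap\<close> raises the differentiability supplied by the inverse function
  theorem to smoothness.\<close>

lemma smooth_local_inverse:
  fixes a :: "real \<Rightarrow> real"
  assumes a: "smooth_on (ball t0 \<delta>) a" "0 < \<delta>" and nz: "vector_derivative a (at t0) \<noteq> 0"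
  obtains U V \<tau> where "open U" "t0 \<in> U" "U \<subseteq> ball t0 \<delta>" "open V" "homeomorphism U V a \<tau>" "smooth_on V \<tau>"
proof -
  let ?a' = "\<lambda>t. vector_derivative a (at t)"
  \<comment> \<open>The inverse function theorem takes the derivative as a bounded linear function;
    on the line it is a multiple of the identity.\<close>
  define f' where "f' t = ?a' t *\<^sub>R (id_blinfun :: real \<Rightarrow>\<^sub>L real)" for t
  have app: "blinfun_apply (f' t) = (\<lambda>h. h * ?a' t)" for t
    by (simp add: f'_def blinfun.scaleR_left mult.commute fun_eq_iff)
  have der: "(a has_derivative blinfun_apply (f' t)) (at t)" if "t \<in> ball t0 \<delta>" for t
    using smooth_on_has_vector_derivative[OF a(1) that] unfolding has_vector_derivative_def app by simp
  have cont: "continuous_on (ball t0 \<delta>) f'" unfolding f'_def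
    by (intro continuous_on_scaleR continuous_on_const smooth_on_continuous_on
        smooth_on_vector_derivative a)
  have inv: "((1 / ?a' t0) *\<^sub>R id_blinfun) o\<^sub>L f' t0 = id_blinfun"
    using nz by (intro blinfun_eqI) (simp add: f'_def blinfun.scaleR_left)
  obtain U V \<tau> \<tau>' where UV: "open U" "U \<subseteq> ball t0 \<delta>" "t0 \<in> U" "open V" "a t0 \<in> V" "homeomorphism U V a \<tau>"
    "\<And>y. y \<in> V \<Longrightarrow> (\<tau> has_derivative \<tau>' y) (at y)"
    "\<And>y. y \<in> V \<Longrightarrow> \<tau>' y = Hilbert_Choice.inv (blinfun_apply (f' (\<tau> y)))"
    "\<And>y. y \<in> V \<Longrightarrow> bij (blinfun_apply (f' (\<tau> y)))"
    using inverse_function_theorem[OF open_ball der cont _ inv] a(2) by (metis centre_in_ball)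
  have nz': "?a' (\<tau> y) \<noteq> 0" if "y \<in> V" for y
    using UV(9)[OF that] unfolding app by (auto dest!: bij_is_inj injD[of _ 0 1])
  have \<tau>': "\<tau>' y = (\<lambda>h. inverse (?a' (\<tau> y)) * h)" if "y \<in> V" for y
    unfolding UV(8)[OF that] app using nz'[OF that]
    by (intro inv_equality) (auto simp: field_simps)
  have img: "\<tau> ` V \<subseteq> ball t0 \<delta>" using homeomorphism_image2[OF UV(6)] UV(2) by simp
  have "smooth_on V \<tau>"
  proof (rule smooth_on_bootstrap[OF UV(4,7)])
    fix i :: real and k assume C: "C_k k V \<tau>"
    have s: "smooth_on (\<tau> ` V) (\<lambda>t. inverse (?a' t))"
      using homeomorphism_image2[OF UV(6)] UV(1,2) nz'
      by (intro smooth_on_inverse smooth_on_subset[OF smooth_on_vector_derivative[OF a(1)]]) auto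
    then have "C_k k V (\<lambda>y. inverse (?a' (\<tau> y)))"
      by (intro C_k_compose[OF UV(4) _ _ _ C, where T = "\<tau> ` V"]) (auto simp: smooth_on_def)
    then have "C_k k V (\<lambda>y. inverse (?a' (\<tau> y)) * i)"
      by (intro C_k_bilinear[OF bounded_bilinear_mult UV(4)] C_k_const)
    then show "C_k k V (\<lambda>y. \<tau>' y i)"
      using C_k_cong[OF UV(4), of "\<lambda>y. \<tau>' y i" "\<lambda>y. inverse (?a' (\<tau> y)) * i"] \<tau>' by simp
  qed
  then show ?thesis by (rule that[OF UV(1,3,2,4,6)])
qed

text \<open>On the arc the derivative of the foot point \<open>T p\<close> drops out of the derivative of the expansion,
  because \<open>\<omega>' = \<kappa> \<cdot> \<alpha>'\<close>; so any smooth choice of foot points will do.\<close>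

lemma arc_jet:
  fixes \<alpha> \<kappa> :: "real \<Rightarrow> 'a::euclidean_space" and \<omega> :: "real \<Rightarrow> real"
  assumes \<alpha>: "smooth_on (ball t0 \<delta>) \<alpha>" and \<kappa>: "smooth_on (ball t0 \<delta>) \<kappa>" and \<omega>: "smooth_on (ball t0 \<delta>) \<omega>"
    and "0 < \<delta>"
    and d\<omega>: "\<And>t. t \<in> ball t0 \<delta> \<Longrightarrow> vector_derivative \<omega> (at t) = \<kappa> t \<bullet> vector_derivative \<alpha> (at t)"
    and e: "e \<bullet> vector_derivative \<alpha> (at t0) \<noteq> 0"
  obtains r \<epsilon> \<psi> where "0 < r" "0 < \<epsilon>" "smooth_on (ball (\<alpha> t0) r) \<psi>"
    "\<And>t. t \<in> ball t0 \<epsilon> \<Longrightarrow> \<alpha> t \<in> ball (\<alpha> t0) r \<Longrightarrow> \<psi> (\<alpha> t) = \<omega> t \<and> grad \<psi> (\<alpha> t) = \<kappa> t"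
proof -
  have a: "smooth_on (ball t0 \<delta>) (\<lambda>t. e \<bullet> \<alpha> t)"
    by (intro smooth_on_inner smooth_on_const \<alpha>) auto
  have "((\<lambda>t. e \<bullet> \<alpha> t) has_vector_derivative e \<bullet> vector_derivative \<alpha> (at t0)) (at t0)"
    by (intro bounded_linear.has_vector_derivative[OF bounded_linear_inner_right]
        smooth_on_has_vector_derivative[OF \<alpha>]) (use assms(4) in auto)
  then have "vector_derivative (\<lambda>t. e \<bullet> \<alpha> t) (at t0) \<noteq> 0"
    using e vector_derivative_at by metis
  with smooth_local_inverse[OF a assms(4)] obtain U V \<tau> where
    UV: "open U" "t0 \<in> U" "U \<subseteq> ball t0 \<delta>" "open V" "homeomorphism U V (\<lambda>t. e \<bullet> \<alpha> t) \<tau>" "smooth_on V \<tau>"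
    by metis
  \<comment> \<open>The foot point of \<open>p\<close> is the parameter at which the arc has the
    same \<open>e\<close>-component. It depends smoothly on \<open>p\<close> because
    \<open>e\<close> is not orthogonal to the arc at \<open>t0\<close>.\<close>
  define T where "T p = \<tau> (e \<bullet> p)" for p
  have V: "e \<bullet> \<alpha> t \<in> V" and T: "T (\<alpha> t) = t" if "t \<in> U" for t
    using homeomorphism_image1[OF UV(5)] homeomorphism_apply1[OF UV(5) that] that by (auto simp: T_def)
  have "open ((\<lambda>p. e \<bullet> p) -` V)" by (intro open_vimage UV(4) continuous_intros)
  moreover have "\<alpha> t0 \<in> (\<lambda>p. e \<bullet> p) -` V" using V[OF UV(2)] by simp
  ultimately obtain r where r: "0 < r" "ball (\<alpha> t0) r \<subseteq> (\<lambda>p. e \<bullet> p) -` V"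
    using open_contains_ball by metis
  obtain \<epsilon> where \<epsilon>: "0 < \<epsilon>" "ball t0 \<epsilon> \<subseteq> U" using UV(1,2) open_contains_ball by metis
  have Ts: "smooth_on (ball (\<alpha> t0) r) T" unfolding T_def
    by (intro smooth_on_compose[OF UV(6)] smooth_on_inner smooth_on_const smooth_on_id)
      (use r(2) in auto)
  have TU: "T p \<in> ball t0 \<delta>" if "p \<in> ball (\<alpha> t0) r" for p
  proof -
    have "e \<bullet> p \<in> V" using r(2) that by auto
    then show ?thesis using homeomorphism_image2[OF UV(5)] UV(3) by (auto simp: T_def)
  qed
  define \<psi> where "\<psi> p = \<omega> (T p) + \<kappa> (T p) \<bullet> (p - \<alpha> (T p))" for p
  show ?thesis
  proof (rule that[OF r(1) \<epsilon>(1)])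
    show "smooth_on (ball (\<alpha> t0) r) \<psi>" unfolding \<psi>_def
      by (intro smooth_on_add smooth_on_inner smooth_on_diff smooth_on_id open_ball
          smooth_on_compose[OF \<omega> Ts] smooth_on_compose[OF \<kappa> Ts] smooth_on_compose[OF \<alpha> Ts])
        (use TU in auto)
    fix t assume t: "t \<in> ball t0 \<epsilon>" "\<alpha> t \<in> ball (\<alpha> t0) r"
    let ?p = "\<alpha> t"
    have tU: "t \<in> U" "t \<in> ball t0 \<delta>" using t(1) \<epsilon>(2) UV(3) by blast+
    have Tt: "T ?p = t" by (rule T[OF tU(1)])
    obtain D where D: "(T has_derivative D) (at ?p)" using smooth_on_has_derivative[OF Ts t(2)] by blast
    have comp: "((\<lambda>p. g (T p)) has_derivative (\<lambda>h. D h *\<^sub>R vector_derivative g (at t))) (at ?p)"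
      if "smooth_on (ball t0 \<delta>) g" for g :: "real \<Rightarrow> 'c::real_normed_vector"
      by (rule has_derivative_compose[OF D]) (unfold Tt, rule smooth_on_has_vector_derivative
          [OF that tU(2), unfolded has_vector_derivative_def])
    have "(\<psi> has_derivative (\<lambda>h. D h *\<^sub>R vector_derivative \<omega> (at t) +
        (\<kappa> (T ?p) \<bullet> (h - D h *\<^sub>R vector_derivative \<alpha> (at t)) +
          (D h *\<^sub>R vector_derivative \<kappa> (at t)) \<bullet> (?p - \<alpha> (T ?p))))) (at ?p)"
      unfolding \<psi>_def
      by (intro has_derivative_add has_derivative_inner has_derivative_diff has_derivative_ident
          comp \<omega> \<kappa> \<alpha>)
    \<comment> \<open>By \<open>Tt\<close> the last term contains the factor
      \<open>\<alpha> t - \<alpha> t\<close>; by \<open>d\<omega>\<close> the two other terms with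
      \<open>D h\<close> cancel.\<close>
    also have "(\<lambda>h. D h *\<^sub>R vector_derivative \<omega> (at t) +
        (\<kappa> (T ?p) \<bullet> (h - D h *\<^sub>R vector_derivative \<alpha> (at t)) +
          (D h *\<^sub>R vector_derivative \<kappa> (at t)) \<bullet> (?p - \<alpha> (T ?p)))) = (\<lambda>h. h \<bullet> \<kappa> t)"
      unfolding Tt d\<omega>[OF tU(2)] by (simp add: inner_diff_right inner_commute)
    finally show "\<psi> ?p = \<omega> t \<and> grad \<psi> ?p = \<kappa> t"
      using Tt by (auto simp: \<psi>_def[abs_def] gderiv_def intro!: grad_eqI)
  qed
qed

text \<open>The difference quotient tends to \<open>d\<close>, which lies in an open cone; the cone
  is invariant under positive scaling, so the secant itself lies in it.\<close>

lemma arc_in_cone: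
  fixes \<alpha> :: "real \<Rightarrow> 'a::euclidean_space"
  assumes "(\<alpha> has_vector_derivative d) (at 0)" "c * norm d < e \<bullet> d"
  obtains \<epsilon> where "0 < \<epsilon>"
    "\<And>s. 0 < s \<Longrightarrow> s < \<epsilon> \<Longrightarrow> c * norm (\<alpha> s - \<alpha> 0) < e \<bullet> (\<alpha> s - \<alpha> 0)"
proof -
  have "((\<lambda>s. (\<alpha> s - \<alpha> 0) /\<^sub>R s) \<longlongrightarrow> d) (at 0)"
  proof (rule LIM_zero_cancel, rule tendsto_norm_zero_cancel)
    have "((\<lambda>s. norm (\<alpha> (0 + s) - \<alpha> 0 - s *\<^sub>R d) / norm s) \<longlongrightarrow> 0) (at 0)"
      using assms(1) unfolding has_vector_derivative_def has_derivative_at by blast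
    then show "((\<lambda>s. norm ((\<alpha> s - \<alpha> 0) /\<^sub>R s - d)) \<longlongrightarrow> 0) (at 0)"
    proof (rule Lim_transform_eventually)
      show "\<forall>\<^sub>F s in at 0. norm (\<alpha> (0 + s) - \<alpha> 0 - s *\<^sub>R d) / norm s = norm ((\<alpha> s - \<alpha> 0) /\<^sub>R s - d)"
        unfolding eventually_at_filter
      proof (intro always_eventually allI impI)
        fix s :: real assume "s \<noteq> 0"
        then have "(\<alpha> s - \<alpha> 0) /\<^sub>R s - d = (\<alpha> s - \<alpha> 0 - s *\<^sub>R d) /\<^sub>R s"
          by (simp add: scaleR_diff_right)
        then have "norm ((\<alpha> s - \<alpha> 0) /\<^sub>R s - d) = norm (\<alpha> s - \<alpha> 0 - s *\<^sub>R d) / norm s"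
          by (simp only: norm_scaleR norm_inverse abs_inverse real_norm_def divide_inverse mult.commute)
        then show "norm (\<alpha> (0 + s) - \<alpha> 0 - s *\<^sub>R d) / norm s = norm ((\<alpha> s - \<alpha> 0) /\<^sub>R s - d)"
          by simp
      qed
    qed
  qed
  then have "((\<lambda>s. e \<bullet> ((\<alpha> s - \<alpha> 0) /\<^sub>R s) - c * norm ((\<alpha> s - \<alpha> 0) /\<^sub>R s)) \<longlongrightarrow> e \<bullet> d - c * norm d) (at 0)"
    by (intro tendsto_intros)
  then have "\<forall>\<^sub>F s in at 0. 0 < e \<bullet> ((\<alpha> s - \<alpha> 0) /\<^sub>R s) - c * norm ((\<alpha> s - \<alpha> 0) /\<^sub>R s)"
    using assms(2) by (intro order_tendstoD(1)) auto
  then obtain \<epsilon> where \<epsilon>: "0 < \<epsilon>" "\<And>s. s \<noteq> 0 \<Longrightarrow> \<bar>s\<bar> < \<epsilon> \<Longrightarrow>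
      0 < e \<bullet> ((\<alpha> s - \<alpha> 0) /\<^sub>R s) - c * norm ((\<alpha> s - \<alpha> 0) /\<^sub>R s)"
    unfolding eventually_at by (auto simp: dist_real_def)
  show ?thesis
  proof (rule that[OF \<epsilon>(1)])
    fix s assume s: "0 < s" "s < \<epsilon>"
    then have "0 < s * (e \<bullet> ((\<alpha> s - \<alpha> 0) /\<^sub>R s) - c * norm ((\<alpha> s - \<alpha> 0) /\<^sub>R s))"
      using \<epsilon>(2)[of s] by (intro mult_pos_pos) auto
    then show "c * norm (\<alpha> s - \<alpha> 0) < e \<bullet> (\<alpha> s - \<alpha> 0)"
      using s by (simp add: right_diff_distrib)
  qed
qed

text \<open>A germ at the start of an arc \<Gamma> together with the values \<open>U\<close> and
  gradients \<open>Q\<close> to be prescribed on it. The smooth representatives live on both sides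
  of 0, so that derivatives at the end point are ordinary two-sided ones. The equation for the
  derivative of \<omega> is the compatibility condition dU = Q . d\<Gamma>.\<close>

definition smooth_arc ::
  "(real \<Rightarrow> 'a::euclidean_space) \<Rightarrow> (real \<Rightarrow> 'a) \<Rightarrow> (real \<Rightarrow> real) \<Rightarrow> 'a \<Rightarrow> bool" where
  "smooth_arc \<Gamma> Q U d \<longleftrightarrow>
     (\<exists>\<delta>>0. \<exists>\<alpha> \<kappa> \<omega>. smooth_on (ball 0 \<delta>) \<alpha> \<and> smooth_on (ball 0 \<delta>) \<kappa> \<and> smooth_on (ball 0 \<delta>) \<omega> \<and>
        (\<forall>s\<in>ball 0 \<delta>. vector_derivative \<omega> (at s) = \<kappa> s \<bullet> vector_derivative \<alpha> (at s)) \<and>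
        (\<forall>s\<in>{0..<\<delta>}. \<Gamma> s = \<alpha> s \<and> Q s = \<kappa> s \<and> U s = \<omega> s) \<and> vector_derivative \<alpha> (at 0) = d)"

lemma smooth_arc_jet:
  fixes \<Gamma> :: "real \<Rightarrow> 'a::euclidean_space"
  assumes "smooth_arc \<Gamma> Q U d" "c * norm d < e \<bullet> d" "0 < c"
  obtains r \<epsilon> \<psi> where "0 < r" "0 < \<epsilon>" "smooth_on (ball (\<Gamma> 0) r) \<psi>"
    "\<And>s. 0 \<le> s \<Longrightarrow> s < \<epsilon> \<Longrightarrow> \<Gamma> s \<in> ball (\<Gamma> 0) r \<Longrightarrow> \<psi> (\<Gamma> s) = U s \<and> grad \<psi> (\<Gamma> s) = Q s"
    "\<And>s. 0 < s \<Longrightarrow> s < \<epsilon> \<Longrightarrow> c * norm (\<Gamma> s - \<Gamma> 0) < e \<bullet> (\<Gamma> s - \<Gamma> 0)"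
proof -
  obtain \<delta> \<alpha> \<kappa> \<omega> where \<delta>: "0 < \<delta>" and s: "smooth_on (ball 0 \<delta>) \<alpha>" "smooth_on (ball 0 \<delta>) \<kappa>"
    "smooth_on (ball 0 \<delta>) \<omega>"
    and d: "\<And>s. s \<in> ball 0 \<delta> \<Longrightarrow> vector_derivative \<omega> (at s) = \<kappa> s \<bullet> vector_derivative \<alpha> (at s)"
      "vector_derivative \<alpha> (at 0) = d"
    and eq: "\<And>s. 0 \<le> s \<Longrightarrow> s < \<delta> \<Longrightarrow> \<Gamma> s = \<alpha> s \<and> Q s = \<kappa> s \<and> U s = \<omega> s"
    using assms(1) unfolding smooth_arc_def atLeastLessThan_iff Ball_def by blast
  have "0 \<le> c * norm d" using assms(3) by simp
  \<comment> \<open>The cone inequality does double duty: it keeps the arc in the cone and makes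
    \<open>e\<close> transverse to it, as \<open>arc_jet\<close> requires.\<close>
  then have "e \<bullet> vector_derivative \<alpha> (at 0) \<noteq> 0" unfolding d(2) using assms(2) by linarith
  from arc_jet[OF s \<delta> d(1) this] obtain r \<epsilon>1 \<psi> where 1: "0 < r" "0 < \<epsilon>1" "smooth_on (ball (\<alpha> 0) r) \<psi>"
    "\<And>t. t \<in> ball 0 \<epsilon>1 \<Longrightarrow> \<alpha> t \<in> ball (\<alpha> 0) r \<Longrightarrow> \<psi> (\<alpha> t) = \<omega> t \<and> grad \<psi> (\<alpha> t) = \<kappa> t"
    by metis
  have "(\<alpha> has_vector_derivative d) (at 0)"
    using smooth_on_has_vector_derivative[OF s(1)] d(2) \<delta> by auto
  from arc_in_cone[OF this assms(2)] obtain \<epsilon>2 where 2: "0 < \<epsilon>2"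
    "\<And>s. 0 < s \<Longrightarrow> s < \<epsilon>2 \<Longrightarrow> c * norm (\<alpha> s - \<alpha> 0) < e \<bullet> (\<alpha> s - \<alpha> 0)" by metis
  have 0: "\<Gamma> 0 = \<alpha> 0" using eq[of 0] \<delta> by simp
  show ?thesis
    by (rule that[of r "min \<delta> (min \<epsilon>1 \<epsilon>2)" \<psi>]) (use 0 1 2 \<delta> eq in auto)
qed

lemma inner_sgn_less_1:
  fixes u v :: "'a::real_inner"
  assumes "u \<noteq> 0" "v \<noteq> 0" "sgn u \<noteq> sgn v"
  shows "sgn u \<bullet> sgn v < 1"
proof -
  have "0 < (norm (sgn u - sgn v))\<^sup>2" using assms by simp
  also have "\<dots> = 2 - 2 * (sgn u \<bullet> sgn v)"
    using assms(1,2) by (simp add: power2_norm_eq_inner inner_diff_left inner_diff_right inner_commute)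
      (simp add: power2_norm_eq_inner[symmetric] norm_sgn)
  finally show ?thesis by simp
qed

text \<open>The expansions along the two arcs agree to first order at the corner, so
  \<open>corner_blend\<close> applies to their difference. Adding the blended difference to
  \<open>\<psi>2\<close> changes nothing on the second arc and yields \<open>\<psi>1\<close> on the
  first. Distinct tangent directions put the arcs into two disjoint cones.\<close>

lemma corner_jet:
  fixes \<Gamma> :: "real \<Rightarrow> 'a::euclidean_space"
  assumes arcs: "smooth_arc \<Gamma> Q U u" "smooth_arc (\<lambda>s. \<Gamma> (- s)) (\<lambda>s. Q (- s)) (\<lambda>s. U (- s)) v"
    and uv: "u \<noteq> 0" "v \<noteq> 0" "sgn u \<noteq> sgn v"
  obtains r \<epsilon> \<psi> G where "0 < r" "0 < \<epsilon>" "C11_on (ball (\<Gamma> 0) r) {\<Gamma> 0} \<psi> G"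
    "\<And>s. \<bar>s\<bar> < \<epsilon> \<Longrightarrow> \<Gamma> s \<in> ball (\<Gamma> 0) r \<Longrightarrow> \<psi> (\<Gamma> s) = U s \<and> G (\<Gamma> s) = Q s"
proof -
  define e where "e = sgn u - sgn v"
  \<comment> \<open>With this choice \<open>e \<bullet> sgn u\<close> is 2 c and
    \<open>e \<bullet> sgn v\<close> is -2 c; the spare factor 2 makes the cone inequalities
    strict.\<close>
  define c where "c = (1 - sgn u \<bullet> sgn v) / 2"
  let ?z = "\<Gamma> 0"
  have c: "0 < c" using inner_sgn_less_1[OF uv] by (simp add: c_def)
  have n: "sgn u \<bullet> sgn u = 1" "sgn v \<bullet> sgn v = 1"
    using uv by (simp_all add: power2_norm_eq_inner[symmetric] norm_sgn)
  have "e \<bullet> sgn u = 2 * c" "e \<bullet> sgn v = - (2 * c)"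
    using n by (simp_all add: e_def c_def inner_diff_left inner_commute[of "sgn v" "sgn u"] field_simps)
  moreover have "u = norm u *\<^sub>R sgn u" "v = norm v *\<^sub>R sgn v" using uv by (simp_all add: sgn_div_norm)
  ultimately have "e \<bullet> u = norm u * (2 * c)" "e \<bullet> v = norm v * - (2 * c)"
    by (metis inner_scaleR_right)+
  then have cone: "c * norm u < e \<bullet> u" "c * norm v < (- e) \<bullet> v"
    using c uv by auto
  obtain r1 \<epsilon>1 \<psi>1 where 1: "0 < r1" "0 < \<epsilon>1" "smooth_on (ball ?z r1) \<psi>1"
    "\<And>s. 0 \<le> s \<Longrightarrow> s < \<epsilon>1 \<Longrightarrow> \<Gamma> s \<in> ball ?z r1 \<Longrightarrow> \<psi>1 (\<Gamma> s) = U s \<and> grad \<psi>1 (\<Gamma> s) = Q s"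
    "\<And>s. 0 < s \<Longrightarrow> s < \<epsilon>1 \<Longrightarrow> c * norm (\<Gamma> s - ?z) < e \<bullet> (\<Gamma> s - ?z)"
    by (rule smooth_arc_jet[OF arcs(1) cone(1) c]) (rule that; assumption)
  obtain r2 \<epsilon>2 \<psi>2 where 2: "0 < r2" "0 < \<epsilon>2" "smooth_on (ball (\<Gamma> (- 0)) r2) \<psi>2"
    "\<And>s. 0 \<le> s \<Longrightarrow> s < \<epsilon>2 \<Longrightarrow> \<Gamma> (- s) \<in> ball (\<Gamma> (- 0)) r2 \<Longrightarrow>
      \<psi>2 (\<Gamma> (- s)) = U (- s) \<and> grad \<psi>2 (\<Gamma> (- s)) = Q (- s)"
    "\<And>s. 0 < s \<Longrightarrow> s < \<epsilon>2 \<Longrightarrow> c * norm (\<Gamma> (- s) - \<Gamma> (- 0)) < (- e) \<bullet> (\<Gamma> (- s) - \<Gamma> (- 0))"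
    by (rule smooth_arc_jet[OF arcs(2) cone(2) c]) (rule that; assumption)
  define r where "r = min r1 r2"
  have r: "0 < r" "r \<le> r1" "r \<le> r2" using 1 2 by (auto simp: r_def)
  have s: "smooth_on (ball ?z r) \<psi>1" "smooth_on (ball ?z r) \<psi>2"
    using smooth_on_subset[OF 1(3)] smooth_on_subset[OF 2(3)] r by (auto simp: subset_ball)
  define f where "f p = \<psi>1 p - \<psi>2 p" for p
  have fs: "smooth_on (ball ?z r) f" unfolding f_def by (rule smooth_on_diff[OF s])
  have gradf: "grad f p = grad \<psi>1 p - grad \<psi>2 p" if "p \<in> ball ?z r" for p
    unfolding f_def by (intro grad_eqI GDERIV_diff GDERIV_grad[OF _ that] s)
  have "f ?z = 0" "grad f ?z = 0"
    using gradf[of ?z] 1(4)[of 0] 2(4)[of 0] 1 2 r by (auto simp: f_def)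
  from corner_blend[OF fs this r(1) c, of e] obtain H G where
    H: "C11_on (ball ?z (r / 2)) {?z} H G" "H ?z = 0" "G ?z = 0"
    "\<And>p. c * norm (p - ?z) < e \<bullet> (p - ?z) \<Longrightarrow> H p = f p \<and> G p = grad f p"
    "\<And>p. e \<bullet> (p - ?z) < - c * norm (p - ?z) \<Longrightarrow> H p = 0 \<and> G p = 0" by metis
  show ?thesis
  proof (rule that[of "r / 2" "min \<epsilon>1 \<epsilon>2"])
    show "C11_on (ball ?z (r / 2)) {?z} (\<lambda>p. \<psi>2 p + H p) (\<lambda>p. grad \<psi>2 p + G p)"
      by (intro C11_on_add H(1) C11_on_smooth smooth_on_subset[OF s(2)]) (use r in auto)
    fix t assume t: "\<bar>t\<bar> < min \<epsilon>1 \<epsilon>2" "\<Gamma> t \<in> ball ?z (r / 2)"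
    then have tr: "\<Gamma> t \<in> ball ?z r" "\<Gamma> t \<in> ball ?z r1" "\<Gamma> t \<in> ball ?z r2" using r by auto
    consider "t = 0" | "0 < t" | "t < 0" by linarith
    then show "\<psi>2 (\<Gamma> t) + H (\<Gamma> t) = U t \<and> grad \<psi>2 (\<Gamma> t) + G (\<Gamma> t) = Q t"
    proof cases
      case 1
      then show ?thesis using H(2,3) 2(4)[of 0] 2(1,2) by simp
    next
      case 2
      then show ?thesis using H(4)[OF 1(5)] 1(4)[of t] t tr gradf[OF tr(1)] by (auto simp: f_def)
    next
      case 3
      then show ?thesis using H(5)[of "\<Gamma> t"] 2(4)[of "- t"] 2(5)[of "- t"] t tr by auto
    qed
  qed (use r 1 2 in auto)
qed

section \<open>Extending a function from a loop with prescribed gradient\<close>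

lemma C11_on_zero:
  assumes "open S" "open (S - Z)"
  shows "C11_on S Z (\<lambda>p. 0) (\<lambda>p. 0)"
proof -
  have "grad (\<lambda>p::'a. 0) = (\<lambda>p. 0)" by (intro ext grad_eqI GDERIV_const)
  then show ?thesis using C11_on_smooth[OF smooth_on_const[OF assms(1), of 0] assms(2)] by simp
qed

text \<open>The local function has the right jet only for times close to \<open>t0\<close>, whereas
  the loop could return near \<open>\<Gamma> t0\<close> later. Injectivity modulo integers and
  compactness of a period rule this out on a small ball. A bump function then makes the local
  function global, and the product rule dictates the resulting jet.\<close>

lemma cutoff_extension:
  fixes \<Gamma> :: "real \<Rightarrow> 'a::euclidean_space"
  assumes cont: "continuous_on UNIV \<Gamma>"
    and inj: "\<And>t t'. \<Gamma> t = \<Gamma> t' \<Longrightarrow> t - t' \<in> \<int>"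
    and per: "\<And>t n. n \<in> \<int> \<Longrightarrow> \<Gamma> (t + n) = \<Gamma> t \<and> Q (t + n) = Q t \<and> U (t + n) = U t"
    and arcs: "smooth_arc (\<lambda>s. \<Gamma> (t0 + s)) (\<lambda>s. Q (t0 + s)) (\<lambda>s. U (t0 + s)) u"
      "smooth_arc (\<lambda>s. \<Gamma> (t0 - s)) (\<lambda>s. Q (t0 - s)) (\<lambda>s. U (t0 - s)) v"
    and uv: "u \<noteq> 0" "v \<noteq> 0" "sgn u \<noteq> sgn v"
  obtains \<beta> \<Psi> H \<rho> where "0 < \<rho>" "smooth_on UNIV \<beta>" "C11_on UNIV {\<Gamma> t0} \<Psi> H"
    "\<And>p. p \<in> ball (\<Gamma> t0) \<rho> \<Longrightarrow> \<beta> p = 1 \<and> grad \<beta> p = 0"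
    "\<And>t. \<Psi> (\<Gamma> t) = \<beta> (\<Gamma> t) * U t \<and> H (\<Gamma> t) = \<beta> (\<Gamma> t) *\<^sub>R Q t + U t *\<^sub>R grad \<beta> (\<Gamma> t)"
proof -
  let ?z = "\<Gamma> t0"
  obtain r \<epsilon> \<psi> G where r: "0 < r" "0 < \<epsilon>" "C11_on (ball (\<Gamma> (t0 + 0)) r) {\<Gamma> (t0 + 0)} \<psi> G"
    "\<And>s. \<bar>s\<bar> < \<epsilon> \<Longrightarrow> \<Gamma> (t0 + s) \<in> ball (\<Gamma> (t0 + 0)) r \<Longrightarrow>
      \<psi> (\<Gamma> (t0 + s)) = U (t0 + s) \<and> G (\<Gamma> (t0 + s)) = Q (t0 + s)"
    by (rule corner_jet[of "\<lambda>s. \<Gamma> (t0 + s)" "\<lambda>s. Q (t0 + s)" "\<lambda>s. U (t0 + s)" u v])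
      (use arcs uv in simp_all)
  \<comment> \<open>One full period centred at \<open>t0\<close>, without the times at which the
    local jet is already known.\<close>
  define K where "K = {t0 - 1/2..t0 + 1/2} - ball t0 \<epsilon>"
  have "compact (\<Gamma> ` K)" unfolding K_def
    by (intro compact_continuous_image continuous_on_subset[OF cont] compact_diff) auto
  then have op: "open (- (\<Gamma> ` K))" using compact_imp_closed by blast
  have "?z \<notin> \<Gamma> ` K"
  proof
    assume "?z \<in> \<Gamma> ` K"
    then obtain t where t: "t \<in> K" "t - t0 \<in> \<int>" using inj by (metis imageE)
    from t(2) obtain n :: int where n: "t - t0 = of_int n" by (auto elim: Ints_cases)
    have "t0 - 1/2 \<le> t" "t \<le> t0 + 1/2" using t(1) by (auto simp: K_def)
    then have "\<bar>t - t0\<bar> \<le> 1/2" by (intro abs_leI) linarith+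
    then have "n = 0" unfolding n by linarith
    then show False using n t(1) r(2) by (simp add: K_def)
  qed
  then obtain r' where r': "0 < r'" "ball ?z r' \<subseteq> - (\<Gamma> ` K)" using op open_contains_ball by blast
  define R where "R = min r r'"
  have R: "0 < R" "ball ?z R \<subseteq> ball ?z r" "ball ?z R \<subseteq> - (\<Gamma> ` K)"
    using r(1) r' by (auto simp: R_def)
  have jet: "\<psi> (\<Gamma> t) = U t \<and> G (\<Gamma> t) = Q t" if t: "\<Gamma> t \<in> ball ?z R" for t
  proof -
    \<comment> \<open>Rounding shifts \<open>t\<close> by an integer into the period centred at
      \<open>t0\<close>, where lying outside \<open>K\<close> means lying closer to
      \<open>t0\<close> than \<epsilon>.\<close>
    define n where "n = real_of_int (round (t - t0))"
    define s where "s = t - t0 - n"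
    have n: "n \<in> \<int>" by (simp add: n_def)
    have ts: "t = (t0 + s) + n" by (simp add: s_def)
    have "\<bar>s\<bar> \<le> 1/2" using of_int_round_abs_le[of "t - t0"] by (simp add: s_def n_def abs_minus_commute)
    moreover have G: "\<Gamma> (t0 + s) = \<Gamma> t" using per[OF n, of "t0 + s"] ts by metis
    then have "t0 + s \<notin> K" using R(3) t by (metis ComplD imageI subsetD)
    ultimately have "\<bar>s\<bar> < \<epsilon>" unfolding K_def by (auto simp: dist_real_def abs_le_iff)
    then have "\<psi> (\<Gamma> (t0 + s)) = U (t0 + s) \<and> G (\<Gamma> (t0 + s)) = Q (t0 + s)"
      using r(4)[of s] G t subsetD[OF R(2) t] by simp
    then show ?thesis using G per[OF n, of "t0 + s"] ts by metis
  qed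
  obtain \<beta> :: "'a \<Rightarrow> real" where \<beta>: "smooth_on UNIV \<beta>" "\<And>p. p \<in> ball ?z (R / 4) \<Longrightarrow> \<beta> p = 1"
    "\<And>p. p \<notin> ball ?z (R / 2) \<Longrightarrow> \<beta> p = 0" using smooth_bump[OF R(1)] by metis
  have gconst: "grad \<beta> p = 0" if "open T" "p \<in> T" "\<And>q. q \<in> T \<Longrightarrow> \<beta> q = a" for p T a
    by (rule grad_eqI) (simp add: gderiv_def has_derivative_transform_within_open
        [OF has_derivative_const[of a] that(1,2)] that(3))
  define \<Psi> where "\<Psi> p = (if p \<in> ball ?z R then \<beta> p * \<psi> p else 0)" for p
  define H where "H p = (if p \<in> ball ?z R then \<beta> p *\<^sub>R G p + \<psi> p *\<^sub>R grad \<beta> p else 0)" for p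
  have far: "\<beta> p = 0 \<and> grad \<beta> p = 0" if "p \<in> - cball ?z (R / 2)" for p
    using that \<beta>(3) gconst[of "- cball ?z (R / 2)" p 0] by auto
  show ?thesis
  proof (rule that[of "R / 4" \<beta> \<Psi> H])
    \<comment> \<open>The ball of radius \<open>R\<close> and the complement of the closed ball of
      radius \<open>R / 2\<close> are open and cover the space; on the latter the bump vanishes with
      its gradient, so extension by zero is consistent.\<close>
    show "C11_on UNIV {?z} \<Psi> H"
    proof (rule C11_on_local)
      fix p :: 'a
      show "\<exists>T F' G'. p \<in> T \<and> C11_on T {?z} F' G' \<and> (\<forall>q\<in>T. \<Psi> q = F' q \<and> H q = G' q)"
      proof (cases "p \<in> ball ?z R")
        case True
        have "C11_on (ball ?z R) {?z} (\<lambda>p. \<beta> p * \<psi> p) (\<lambda>p. \<beta> p *\<^sub>R G p + \<psi> p *\<^sub>R grad \<beta> p)"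
        proof (rule C11_on_mult)
          show "C11_on (ball ?z R) {?z} \<beta> (grad \<beta>)"
            by (intro C11_on_smooth smooth_on_subset[OF \<beta>(1)]) auto
          show "C11_on (ball ?z R) {?z} \<psi> G"
            by (rule C11_on_mono[of "ball ?z r" "{?z}"]) (use r(3) R(2) in auto)
        qed
        moreover have "\<forall>q\<in>ball ?z R. \<Psi> q = \<beta> q * \<psi> q \<and> H q = \<beta> q *\<^sub>R G q + \<psi> q *\<^sub>R grad \<beta> q"
          by (simp add: \<Psi>_def H_def)
        ultimately show ?thesis using True by blast
      next
        case False
        have "C11_on (- cball ?z (R / 2)) {?z} (\<lambda>p. 0) (\<lambda>p. 0)"
          by (rule C11_on_zero) auto
        moreover have "p \<in> - cball ?z (R / 2)" using False R(1) by auto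
        moreover have "\<forall>q\<in>- cball ?z (R / 2). \<Psi> q = 0 \<and> H q = 0"
          using far by (simp add: \<Psi>_def H_def)
        ultimately show ?thesis by blast
      qed
    qed auto
    show "\<beta> p = 1 \<and> grad \<beta> p = 0" if "p \<in> ball ?z (R / 4)" for p
      using \<beta>(2) gconst[OF open_ball that] that by blast
    show "\<Psi> (\<Gamma> t) = \<beta> (\<Gamma> t) * U t \<and> H (\<Gamma> t) = \<beta> (\<Gamma> t) *\<^sub>R Q t + U t *\<^sub>R grad \<beta> (\<Gamma> t)" for t
    proof (cases "\<Gamma> t \<in> ball ?z R")
      case True
      then show ?thesis using jet by (simp add: \<Psi>_def H_def)
    next
      case False
      then have "\<Gamma> t \<in> - cball ?z (R / 2)" using R(1) by auto
      then show ?thesis using far[of "\<Gamma> t"] False by (simp add: \<Psi>_def H_def)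
    qed
  qed (use R \<beta> in auto)
qed

text \<open>The local pieces are added one at a time, \<open>F\<close> being replaced by (1 -
  \<beta>) F + \<Psi>. Where \<open>F\<close> already has the jet (U, Q), the two terms with grad
  \<beta> cancel; near the new point \<beta> is 1 with zero gradient and \<open>F\<close> drops out.
  A correct jet is thus never destroyed, and finitely many balls cover the loop.\<close>

lemma loop_extension:
  fixes \<Gamma> :: "real \<Rightarrow> 'a::euclidean_space"
  assumes cont: "continuous_on UNIV \<Gamma>"
    and inj: "\<And>t t'. \<Gamma> t = \<Gamma> t' \<Longrightarrow> t - t' \<in> \<int>"
    and per: "\<And>t n. n \<in> \<int> \<Longrightarrow> \<Gamma> (t + n) = \<Gamma> t \<and> Q (t + n) = Q t \<and> U (t + n) = U t"
    and arcs: "\<And>t. \<exists>u v. smooth_arc (\<lambda>s. \<Gamma> (t + s)) (\<lambda>s. Q (t + s)) (\<lambda>s. U (t + s)) u \<and>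
      smooth_arc (\<lambda>s. \<Gamma> (t - s)) (\<lambda>s. Q (t - s)) (\<lambda>s. U (t - s)) v \<and>
      u \<noteq> 0 \<and> v \<noteq> 0 \<and> sgn u \<noteq> sgn v"
  obtains Z F G where "finite Z" "Z \<subseteq> range \<Gamma>" "C11_on UNIV Z F G"
    "\<And>t. F (\<Gamma> t) = U t \<and> G (\<Gamma> t) = Q t"
proof -
  have "\<exists>\<beta> \<Psi> H \<rho>. 0 < \<rho> \<and> smooth_on UNIV \<beta> \<and> C11_on UNIV {\<Gamma> t} \<Psi> H \<and>
      (\<forall>p \<in> ball (\<Gamma> t) \<rho>. \<beta> p = 1 \<and> grad \<beta> p = 0) \<and>
      (\<forall>s. \<Psi> (\<Gamma> s) = \<beta> (\<Gamma> s) * U s \<and> H (\<Gamma> s) = \<beta> (\<Gamma> s) *\<^sub>R Q s + U s *\<^sub>R grad \<beta> (\<Gamma> s))" for t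
  proof -
    obtain u v where uv: "smooth_arc (\<lambda>s. \<Gamma> (t + s)) (\<lambda>s. Q (t + s)) (\<lambda>s. U (t + s)) u"
      "smooth_arc (\<lambda>s. \<Gamma> (t - s)) (\<lambda>s. Q (t - s)) (\<lambda>s. U (t - s)) v" "u \<noteq> 0" "v \<noteq> 0" "sgn u \<noteq> sgn v"
      using arcs by metis
    show ?thesis
      by (rule cutoff_extension[OF cont inj per uv]) (assumption | blast)+
  qed
  then obtain \<beta> \<Psi> H \<rho> where *: "\<And>t. 0 < \<rho> t" "\<And>t. smooth_on UNIV (\<beta> t)" "\<And>t. C11_on UNIV {\<Gamma> t} (\<Psi> t) (H t)"
      "\<And>t p. p \<in> ball (\<Gamma> t) (\<rho> t) \<Longrightarrow> \<beta> t p = 1 \<and> grad (\<beta> t) p = 0"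
      "\<And>t s. \<Psi> t (\<Gamma> s) = \<beta> t (\<Gamma> s) * U s \<and> H t (\<Gamma> s) = \<beta> t (\<Gamma> s) *\<^sub>R Q s + U s *\<^sub>R grad (\<beta> t) (\<Gamma> s)"
    by metis
  have fin: "\<exists>F G. C11_on UNIV (\<Gamma> ` T) F G \<and>
      (\<forall>s. \<Gamma> s \<in> (\<Union>t\<in>T. ball (\<Gamma> t) (\<rho> t)) \<longrightarrow> F (\<Gamma> s) = U s \<and> G (\<Gamma> s) = Q s)" if "finite T" for T
    using that
  proof (induction T rule: finite_induct)
    case empty
    have "C11_on UNIV (\<Gamma> ` {}) (\<lambda>p. 0) (\<lambda>p. 0)"
      by (rule C11_on_zero) auto
    then show ?case by (intro exI conjI) auto
  next
    case (insert t T)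
    then obtain F G where FG: "C11_on UNIV (\<Gamma> ` T) F G"
      "\<And>s. \<Gamma> s \<in> (\<Union>t\<in>T. ball (\<Gamma> t) (\<rho> t)) \<Longrightarrow> F (\<Gamma> s) = U s \<and> G (\<Gamma> s) = Q s" by blast
    let ?Z = "\<Gamma> ` insert t T"
    have op: "open (UNIV - ?Z)" using insert(1) by (auto intro!: open_Diff finite_imp_closed)
    have C: "C11_on UNIV ?Z F G" "C11_on UNIV ?Z (\<Psi> t) (H t)"
      using C11_on_mono[OF FG(1) open_UNIV order_refl _ op]
        C11_on_mono[OF *(3)[of t] open_UNIV order_refl _ op] by blast+
    have C': "C11_on UNIV ?Z (\<lambda>p. 1 - \<beta> t p) (\<lambda>p. - grad (\<beta> t) p)"
    proof -
      have "GDERIV (\<lambda>p. 1 - \<beta> t p) p :> - grad (\<beta> t) p" for p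
        using GDERIV_diff[OF GDERIV_const[of 1 p] GDERIV_grad[OF *(2)[of t]]] by simp
      then have "grad (\<lambda>p. 1 - \<beta> t p) = (\<lambda>p. - grad (\<beta> t) p)" by (intro ext grad_eqI)
      moreover have "C11_on UNIV ?Z (\<lambda>p. 1 - \<beta> t p) (grad (\<lambda>p. 1 - \<beta> t p))"
        by (intro C11_on_smooth smooth_on_diff smooth_on_const *(2) op) auto
      ultimately show ?thesis by simp
    qed
    show ?case
    proof (intro exI conjI allI impI)
      show "C11_on UNIV ?Z (\<lambda>p. (1 - \<beta> t p) * F p + \<Psi> t p)
          (\<lambda>p. ((1 - \<beta> t p) *\<^sub>R G p + F p *\<^sub>R - grad (\<beta> t) p) + H t p)"
        by (intro C11_on_add C11_on_mult C C')
      fix s assume s: "\<Gamma> s \<in> (\<Union>t\<in>insert t T. ball (\<Gamma> t) (\<rho> t))"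
      \<comment> \<open>The two cases are the two reasons for correctness: an earlier ball already
        contains the point, or the new ball does.\<close>
      have or: "F (\<Gamma> s) = U s \<and> G (\<Gamma> s) = Q s \<or> \<beta> t (\<Gamma> s) = 1 \<and> grad (\<beta> t) (\<Gamma> s) = 0"
        using s FG(2)[of s] *(4)[of "\<Gamma> s" t] by blast
      show "(1 - \<beta> t (\<Gamma> s)) * F (\<Gamma> s) + \<Psi> t (\<Gamma> s) = U s"
        "((1 - \<beta> t (\<Gamma> s)) *\<^sub>R G (\<Gamma> s) + F (\<Gamma> s) *\<^sub>R - grad (\<beta> t) (\<Gamma> s)) + H t (\<Gamma> s) = Q s"
        using or *(5)[of t s] by (auto simp: algebra_simps)
    qed
  qed
  have cpt: "compact (\<Gamma> ` {0..1})" by (intro compact_continuous_image continuous_on_subset[OF cont]) auto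
  have cov: "\<Gamma> ` {0..1} \<subseteq> (\<Union>t\<in>{0..1}. ball (\<Gamma> t) (\<rho> t))" using *(1) by auto
  obtain T where T: "T \<subseteq> {0..1}" "finite T" "\<Gamma> ` {0..1} \<subseteq> (\<Union>t\<in>T. ball (\<Gamma> t) (\<rho> t))"
    by (rule compactE_image[OF cpt _ cov]) auto
  obtain F G where FG: "C11_on UNIV (\<Gamma> ` T) F G"
      "\<And>s. \<Gamma> s \<in> (\<Union>t\<in>T. ball (\<Gamma> t) (\<rho> t)) \<Longrightarrow> F (\<Gamma> s) = U s \<and> G (\<Gamma> s) = Q s"
    using fin[OF T(2)] by blast
  show ?thesis
  proof (rule that[OF _ _ FG(1)])
    fix t :: real
    have "frac t \<in> {0..1}" using frac_lt_1[of t] by (simp add: less_imp_le)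
    then have "F (\<Gamma> (frac t)) = U (frac t) \<and> G (\<Gamma> (frac t)) = Q (frac t)"
      using T(3) by (intro FG(2)) blast
    moreover have "t = frac t + of_int \<lfloor>t\<rfloor>" by (simp add: frac_def)
    ultimately show "F (\<Gamma> t) = U t \<and> G (\<Gamma> t) = Q t"
      using per[of "of_int \<lfloor>t\<rfloor>" "frac t"] by (metis Ints_of_int)
  qed (use T in auto)
qed

section \<open>Gradient graphs are Lagrangian\<close>

text \<open>The mean value theorem is used twice: in direction \<open>a\<close> for the increment of
  \<open>f\<close> by \<open>s *\<^sub>R b\<close>, and then in direction \<open>b\<close> for the
  derivative so obtained.\<close>

lemma second_difference:
  fixes f :: "'a::euclidean_space \<Rightarrow> real"
  assumes f: "smooth_on S f" and s: "0 < s"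
    and sub: "\<And>\<tau> \<sigma>. 0 \<le> \<tau> \<Longrightarrow> \<tau> \<le> s \<Longrightarrow> 0 \<le> \<sigma> \<Longrightarrow> \<sigma> \<le> s \<Longrightarrow> p + \<tau> *\<^sub>R a + \<sigma> *\<^sub>R b \<in> S"
  obtains \<tau> \<sigma> where "0 < \<tau>" "\<tau> < s" "0 < \<sigma>" "\<sigma> < s"
    "f (p + s *\<^sub>R a + s *\<^sub>R b) - f (p + s *\<^sub>R a) - f (p + s *\<^sub>R b) + f p =
      s * s * (frechet_derivative (grad f) (at (p + \<tau> *\<^sub>R a + \<sigma> *\<^sub>R b)) b \<bullet> a)"
proof -
  let ?D = "\<lambda>q. frechet_derivative (grad f) (at q)"
  have line: "((\<lambda>\<tau>. f (q + \<tau> *\<^sub>R a)) has_real_derivative a \<bullet> grad f (q + \<tau> *\<^sub>R a)) (at \<tau>)"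
    if "q + \<tau> *\<^sub>R a \<in> S" for q \<tau>
  proof -
    have "((\<lambda>\<tau>. q + \<tau> *\<^sub>R a) has_derivative (\<lambda>h. h *\<^sub>R a)) (at \<tau>)"
      by (auto intro!: derivative_eq_intros)
    from has_derivative_compose[OF this GDERIV_grad[OF f that, unfolded gderiv_def]]
    show ?thesis by (simp add: has_field_derivative_def mult.commute[of _ "a \<bullet> _"])
  qed
  have "((\<lambda>\<tau>. f (p + s *\<^sub>R b + \<tau> *\<^sub>R a) - f (p + \<tau> *\<^sub>R a)) has_real_derivative
      a \<bullet> grad f (p + s *\<^sub>R b + \<tau> *\<^sub>R a) - a \<bullet> grad f (p + \<tau> *\<^sub>R a)) (at \<tau>)"
    if "0 \<le> \<tau>" "\<tau> \<le> s" for \<tau>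
    using sub[OF that, of s] sub[OF that, of 0] s
    by (intro DERIV_diff line) (auto simp: algebra_simps)
  from MVT2[OF s this] obtain \<tau> where \<tau>: "0 < \<tau>" "\<tau> < s"
    "(f (p + s *\<^sub>R b + s *\<^sub>R a) - f (p + s *\<^sub>R a)) - (f (p + s *\<^sub>R b + 0 *\<^sub>R a) - f (p + 0 *\<^sub>R a)) =
      (s - 0) * (a \<bullet> grad f (p + s *\<^sub>R b + \<tau> *\<^sub>R a) - a \<bullet> grad f (p + \<tau> *\<^sub>R a))" by auto
  have "((\<lambda>\<sigma>. a \<bullet> grad f (p + \<tau> *\<^sub>R a + \<sigma> *\<^sub>R b)) has_real_derivative
      a \<bullet> ?D (p + \<tau> *\<^sub>R a + \<sigma> *\<^sub>R b) b) (at \<sigma>)" if "0 \<le> \<sigma>" "\<sigma> \<le> s" for \<sigma>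
  proof -
    have S: "p + \<tau> *\<^sub>R a + \<sigma> *\<^sub>R b \<in> S" using sub \<tau> that by simp
    have "((\<lambda>\<sigma>. p + \<tau> *\<^sub>R a + \<sigma> *\<^sub>R b) has_derivative (\<lambda>h. h *\<^sub>R b)) (at \<sigma>)"
      by (auto intro!: derivative_eq_intros)
    moreover note d = smooth_on_has_derivative[OF smooth_on_grad[OF f] S]
    ultimately have "((\<lambda>\<sigma>. grad f (p + \<tau> *\<^sub>R a + \<sigma> *\<^sub>R b)) has_derivative
        (\<lambda>h. ?D (p + \<tau> *\<^sub>R a + \<sigma> *\<^sub>R b) (h *\<^sub>R b))) (at \<sigma>)"
      by (rule has_derivative_compose)
    from has_derivative_inner_right[OF this, of a]
    show ?thesis
      using linear_scale[OF has_derivative_linear[OF d]]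
      by (simp add: has_field_derivative_def mult.commute[of _ "a \<bullet> _"])
  qed
  from MVT2[OF s this] obtain \<sigma> where \<sigma>: "0 < \<sigma>" "\<sigma> < s"
    "a \<bullet> grad f (p + \<tau> *\<^sub>R a + s *\<^sub>R b) - a \<bullet> grad f (p + \<tau> *\<^sub>R a + 0 *\<^sub>R b) =
      (s - 0) * (a \<bullet> ?D (p + \<tau> *\<^sub>R a + \<sigma> *\<^sub>R b) b)" by auto
  have comm: "p + s *\<^sub>R b + \<tau> *\<^sub>R a = p + \<tau> *\<^sub>R a + s *\<^sub>R b" "p + s *\<^sub>R b + s *\<^sub>R a = p + s *\<^sub>R a + s *\<^sub>R b"
    by (simp_all add: algebra_simps)
  show ?thesis
  proof (rule that[OF \<tau>(1,2) \<sigma>(1,2)])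
    have "f (p + s *\<^sub>R a + s *\<^sub>R b) - f (p + s *\<^sub>R a) - f (p + s *\<^sub>R b) + f p =
        s * (a \<bullet> grad f (p + \<tau> *\<^sub>R a + s *\<^sub>R b) - a \<bullet> grad f (p + \<tau> *\<^sub>R a + 0 *\<^sub>R b))"
      using \<tau>(3) unfolding comm by simp
    also have "\<dots> = s * s * (?D (p + \<tau> *\<^sub>R a + \<sigma> *\<^sub>R b) b \<bullet> a)"
      unfolding \<sigma>(3) by (simp add: inner_commute)
    finally show "f (p + s *\<^sub>R a + s *\<^sub>R b) - f (p + s *\<^sub>R a) - f (p + s *\<^sub>R b) + f p =
        s * s * (?D (p + \<tau> *\<^sub>R a + \<sigma> *\<^sub>R b) b \<bullet> a)" .
  qed
qed

text \<open>The second difference is symmetric in \<open>a\<close> and \<open>b\<close>. Divided by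
  s^2 it is, in either order, a value of the corresponding mixed derivative at a point close to
  \<open>p\<close>; by continuity the two mixed derivatives cannot differ at
  \<open>p\<close>.\<close>

lemma symmetric_hessian:
  fixes f :: "'a::euclidean_space \<Rightarrow> real"
  assumes f: "smooth_on S f" and p: "p \<in> S"
  shows "frechet_derivative (grad f) (at p) a \<bullet> b = frechet_derivative (grad f) (at p) b \<bullet> a"
proof (rule ccontr)
  let ?h = "\<lambda>a b q. frechet_derivative (grad f) (at q) a \<bullet> b"
  assume ne: "?h a b p \<noteq> ?h b a p"
  define \<epsilon> where "\<epsilon> = dist (?h a b p) (?h b a p) / 2"
  have \<epsilon>: "0 < \<epsilon>" using ne by (simp add: \<epsilon>_def)
  have cont: "isCont (?h a b) p" for a b
  proof -
    have "continuous_on S (?h a b)"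
      by (intro continuous_intros smooth_on_continuous_on smooth_on_frechet_derivative smooth_on_grad f)
    then show ?thesis using p smooth_on_open[OF f] continuous_on_eq_continuous_at by blast
  qed
  obtain \<delta>1 where 1: "0 < \<delta>1" "\<And>q. dist q p < \<delta>1 \<Longrightarrow> dist (?h a b q) (?h a b p) < \<epsilon>"
    using cont[of a b] \<epsilon> unfolding continuous_at_eps_delta by metis
  obtain \<delta>2 where 2: "0 < \<delta>2" "\<And>q. dist q p < \<delta>2 \<Longrightarrow> dist (?h b a q) (?h b a p) < \<epsilon>"
    using cont[of b a] \<epsilon> unfolding continuous_at_eps_delta by metis
  obtain \<delta>3 where 3: "0 < \<delta>3" "ball p \<delta>3 \<subseteq> S"
    using p smooth_on_open[OF f] open_contains_ball by blast
  define \<delta> where "\<delta> = min \<delta>1 (min \<delta>2 \<delta>3)"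
  \<comment> \<open>The summand 1 keeps the denominator positive, and the division by 2 keeps the
    whole parallelogram strictly within distance \<delta> of \<open>p\<close>.\<close>
  define s where "s = \<delta> / (norm a + norm b + 1) / 2"
  have \<delta>: "0 < \<delta>" using 1 2 3 by (simp add: \<delta>_def)
  then have s: "0 < s" by (simp add: s_def add_nonneg_pos)
  have near: "dist (p + \<tau> *\<^sub>R a + \<sigma> *\<^sub>R b) p < \<delta>" if "0 \<le> \<tau>" "\<tau> \<le> s" "0 \<le> \<sigma>" "\<sigma> \<le> s" for \<tau> \<sigma>
  proof -
    have "dist (p + \<tau> *\<^sub>R a + \<sigma> *\<^sub>R b) p = norm (\<tau> *\<^sub>R a + \<sigma> *\<^sub>R b)" by (simp add: dist_norm add.assoc)
    also have "\<dots> \<le> \<tau> * norm a + \<sigma> * norm b" using that by (intro order_trans[OF norm_triangle_ineq]) simp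
    also have "\<dots> \<le> s * norm a + s * norm b" using that by (intro add_mono mult_right_mono) auto
    also have "\<dots> \<le> s * (norm a + norm b + 1)" using s by (simp add: algebra_simps)
    also have "\<dots> = \<delta> / 2"
    proof -
      have "norm a + norm b + 1 \<noteq> 0"
        using norm_ge_zero[of a] norm_ge_zero[of b] by linarith
      then show ?thesis unfolding s_def by (metis nonzero_eq_divide_eq times_divide_eq_left mult.commute)
    qed
    also have "\<dots> < \<delta>" using \<delta> by simp
    finally show ?thesis .
  qed
  have inS: "q \<in> S" if "dist q p < \<delta>" for q using that 3(2) by (auto simp: \<delta>_def dist_commute)
  have near': "dist (p + \<tau> *\<^sub>R b + \<sigma> *\<^sub>R a) p < \<delta>" if "0 \<le> \<tau>" "\<tau> \<le> s" "0 \<le> \<sigma>" "\<sigma> \<le> s" for \<tau> \<sigma>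
    using near[OF that(3,4,1,2)] by (simp add: add.assoc add.commute[of "\<tau> *\<^sub>R b"])
  obtain \<tau> \<sigma> where A: "0 < \<tau>" "\<tau> < s" "0 < \<sigma>" "\<sigma> < s"
    "f (p + s *\<^sub>R a + s *\<^sub>R b) - f (p + s *\<^sub>R a) - f (p + s *\<^sub>R b) + f p = s * s * ?h b a (p + \<tau> *\<^sub>R a + \<sigma> *\<^sub>R b)"
    by (rule second_difference[OF f s inS[OF near]])
  obtain \<tau>' \<sigma>' where B: "0 < \<tau>'" "\<tau>' < s" "0 < \<sigma>'" "\<sigma>' < s"
    "f (p + s *\<^sub>R b + s *\<^sub>R a) - f (p + s *\<^sub>R b) - f (p + s *\<^sub>R a) + f p = s * s * ?h a b (p + \<tau>' *\<^sub>R b + \<sigma>' *\<^sub>R a)"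
    by (rule second_difference[OF f s inS[OF near']])
  have comm: "p + s *\<^sub>R b + s *\<^sub>R a = p + s *\<^sub>R a + s *\<^sub>R b" by (simp add: algebra_simps)
  have "s * s * ?h b a (p + \<tau> *\<^sub>R a + \<sigma> *\<^sub>R b) = s * s * ?h a b (p + \<tau>' *\<^sub>R b + \<sigma>' *\<^sub>R a)"
    using A(5) B(5) unfolding comm by linarith
  then have eq: "?h b a (p + \<tau> *\<^sub>R a + \<sigma> *\<^sub>R b) = ?h a b (p + \<tau>' *\<^sub>R b + \<sigma>' *\<^sub>R a)" using s by simp
  have "dist (?h b a (p + \<tau> *\<^sub>R a + \<sigma> *\<^sub>R b)) (?h b a p) < \<epsilon>"
    using near[of \<tau> \<sigma>] A by (intro 2(2)) (auto simp: \<delta>_def)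
  moreover have "dist (?h a b (p + \<tau>' *\<^sub>R b + \<sigma>' *\<^sub>R a)) (?h a b p) < \<epsilon>"
    using near'[of \<tau>' \<sigma>'] B by (intro 1(2)) (auto simp: \<delta>_def)
  ultimately have "dist (?h b a p) (?h a b p) < dist (?h a b p) (?h b a p)"
    unfolding eq \<epsilon>_def by (rule dist_triangle_half_r)
  then show False by (simp add: dist_commute)
qed

lemma smooth_on_from_coords:
  assumes "smooth_on S q" "smooth_on S p"
  shows "smooth_on S (\<lambda>x. from_coords (q x) (p x))"
  unfolding from_coords_def
  by (intro smooth_on_vec smooth_on_mult smooth_on_bounded_linear[OF bounded_linear_of_real]
      smooth_on_compose[OF smooth_on_exp] smooth_on_compose[OF smooth_on_cis]
      smooth_on_const smooth_on_vec_nth assms smooth_on_open[OF assms(1)]) auto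

text \<open>Each component of the derivative is the component of the point times a complex number.
  This form exhibits dz/z = dq + 2 pi i dp, so \<open>dq\<close> and \<open>dp\<close> of a tangent
  vector can be read off as real and imaginary parts.\<close>

lemma from_coords_has_derivative:
  assumes "(q has_derivative q') (at x)" "(p has_derivative p') (at x)"
  shows "((\<lambda>x. from_coords (q x) (p x)) has_derivative
    (\<lambda>h. \<chi> j. from_coords (q x) (p x) $ j * Complex (q' h $ j) (2 * pi * p' h $ j))) (at x)"
proof -
  have comp: "((\<lambda>x. from_coords (q x) (p x) $ j) has_derivative
      (\<lambda>h. from_coords (q x) (p x) $ j * Complex (q' h $ j) (2 * pi * p' h $ j))) (at x)" for j
  proof -
    have q: "((\<lambda>x. q x $ j) has_derivative (\<lambda>h. q' h $ j)) (at x)"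
      and p: "((\<lambda>x. p x $ j) has_derivative (\<lambda>h. p' h $ j)) (at x)"
      using bounded_linear.has_derivative[OF bounded_linear_vec_nth] assms by blast+
    have e: "((\<lambda>x. exp (q x $ j)) has_derivative (\<lambda>h. q' h $ j * exp (q x $ j))) (at x)"
      using has_derivative_exp[OF q] by (simp add: mult.commute)
    have "((\<lambda>x. complex_of_real (exp (q x $ j)) * cis (2 * pi * p x $ j)) has_derivative
        (\<lambda>h. complex_of_real (exp (q x $ j)) * ((2 * pi * p' h $ j) *\<^sub>R (\<i> * cis (2 * pi * p x $ j))) +
          complex_of_real (q' h $ j * exp (q x $ j)) * cis (2 * pi * p x $ j))) (at x)"
      by (rule has_derivative_mult[OF has_derivative_of_real[OF e]
          has_derivative_cis[OF has_derivative_mult_right[OF p]]])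
    also have "(\<lambda>h. complex_of_real (exp (q x $ j)) * ((2 * pi * p' h $ j) *\<^sub>R (\<i> * cis (2 * pi * p x $ j))) +
          complex_of_real (q' h $ j * exp (q x $ j)) * cis (2 * pi * p x $ j)) =
        (\<lambda>h. from_coords (q x) (p x) $ j * Complex (q' h $ j) (2 * pi * p' h $ j))"
      by (simp add: from_coords_def Complex_eq scaleR_conv_of_real algebra_simps)
    finally show ?thesis by (simp add: from_coords_def)
  qed
  have "((\<lambda>x. \<Sum>j\<in>UNIV. axis j (from_coords (q x) (p x) $ j)) has_derivative
      (\<lambda>h. \<Sum>j\<in>UNIV. axis j (from_coords (q x) (p x) $ j * Complex (q' h $ j) (2 * pi * p' h $ j)))) (at x)"
    by (intro has_derivative_sum bounded_linear.has_derivative[OF bounded_linear_axis] comp)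
  then show ?thesis by (simp add: vec_lambda_eq_sum_axis[symmetric])
qed

text \<open>In the coordinates the tangent vector belonging to \<open>h\<close> is (Hess F h, h).
  Its second component recovers \<open>h\<close>, which gives injectivity, and \<open>symp\<close>
  becomes the antisymmetric part of the Hessian.\<close>

lemma Lagrangian_immersion_grad:
  fixes F :: "real ^ 'n \<Rightarrow> real"
  assumes F: "smooth_on A F"
  shows "Lagrangian_immersion A (\<lambda>p. from_coords (grad F p) p)"
  unfolding Lagrangian_immersion_def
proof (intro conjI ballI allI)
  let ?\<Phi> = "\<lambda>p. from_coords (grad F p) p"
  show "smooth_on A ?\<Phi>"
    by (intro smooth_on_from_coords smooth_on_grad F smooth_on_id smooth_on_open[OF F])
  have nz: "from_coords q p $ j \<noteq> 0" for q p :: "real ^ 'n" and j by (simp add: from_coords_def)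
  then show "?\<Phi> ` A \<subseteq> Cstar" by (auto simp: Cstar_def)
  fix x assume x: "x \<in> A"
  let ?D = "frechet_derivative (grad F) (at x)"
  have D: "frechet_derivative ?\<Phi> (at x) =
      (\<lambda>h. \<chi> j. ?\<Phi> x $ j * Complex (?D h $ j) (2 * pi * h $ j))"
    by (rule frechet_derivative_at[symmetric], rule from_coords_has_derivative
        [OF smooth_on_has_derivative[OF smooth_on_grad[OF F] x] has_derivative_ident])
  have dq: "dq (?\<Phi> x) (frechet_derivative ?\<Phi> (at x) h) = ?D h"
    and dp: "dp (?\<Phi> x) (frechet_derivative ?\<Phi> (at x) h) = h" for h
    using nz by (simp_all add: D dq_def dp_def vec_eq_iff)
  show "inj (frechet_derivative ?\<Phi> (at x))"
  proof (rule injI)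
    fix a b assume eq: "frechet_derivative ?\<Phi> (at x) a = frechet_derivative ?\<Phi> (at x) b"
    have "dp (?\<Phi> x) (frechet_derivative ?\<Phi> (at x) a) = dp (?\<Phi> x) (frechet_derivative ?\<Phi> (at x) b)"
      by (simp only: eq)
    then show "a = b" by (simp only: dp)
  qed
  show "symp (?\<Phi> x) (frechet_derivative ?\<Phi> (at x) a) (frechet_derivative ?\<Phi> (at x) b) = 0" for a b
    unfolding symp_def dq dp using symmetric_hessian[OF F x, of a b] by simp
qed

lemma loc_lipschitz_on_compact:
  assumes "loc_lipschitz_on UNIV f" "compact K"
  obtains C where "C-lipschitz_on K f"
proof -
  \<comment> \<open>A one-point time interval turns the time-dependent notion into the autonomous
    one.\<close>
  have "local_lipschitz {0::real} K (\<lambda>_. f)"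
    unfolding local_lipschitz_def
  proof (intro ballI)
    fix x :: 'a and t :: real
    obtain r C where "0 < r" "\<And>s. s \<le> r \<Longrightarrow> C-lipschitz_on (ball x s) f"
      by (rule loc_lipschitz_onE[OF assms(1), of x]) auto
    then have "C-lipschitz_on (cball x (r / 2) \<inter> K) f"
      by (rule_tac lipschitz_on_subset[of C "ball x r"]) auto
    then show "\<exists>u>0. \<exists>L. \<forall>t\<in>cball t u \<inter> {0}. L-lipschitz_on (cball x u \<inter> K) f"
      using \<open>0 < r\<close> by (intro exI[of _ "r / 2"]) auto
  qed
  from local_lipschitz_compact_implies_lipschitz[OF this assms(2)] show ?thesis
    using that by (metis compact_sing continuous_on_sing insertI1)
qed

text \<open>\<open>from_coords\<close> grows exponentially in the first argument, so it is Lipschitz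
  only on bounded sets; \<open>N\<close> bounds the gradients that occur over the ball.\<close>

lemma lipschitz_on_from_coords:
  fixes G :: "real ^ 'n \<Rightarrow> real ^ 'n"
  assumes G: "loc_lipschitz_on UNIV G"
  obtains C where "C-lipschitz_on (ball 0 M) (\<lambda>p. from_coords (G p) p)"
proof -
  obtain C where C: "C-lipschitz_on (cball 0 M) G"
    using loc_lipschitz_on_compact[OF G compact_cball] by blast
  have "bounded (G ` cball 0 M)"
    by (intro compact_imp_bounded compact_continuous_image compact_cball
        continuous_on_subset[OF loc_lipschitz_on_continuous_on[OF G]]) auto
  then obtain N where N: "\<And>p. p \<in> cball 0 M \<Longrightarrow> norm (G p) \<le> N"
    unfolding bounded_iff by blast
  let ?K = "cball (0 :: real ^ 'n) N \<times> cball (0 :: real ^ 'n) M"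
  have s: "smooth_on UNIV (\<lambda>x :: (real ^ 'n) \<times> (real ^ 'n). from_coords (fst x) (snd x))"
    by (intro smooth_on_from_coords smooth_on_bounded_linear[OF bounded_linear_fst]
        smooth_on_bounded_linear[OF bounded_linear_snd] smooth_on_id open_UNIV)
  obtain C' where C': "0 \<le> C'" "\<And>p v. p \<in> ?K \<Longrightarrow> norm (frechet_derivative
      (\<lambda>x :: (real ^ 'n) \<times> (real ^ 'n). from_coords (fst x) (snd x)) (at p) v) \<le> C' * norm v"
    by (rule smooth_on_derivative_bound[OF s, of ?K]) (auto intro: compact_Times)
  have 1: "C'-lipschitz_on ?K (\<lambda>x. from_coords (fst x) (snd x))"
    by (rule lipschitz_on_convex_derivative[OF _ smooth_on_has_derivative[OF s]])
      (use C' in \<open>auto intro: convex_Times\<close>)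
  have 2: "(sqrt (C\<^sup>2 + 1\<^sup>2))-lipschitz_on (ball 0 M) (\<lambda>p. (G p, p))"
    by (intro lipschitz_on_Pair lipschitz_on_subset[OF C] lipschitz_on_id) auto
  have "(\<lambda>p. (G p, p)) ` ball 0 M \<subseteq> ?K" using N by (auto simp: subset_iff)
  then have "C'-lipschitz_on ((\<lambda>p. (G p, p)) ` ball 0 M) (\<lambda>x. from_coords (fst x) (snd x))"
    by (rule lipschitz_on_subset[OF 1])
  from lipschitz_on_compose2[OF 2 this] show ?thesis using that by simp
qed

section \<open>Loops bounding a disk in the universal cover\<close>

lemma cis_2pi_eq_iff: "cis (2 * pi * x) = cis (2 * pi * y) \<longleftrightarrow> x - y \<in> \<int>"
proof
  assume "cis (2 * pi * x) = cis (2 * pi * y)"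
  then have "cis (2 * pi * x - 2 * pi * y) = 1" by (simp add: cis_divide[symmetric])
  then have "cos (2 * pi * x - 2 * pi * y) = 1" by (simp add: complex_eq_iff)
  then obtain n :: int where "2 * pi * x - 2 * pi * y = n * 2 * pi" using cos_one_2pi_int by auto
  then have "2 * pi * (x - y) = 2 * pi * n" by (simp add: algebra_simps)
  then show "x - y \<in> \<int>" by simp
next
  assume "x - y \<in> \<int>"
  from cis_multiple_2pi[OF this] have "cis (2 * pi * y) * cis (2 * pi * (x - y)) = cis (2 * pi * y)"
    by simp
  then show "cis (2 * pi * x) = cis (2 * pi * y)" by (simp add: cis_mult algebra_simps)
qed

lemma torus_eq_iff: "torus p = torus p' \<longleftrightarrow> (\<forall>j. (p - p') $ j \<in> \<int>)"
  by (simp add: torus_def vec_eq_iff cis_2pi_eq_iff)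

lemma torus_add_eq_iff: "torus (p + n) = torus p \<longleftrightarrow> (\<forall>j. n $ j \<in> \<int>)"
  by (simp add: torus_eq_iff)

text \<open>The difference of the two lifts is continuous with integer coordinates, hence constant
  on a connected set.\<close>

lemma torus_eq_imp_translate:
  fixes f g :: "real \<Rightarrow> real ^ 'n"
  assumes "continuous_on S f" "continuous_on S g" "connected S"
    and "\<And>t. t \<in> S \<Longrightarrow> torus (f t) = torus (g t)"
  obtains n where "\<And>t. t \<in> S \<Longrightarrow> f t = g t + n"
proof -
  have "\<exists>m. \<forall>t\<in>S. (f t - g t) $ j = m" for j
  proof -
    have "(\<lambda>t. (f t - g t) $ j) constant_on S"
    proof (rule continuous_discrete_range_constant[OF assms(3)])
      show "continuous_on S (\<lambda>t. (f t - g t) $ j)" by (intro continuous_intros assms)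
      fix t assume t: "t \<in> S"
      show "\<exists>e>0. \<forall>y. y \<in> S \<and> (f y - g y) $ j \<noteq> (f t - g t) $ j \<longrightarrow>
          e \<le> norm ((f y - g y) $ j - (f t - g t) $ j)"
      proof (intro exI[of _ 1] conjI allI impI)
        fix y assume y: "y \<in> S \<and> (f y - g y) $ j \<noteq> (f t - g t) $ j"
        have "(f y - g y) $ j - (f t - g t) $ j \<in> \<int>"
          using assms(4) t y unfolding torus_eq_iff by (intro Ints_diff) auto
        then show "1 \<le> norm ((f y - g y) $ j - (f t - g t) $ j)"
          using y Ints_nonzero_abs_ge1[of "(f y - g y) $ j - (f t - g t) $ j"] by simp
      qed simp
    qed
    then show ?thesis by (auto simp: constant_on_def)
  qed
  then obtain m where m: "\<And>j t. t \<in> S \<Longrightarrow> (f t - g t) $ j = m j" by metis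
  have "f t = g t + (\<chi> j. m j)" if "t \<in> S" for t
    using m[OF that] by (simp add: vec_eq_iff algebra_simps)
  then show ?thesis by (rule that)
qed

text \<open>If two points of the open disk were congruent, then the translation taking one to the other
  would map the disk into itself, since it preserves the complement of the graph; but the disk is
  bounded.\<close>

lemma torus_inj_on_disk:
  fixes h :: "complex \<Rightarrow> real ^ 2"
  assumes h: "continuous_on (cball 0 1) h" "inj_on h (cball 0 1)"
    and disj: "torus ` h ` ball 0 1 \<inter> torus ` h ` sphere 0 1 = {}"
    and xy: "x \<in> h ` ball 0 1" "y \<in> h ` cball 0 1" "torus x = torus y"
  shows "x = y"
proof -
  let ?S = "h ` ball 0 1"
  define n where "n = x - y"
  have n: "torus (p + n) = torus p" for p
    using xy(3) unfolding torus_add_eq_iff torus_eq_iff n_def by simp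
  have cb: "h ` cball 0 1 = ?S \<union> h ` sphere 0 1"
  proof -
    have "cball (0::complex) 1 = ball 0 1 \<union> sphere 0 1" by auto
    then show ?thesis by (simp add: image_Un)
  qed
  have S: "open ?S"
    by (rule invariance_of_domain_gen)
      (auto intro: continuous_on_subset[OF h(1)] inj_on_subset[OF h(2)])
  have conn: "connected ((\<lambda>p. p + n) ` ?S)"
    by (intro connected_continuous_image continuous_intros continuous_on_subset[OF h(1)]) auto
  have closed: "closed (h ` cball 0 1)"
    by (intro compact_imp_closed compact_continuous_image h(1)) simp
  have "y \<in> ?S" using xy cb disj by force
  then have meet: "x \<in> (\<lambda>p. p + n) ` ?S \<inter> ?S" using xy(1) by (auto simp: n_def image_iff)
  have avoid: "p + n \<notin> h ` sphere 0 1" if "p \<in> ?S" for p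
  proof
    assume "p + n \<in> h ` sphere 0 1"
    then have "torus p \<in> torus ` h ` sphere 0 1" using n[of p] by (metis imageI)
    then show False using that disj by blast
  qed
  have "(\<lambda>p. p + n) ` ?S \<subseteq> ?S"
  proof (rule ccontr)
    \<comment> \<open>Otherwise the connected translate would meet both the open disk and its
      exterior, two disjoint open sets that cover the translate because it avoids the boundary
      curve.\<close>
    assume "\<not> (\<lambda>p. p + n) ` ?S \<subseteq> ?S"
    then obtain p where "p \<in> ?S" "p + n \<notin> ?S" by blast
    then have 1: "- (h ` cball 0 1) \<inter> (\<lambda>p. p + n) ` ?S \<noteq> {}"
      using avoid[of p] unfolding cb by blast
    have 2: "(\<lambda>p. p + n) ` ?S \<subseteq> ?S \<union> - (h ` cball 0 1)"
    proof (rule image_subsetI)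
      fix p assume "p \<in> ?S"
      from avoid[OF this] show "p + n \<in> ?S \<union> - (h ` cball 0 1)"
        unfolding cb Un_iff Compl_iff by satx
    qed
    have 3: "?S \<inter> - (h ` cball 0 1) \<inter> (\<lambda>p. p + n) ` ?S = {}"
    proof -
      have "A \<inter> - (A \<union> B) \<inter> C = {}" for A B C :: "(real ^ 2) set" by blast
      then show ?thesis unfolding cb .
    qed
    have 4: "open (- (h ` cball 0 1))" using closed unfolding closed_def .
    have "?S \<inter> (\<lambda>p. p + n) ` ?S = {}" using connectedD[OF conn S 4 3 2] 1 by satx
    then show False using meet by (metis Int_commute empty_iff)
  qed
  then have step: "p + n \<in> ?S" if "p \<in> ?S" for p using that by blast
  have iter: "x + real k *\<^sub>R n \<in> ?S" for k
  proof (induction k)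
    case (Suc k)
    then show ?case using step[OF Suc] by (simp add: algebra_simps)
  qed (use xy in simp)
  have "bounded (h ` cball 0 1)"
    by (intro compact_imp_bounded compact_continuous_image h(1)) simp
  then obtain B where B: "\<And>p. p \<in> ?S \<Longrightarrow> norm p \<le> B" unfolding bounded_iff cb by blast
  have "n = 0"
  proof (rule ccontr)
    assume "n \<noteq> 0"
    then obtain k :: nat where k: "(B + norm x) / norm n < real k" using reals_Archimedean2 by blast
    have "real k * norm n = norm ((x + real k *\<^sub>R n) - x)" by simp
    also have "\<dots> \<le> B + norm x" using norm_triangle_ineq4[of "x + real k *\<^sub>R n" x] B[OF iter[of k]] by linarith
    finally show False using k \<open>n \<noteq> 0\<close> by (simp add: field_simps)
  qed
  then show ?thesis by (simp add: n_def)
qed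

lemma arg_torus_from_coords: "arg_torus (from_coords q p) = torus p"
  by (simp add: arg_torus_def from_coords_def torus_def vec_eq_iff sgn_mult sgn_of_real)

text \<open>\<open>F\<close> is defined on the whole plane, so the graph of its gradient continues
  past the boundary of the face; a ball around the compact face provides one Lipschitz constant.
  Points of the disk that coincide have the same argument \<open>torus p\<close>, which reduces
  embeddedness to \<open>torus_inj_on_disk\<close>.\<close>

lemma Lagrangian_disk_of_loop:
  fixes h :: "complex \<Rightarrow> real ^ 2" and Q :: "real \<Rightarrow> real ^ 2"
  defines "\<Gamma> \<equiv> \<lambda>t. h (cis (2 * pi * t))"
  assumes h: "continuous_on (cball 0 1) h" "inj_on h (cball 0 1)"
    and disj: "torus ` h ` ball 0 1 \<inter> torus ` h ` sphere 0 1 = {}"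
    and per: "\<And>t n. n \<in> \<int> \<Longrightarrow> Q (t + n) = Q t \<and> U (t + n) = U t"
    and arcs: "\<And>t. \<exists>u v. smooth_arc (\<lambda>s. \<Gamma> (t + s)) (\<lambda>s. Q (t + s)) (\<lambda>s. U (t + s)) u \<and>
      smooth_arc (\<lambda>s. \<Gamma> (t - s)) (\<lambda>s. Q (t - s)) (\<lambda>s. U (t - s)) v \<and>
      u \<noteq> 0 \<and> v \<noteq> 0 \<and> sgn u \<noteq> sgn v"
    and \<gamma>: "\<And>t. t \<in> {0..1} \<Longrightarrow> \<gamma> t = from_coords (Q t) (\<Gamma> t)"
  shows "\<exists>D. Lagrangian_disk D \<gamma>"
proof -
  have cont: "continuous_on UNIV \<Gamma>" unfolding \<Gamma>_def
    by (rule continuous_on_compose2[OF h(1)]) (auto intro!: continuous_intros)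
  have inj: "t - t' \<in> \<int>" if "\<Gamma> t = \<Gamma> t'" for t t'
    using inj_onD[OF h(2) that[unfolded \<Gamma>_def]] cis_2pi_eq_iff by simp
  have per': "\<Gamma> (t + n) = \<Gamma> t \<and> Q (t + n) = Q t \<and> U (t + n) = U t" if "n \<in> \<int>" for t n
    using per[OF that] cis_2pi_eq_iff[of "t + n" t] that by (simp add: \<Gamma>_def)
  obtain Z F G where Z: "finite Z" "Z \<subseteq> range \<Gamma>" and C: "C11_on UNIV Z F G"
    and jet: "\<And>t. F (\<Gamma> t) = U t \<and> G (\<Gamma> t) = Q t"
    by (rule loop_extension[OF cont inj per' arcs]) (assumption | (rule that; assumption))+
  have G: "G = grad F" using C unfolding C11_on_def by (intro ext grad_eqI[symmetric]) simp
  let ?K = "h ` cball 0 1" and ?\<Phi> = "\<lambda>p. from_coords (G p) p"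
  obtain h' where hom: "homeomorphism (cball 0 1) ?K h h'"
    using homeomorphism_compact[OF compact_cball h(1) refl h(2)] by blast
  have "bounded ?K" by (intro compact_imp_bounded compact_continuous_image h(1)) simp
  then obtain M where M: "?K \<subseteq> ball 0 M" using bounded_subset_ballD by blast
  obtain B where B: "B-lipschitz_on (ball 0 M) ?\<Phi>"
    using lipschitz_on_from_coords C unfolding C11_on_def by metis
  have im: "Lagrangian_immersion (ball 0 M - Z) ?\<Phi>"
    unfolding G
  proof (rule Lagrangian_immersion_grad, rule smooth_on_subset)
    show "smooth_on (UNIV - Z) F" using C by (simp add: C11_on_def)
  qed (use Z(1) in \<open>auto intro: open_Diff finite_imp_closed\<close>)
  have "range \<Gamma> \<subseteq> h ` sphere 0 1" by (auto simp: \<Gamma>_def)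
  then have Z': "Z \<subseteq> h ` sphere 0 1" using Z(2) by blast
  have emb: "\<forall>x\<in>h ` ball 0 1. \<forall>y\<in>?K. ?\<Phi> x = ?\<Phi> y \<longrightarrow> x = y"
  proof (intro ballI impI)
    fix x y assume *: "x \<in> h ` ball 0 1" "y \<in> ?K" "?\<Phi> x = ?\<Phi> y"
    then have "torus x = torus y" by (metis arg_torus_from_coords)
    then show "x = y" using torus_inj_on_disk[OF h disj] * by blast
  qed
  have bd: "\<forall>t\<in>{0..1}. ?\<Phi> (h (cis (2 * pi * t))) = \<gamma> t"
    using \<gamma> jet unfolding \<Gamma>_def by simp
  have "Lagrangian_disk (?\<Phi> ` ?K) \<gamma>"
    unfolding Lagrangian_disk_def
    using hom M Z(1) Z' B im emb bd open_ball by blast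
  then show ?thesis by blast
qed

section \<open>Lifts of smooth arcs\<close>

text \<open>The smooth extension of a piece of a lift may acquire zero entries beyond the ends of
  the piece; the coordinates are used on this open set only.\<close>

lemma open_nonzero_nbhd:
  fixes g :: "real \<Rightarrow> complex ^ 'n"
  assumes "continuous_on UNIV g"
  shows "open {s. \<forall>j. g s $ j \<noteq> 0}"
proof -
  have "{s. \<forall>j. g s $ j \<noteq> 0} = (\<Inter>j. {s. g s $ j \<noteq> 0})" by auto
  moreover have "open {s. g s $ j \<noteq> 0}" for j
    by (intro open_Collect_neq continuous_intros assms)
  ultimately show ?thesis by (simp add: open_INT)
qed

lemma smooth_on_val:
  assumes "smooth_on S g" "\<And>s j. s \<in> S \<Longrightarrow> g s $ j \<noteq> 0"
  shows "smooth_on S (\<lambda>s. val (g s))"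
  unfolding val_def
  by (intro smooth_on_vec smooth_on_open[OF assms(1)] smooth_on_compose[OF smooth_on_ln]
      smooth_on_compose[OF smooth_on_norm] smooth_on_vec_nth assms(1)) (use assms(2) in auto)

lemma from_coords_val:
  assumes "\<And>j. z $ j \<noteq> 0" "arg_torus z = torus p"
  shows "from_coords (val z) p = z"
proof -
  have "sgn (z $ j) = cis (2 * pi * p $ j)" for j
    using assms(2) by (simp add: arg_torus_def torus_def vec_eq_iff)
  then have "complex_of_real (exp (ln (cmod (z $ j)))) * cis (2 * pi * p $ j) = z $ j" for j
    using assms(1)[of j] by (simp flip: \<open>\<And>j. sgn (z $ j) = cis (2 * pi * p $ j)\<close> add: sgn_div_norm scaleR_conv_of_real)
  then show ?thesis by (simp add: from_coords_def val_def vec_eq_iff)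
qed

text \<open>Identifies the Liouville density along a lift with
  \<open>\<kappa> \<bullet> \<alpha>'\<close>, the expression in the compatibility condition of
  \<open>smooth_arc\<close>.\<close>

lemma dp_from_coords:
  fixes \<kappa> \<alpha> :: "real \<Rightarrow> real ^ 'n"
  assumes "(\<kappa> has_vector_derivative \<kappa>') (at s)" "(\<alpha> has_vector_derivative \<alpha>') (at s)"
    and "open T" "s \<in> T" "\<And>s. s \<in> T \<Longrightarrow> \<gamma> s = from_coords (\<kappa> s) (\<alpha> s)"
  shows "\<gamma> differentiable at s" "dp (\<gamma> s) (vector_derivative \<gamma> (at s)) = \<alpha>'"
proof -
  have "((\<lambda>s. from_coords (\<kappa> s) (\<alpha> s)) has_derivative (\<lambda>h. \<chi> j. from_coords (\<kappa> s) (\<alpha> s) $ j *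
      Complex ((h *\<^sub>R \<kappa>') $ j) (2 * pi * (h *\<^sub>R \<alpha>') $ j))) (at s)"
    by (rule from_coords_has_derivative) (use assms(1,2) in \<open>auto simp: has_vector_derivative_def\<close>)
  then have "(\<gamma> has_derivative (\<lambda>h. \<chi> j. from_coords (\<kappa> s) (\<alpha> s) $ j *
      Complex ((h *\<^sub>R \<kappa>') $ j) (2 * pi * (h *\<^sub>R \<alpha>') $ j))) (at s)"
    by (rule has_derivative_transform_within_open[OF _ assms(3,4)]) (use assms(5) in auto)
  also have "(\<lambda>h. \<chi> j. from_coords (\<kappa> s) (\<alpha> s) $ j * Complex ((h *\<^sub>R \<kappa>') $ j) (2 * pi * (h *\<^sub>R \<alpha>') $ j)) =
      (\<lambda>h. h *\<^sub>R (\<chi> j. from_coords (\<kappa> s) (\<alpha> s) $ j * Complex (\<kappa>' $ j) (2 * pi * \<alpha>' $ j)))"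
    by (simp add: fun_eq_iff vec_eq_iff complex_eq_iff algebra_simps)
  finally have v: "(\<gamma> has_vector_derivative (\<chi> j. from_coords (\<kappa> s) (\<alpha> s) $ j * Complex (\<kappa>' $ j) (2 * pi * \<alpha>' $ j))) (at s)"
    by (simp add: has_vector_derivative_def)
  then show "\<gamma> differentiable at s" by (rule differentiableI_vector)
  have nz: "from_coords (\<kappa> s) (\<alpha> s) $ j \<noteq> 0" for j by (simp add: from_coords_def)
  show "dp (\<gamma> s) (vector_derivative \<gamma> (at s)) = \<alpha>'"
    using nz by (simp add: vector_derivative_at[OF v] assms(5)[OF assms(4)] dp_def vec_eq_iff)
qed

lemma smooth_primitive:
  assumes "smooth_on (ball 0 \<delta>) k" "0 < \<delta>"
  obtains \<omega> where "smooth_on (ball 0 (\<delta> / 2)) \<omega>" "\<omega> (0::real) = (c::real)"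
    "\<And>s. s \<in> ball 0 (\<delta> / 2) \<Longrightarrow> (\<omega> has_real_derivative k s) (at s)"
proof -
  \<comment> \<open>The lower limit lies to the left of 0, which makes the integral differentiable
    at 0 from both sides.\<close>
  define I where "I s = integral {- (\<delta> / 2)..s} k" for s
  have der: "(I has_real_derivative k s) (at s)" if "s \<in> ball 0 (\<delta> / 2)" for s
  proof -
    have "continuous_on {- (\<delta> / 2)..\<delta> / 2} k"
      by (rule continuous_on_subset[OF smooth_on_continuous_on[OF assms(1)]])
        (use assms(2) in \<open>auto simp: dist_real_def\<close>)
    moreover have s: "- (\<delta> / 2) < s" "s < \<delta> / 2" using that by (auto simp: dist_real_def)
    ultimately have "(I has_real_derivative k s) (at s within {- (\<delta> / 2)..\<delta> / 2})"
      unfolding I_def by (intro integral_has_real_derivative) auto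
    then show ?thesis using s by (simp add: at_within_Icc_at)
  qed
  show ?thesis
  proof (rule that[of "\<lambda>s. I s - I 0 + c"])
    show d: "((\<lambda>s. I s - I 0 + c) has_real_derivative k s) (at s)" if "s \<in> ball 0 (\<delta> / 2)" for s
      using der[OF that] by (auto intro!: derivative_eq_intros)
    show "smooth_on (ball 0 (\<delta> / 2)) (\<lambda>s. I s - I 0 + c)"
      by (rule smooth_on_vector_derivI[OF open_ball d[unfolded has_real_derivative_iff_has_vector_derivative]])
        (auto intro: smooth_on_subset[OF assms(1)])
  qed simp
qed

text \<open>\<open>U\<close> is given on one side of the end point only. Integrating the density of
  the smooth extension \<open>g\<close> yields a two-sided smooth \<omega>; it agrees with
  \<open>U\<close> because both have the same value at 0 and the same derivative at positive
  times.\<close>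

lemma smooth_arc_lift:
  fixes \<alpha> :: "real \<Rightarrow> real ^ 'n"
  assumes b: "0 < b" and g: "smooth_on UNIV g" and \<alpha>: "smooth_on UNIV \<alpha>"
    and eq: "\<And>s. 0 \<le> s \<Longrightarrow> s \<le> b \<Longrightarrow> \<gamma> s = g s \<and> \<Gamma> s = \<alpha> s \<and>
      arg_torus (\<gamma> s) = torus (\<Gamma> s) \<and> (\<forall>j. \<gamma> s $ j \<noteq> 0)"
    and U: "continuous_on {0..b} U"
      "\<And>s. 0 < s \<Longrightarrow> s < b \<Longrightarrow>
        (U has_real_derivative val (\<gamma> s) \<bullet> dp (\<gamma> s) (vector_derivative \<gamma> (at s))) (at s)"
  shows "smooth_arc \<Gamma> (\<lambda>s. val (\<gamma> s)) U (vector_derivative \<alpha> (at 0))"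
proof -
  have "open ({s. \<forall>j. g s $ j \<noteq> 0} \<inter> {..<b})"
    by (intro open_Int open_nonzero_nbhd smooth_on_continuous_on[OF g] open_lessThan)
  moreover have "0 \<in> {s. \<forall>j. g s $ j \<noteq> 0} \<inter> {..<b}"
  proof -
    have "\<gamma> 0 = g 0" "\<forall>j. \<gamma> 0 $ j \<noteq> 0" using eq[of 0] b by auto
    then show ?thesis using b by simp
  qed
  ultimately obtain \<delta> where \<delta>: "0 < \<delta>" "ball 0 \<delta> \<subseteq> {s. \<forall>j. g s $ j \<noteq> 0} \<inter> {..<b}"
    using open_contains_ball by metis
  define \<kappa> where "\<kappa> s = val (g s)" for s
  have \<kappa>: "smooth_on (ball 0 \<delta>) \<kappa>" unfolding \<kappa>_def
    by (rule smooth_on_val[OF smooth_on_subset[OF g]]) (use \<delta> in auto)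
  have \<alpha>': "smooth_on (ball 0 \<delta>) \<alpha>" by (rule smooth_on_subset[OF \<alpha>]) auto
  let ?k = "\<lambda>s. \<kappa> s \<bullet> vector_derivative \<alpha> (at s)"
  have "smooth_on (ball 0 \<delta>) ?k"
    by (intro smooth_on_inner \<kappa> smooth_on_vector_derivative \<alpha>')
  from smooth_primitive[OF this \<delta>(1), of "U 0"] obtain \<omega> where
    \<omega>: "smooth_on (ball 0 (\<delta> / 2)) \<omega>" "\<omega> 0 = U 0"
      "\<And>s. s \<in> ball 0 (\<delta> / 2) \<Longrightarrow> (\<omega> has_real_derivative ?k s) (at s)" by metis
  have lt: "s < b" if "0 \<le> s" "s < \<delta>" for s
  proof -
    have "s \<in> ball 0 \<delta>" using that by simp
    then show ?thesis using \<delta>(2) by blast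
  qed
  have U\<omega>: "U s = \<omega> s" if s: "0 \<le> s" "s < \<delta> / 2" for s
  proof (cases "s = 0")
    case False
    have "U s - \<omega> s = U 0 - \<omega> 0"
    proof (rule DERIV_isconst_end[where f = "\<lambda>s. U s - \<omega> s"])
      show "0 < s" using s False by simp
      show "continuous_on {0..s} (\<lambda>s. U s - \<omega> s)"
        by (intro continuous_on_diff continuous_on_subset[OF U(1)]
            continuous_on_subset[OF smooth_on_continuous_on[OF \<omega>(1)]])
          (use lt[of s] s \<delta>(1) in auto)
      fix x assume x: "0 < x" "x < s"
      have xb: "x < b" using lt[of x] x s \<delta>(1) by simp
      have \<gamma>: "\<gamma> t = from_coords (\<kappa> t) (\<alpha> t)" if "t \<in> {0<..<b}" for t
      proof -
        have e: "\<gamma> t = g t" "\<Gamma> t = \<alpha> t" "arg_torus (\<gamma> t) = torus (\<Gamma> t)" "\<forall>j. \<gamma> t $ j \<noteq> 0"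
          using eq[of t] that by auto
        have "from_coords (val (\<gamma> t)) (\<Gamma> t) = \<gamma> t" by (rule from_coords_val[OF spec[OF e(4)] e(3)])
        then show ?thesis by (simp add: \<kappa>_def e(1,2))
      qed
      have "dp (\<gamma> x) (vector_derivative \<gamma> (at x)) = vector_derivative \<alpha> (at x)"
        by (rule dp_from_coords(2)[OF smooth_on_has_vector_derivative[OF \<kappa>]
              smooth_on_has_vector_derivative[OF \<alpha>] _ _ \<gamma>, of _ "{0<..<b}"]) (use x s \<delta>(1) xb in auto)
      then have "val (\<gamma> x) \<bullet> dp (\<gamma> x) (vector_derivative \<gamma> (at x)) = ?k x"
        using eq[of x] x xb by (simp add: \<kappa>_def)
      then show "((\<lambda>s. U s - \<omega> s) has_real_derivative 0) (at x)"
        using DERIV_diff[OF U(2)[OF x(1) xb] \<omega>(3)[of x]] x s by simp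
    qed
    then show ?thesis using \<omega>(2) by simp
  qed (use \<omega> in simp)
  have d\<omega>: "\<forall>s\<in>ball 0 (\<delta> / 2). vector_derivative \<omega> (at s) = ?k s"
    using \<omega>(3) vector_derivative_at unfolding has_real_derivative_iff_has_vector_derivative by blast
  have eqs: "\<forall>s\<in>{0..<\<delta> / 2}. \<Gamma> s = \<alpha> s \<and> val (\<gamma> s) = \<kappa> s \<and> U s = \<omega> s"
  proof
    fix s assume s: "s \<in> {0..<\<delta> / 2}"
    then have "s < b" using lt[of s] \<delta>(1) by auto
    then show "\<Gamma> s = \<alpha> s \<and> val (\<gamma> s) = \<kappa> s \<and> U s = \<omega> s"
      using eq[of s] s U\<omega>[of s] by (auto simp: \<kappa>_def)
  qed
  have "ball 0 (\<delta> / 2) \<subseteq> ball 0 \<delta>" "0 < \<delta> / 2" using \<delta>(1) by auto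
  then show ?thesis unfolding smooth_arc_def
    using smooth_on_subset[OF \<alpha>' open_ball] smooth_on_subset[OF \<kappa> open_ball] \<omega>(1) d\<omega> eqs by blast
qed

section \<open>The primitive of the Liouville form along a lift\<close>

definition eta_density :: "(real \<Rightarrow> complex ^ 'n) \<Rightarrow> real \<Rightarrow> real" where
  "eta_density \<gamma> t = val (\<gamma> t) \<bullet> dp (\<gamma> t) (vector_derivative \<gamma> (at t))"

lemma dp_scaleR: "dp z (r *\<^sub>R a) = r *\<^sub>R dp z a"
proof -
  have "r *\<^sub>R x / y = r *\<^sub>R (x / y)" for x y :: complex
    unfolding scaleR_conv_of_real by (rule times_divide_eq_right[symmetric])
  then show ?thesis by (simp add: dp_def vec_eq_iff)
qed

lemma eta_integral_density: "eta_integral \<gamma> = integral {0..1} (eta_density \<gamma>)"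
  unfolding eta_integral_def eta_density_def[abs_def] ..

lemma eta_density_cong:
  assumes "open T" "t \<in> T" "\<And>s. s \<in> T \<Longrightarrow> \<gamma> s = g s"
  shows "eta_density \<gamma> t = eta_density g t"
proof -
  have "(\<gamma> has_vector_derivative D) (at t) \<longleftrightarrow> (g has_vector_derivative D) (at t)" for D
  proof
    assume "(\<gamma> has_vector_derivative D) (at t)"
    then show "(g has_vector_derivative D) (at t)"
      by (rule has_vector_derivative_transform_within_open[OF _ assms])
  next
    assume "(g has_vector_derivative D) (at t)"
    then show "(\<gamma> has_vector_derivative D) (at t)"
      by (rule has_vector_derivative_transform_within_open[OF _ assms(1,2) assms(3)[symmetric]])
  qed
  then have "vector_derivative \<gamma> (at t) = vector_derivative g (at t)"
    unfolding vector_derivative_def by simp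
  then show ?thesis unfolding eta_density_def assms(3)[OF assms(2)] by simp
qed

lemma continuous_on_eta_density:
  assumes "smooth_on UNIV g"
  shows "continuous_on {s. \<forall>j. g s $ j \<noteq> 0} (eta_density g)"
proof -
  let ?S = "{s. \<forall>j. g s $ j \<noteq> 0}"
  have S: "open ?S" by (rule open_nonzero_nbhd[OF smooth_on_continuous_on[OF assms]])
  have v: "continuous_on ?S (\<lambda>s. val (g s))"
    by (intro smooth_on_continuous_on smooth_on_val smooth_on_subset[OF assms] S) auto
  have g: "continuous_on ?S (\<lambda>s. g s $ j)" for j
    by (rule continuous_on_subset[OF smooth_on_continuous_on[OF smooth_on_vec_nth[OF assms]]]) simp
  have g': "continuous_on ?S (\<lambda>s. vector_derivative g (at s) $ j)" for j
    by (rule continuous_on_subset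
        [OF smooth_on_continuous_on[OF smooth_on_vec_nth[OF smooth_on_vector_derivative[OF assms]]]]) simp
  have "continuous_on ?S (\<lambda>s. dp (g s) (vector_derivative g (at s)))"
    unfolding dp_def
    by (intro continuous_on_vec_lambda continuous_on_divide continuous_on_Im continuous_on_const g g') auto
  then show ?thesis unfolding eta_density_def[abs_def] by (intro continuous_on_inner v)
qed

locale smooth_lift =
  fixes \<gamma> :: "real \<Rightarrow> complex ^ 'n" and S :: "real set"
  assumes finite_breaks: "finite S"
    and smooth_piece: "\<And>a b. 0 \<le> a \<Longrightarrow> a < b \<Longrightarrow> b \<le> 1 \<Longrightarrow> {a<..<b} \<inter> S = {} \<Longrightarrow>
      \<exists>g. smooth_on UNIV g \<and> (\<forall>t\<in>{a..b}. g t = \<gamma> t)"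
    and nonzero: "\<And>t j. t \<in> {0..1} \<Longrightarrow> \<gamma> t $ j \<noteq> 0"
begin

lemma right_gap:
  assumes "t < c"
  obtains b where "t < b" "b \<le> c" "{t<..<b} \<inter> S = {}"
proof -
  have "finite (insert c {s \<in> S. t < s})" using finite_breaks by simp
  then show ?thesis
    using assms by (intro that[of "Min (insert c {s \<in> S. t < s})"]) auto
qed

lemma left_gap:
  assumes "c < t"
  obtains a where "a < t" "c \<le> a" "{a<..<t} \<inter> S = {}"
proof -
  have "finite (insert c {s \<in> S. s < t})" using finite_breaks by simp
  then show ?thesis
    using assms by (intro that[of "Max (insert c {s \<in> S. s < t})"]) auto
qed

lemma density_integrable_piece:
  assumes "0 \<le> a" "a \<le> b" "b \<le> 1" "{a<..<b} \<inter> S = {}"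
  shows "eta_density \<gamma> integrable_on {a..b}"
proof (cases "a = b")
  case False
  then obtain g where g: "smooth_on UNIV g" "\<And>t. t \<in> {a..b} \<Longrightarrow> g t = \<gamma> t"
    using smooth_piece[of a b] assms by auto
  have "eta_density g integrable_on cbox a b"
    by (intro integrable_continuous continuous_on_subset[OF continuous_on_eta_density[OF g(1)]])
      (use g nonzero assms in auto)
  moreover have "eta_density \<gamma> x = eta_density g x" if "x \<in> box a b" for x
    by (rule eta_density_cong[of "{a<..<b}"]) (use that g in auto)
  ultimately show ?thesis using integrable_spike_interior[of a b "eta_density \<gamma>"] by simp
qed (use integrable_on_refl[of "eta_density \<gamma>" b] in simp)

text \<open>It suffices to integrate over short intervals around each point: cut at that point, such
  an interval has no break point inside either half.\<close>

lemma density_integrable: "eta_density \<gamma> integrable_on {0..1}"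
proof -
  have "eta_density \<gamma> integrable_on cbox 0 1"
  proof (rule integrable_on_little_subintervals, rule ballI)
    fix x :: real assume "x \<in> cbox 0 1"
    obtain b where b: "x < b" "{x<..<b} \<inter> S = {}" by (rule right_gap[of x "x + 1"]) auto
    obtain a where a: "a < x" "{a<..<x} \<inter> S = {}" by (rule left_gap[of "x - 1" x]) auto
    show "\<exists>d>0. \<forall>u v. x \<in> cbox u v \<and> cbox u v \<subseteq> ball x d \<and> cbox u v \<subseteq> cbox 0 1 \<longrightarrow>
        eta_density \<gamma> integrable_on cbox u v"
    proof (intro exI[of _ "min (b - x) (x - a)"] conjI allI impI)
      show "0 < min (b - x) (x - a)" using a b by simp
      fix u v assume uv: "x \<in> cbox u v \<and> cbox u v \<subseteq> ball x (min (b - x) (x - a)) \<and> cbox u v \<subseteq> cbox 0 1"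
      then have "u \<in> cbox u v" "v \<in> cbox u v" by auto
      then have *: "u \<in> ball x (min (b - x) (x - a))" "v \<in> ball x (min (b - x) (x - a))" "u \<in> cbox 0 1" "v \<in> cbox 0 1"
        using uv by blast+
      have le: "u \<le> x" "x \<le> v" "a < u" "v < b" "0 \<le> u" "v \<le> 1"
        using * uv by (auto simp: dist_real_def abs_less_iff)
      then have "{u<..<x} \<subseteq> {a<..<x}" "{x<..<v} \<subseteq> {x<..<b}" by auto
      then have "{u<..<x} \<inter> S = {}" "{x<..<v} \<inter> S = {}" using a b by blast+
      then have "eta_density \<gamma> integrable_on {u..x}" "eta_density \<gamma> integrable_on {x..v}"
        using density_integrable_piece[of u x] density_integrable_piece[of x v] le by auto
      then show "eta_density \<gamma> integrable_on cbox u v"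
        using Henstock_Kurzweil_Integration.integrable_combine[of u x v "eta_density \<gamma>"] uv by simp
    qed
  qed
  then show ?thesis by simp
qed

definition primitive :: "real \<Rightarrow> real" where
  "primitive t = integral {0..t} (eta_density \<gamma>)"

lemma primitive_0: "primitive 0 = 0"
  by (simp add: primitive_def)

lemma primitive_1: "primitive 1 = eta_integral \<gamma>"
  by (simp add: primitive_def eta_integral_density)

lemma continuous_on_primitive: "continuous_on {0..1} primitive"
  unfolding primitive_def[abs_def] by (rule indefinite_integral_continuous_1[OF density_integrable])

lemma smooth_at:
  assumes "t \<in> {0<..<1} - S"
  obtains g a b where "0 \<le> a" "a < t" "t < b" "b \<le> 1" "smooth_on UNIV g" "\<And>s. s \<in> {a..b} \<Longrightarrow> g s = \<gamma> s"
proof -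
  obtain b where b: "t < b" "b \<le> 1" "{t<..<b} \<inter> S = {}" using assms by (auto intro: right_gap)
  obtain a where a: "a < t" "0 \<le> a" "{a<..<t} \<inter> S = {}" using assms by (auto intro: left_gap)
  have "{a<..<b} \<subseteq> {a<..<t} \<union> {t} \<union> {t<..<b}" by auto
  then have "{a<..<b} \<inter> S = {}" using a b assms by blast
  then show ?thesis using smooth_piece[of a b] a b that by (metis less_trans)
qed

lemma differentiable: "t \<in> {0<..<1} - S \<Longrightarrow> \<gamma> differentiable at t"
proof -
  assume "t \<in> {0<..<1} - S"
  then obtain g a b where "0 \<le> a" "b \<le> 1"
    and *: "a < t" "t < b" "smooth_on UNIV g" "\<And>s. s \<in> {a..b} \<Longrightarrow> g s = \<gamma> s"
    by (rule smooth_at) (rule that; assumption)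
  have "(\<gamma> has_vector_derivative vector_derivative g (at t)) (at t)"
    by (rule has_vector_derivative_transform_within_open[OF smooth_on_has_vector_derivative[OF *(3)], of _ "{a<..<b}"])
      (use * in auto)
  then show ?thesis by (rule differentiableI_vector)
qed

lemma primitive_has_derivative:
  assumes t: "t \<in> {0<..<1} - S"
  shows "(primitive has_real_derivative eta_density \<gamma> t) (at t)"
proof -
  obtain g a b where *: "0 \<le> a" "a < t" "t < b" "b \<le> 1" "smooth_on UNIV g" "\<And>s. s \<in> {a..b} \<Longrightarrow> g s = \<gamma> s"
    by (rule smooth_at[OF t]) (rule that; assumption)
  have "continuous_on {a<..<b} (eta_density g)"
    by (rule continuous_on_subset[OF continuous_on_eta_density[OF *(5)]])
      (use * nonzero in auto)
  moreover have "eta_density \<gamma> s = eta_density g s" if "s \<in> {a<..<b}" for s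
    by (rule eta_density_cong[of "{a<..<b}"]) (use that * in auto)
  ultimately have "continuous_on {a<..<b} (eta_density \<gamma>)"
    using continuous_on_cong by (metis (no_types, lifting))
  then have c: "isCont (eta_density \<gamma>) t"
    using * by (simp add: continuous_on_eq_continuous_at)
  have "((\<lambda>u. integral {0..u} (eta_density \<gamma>)) has_vector_derivative eta_density \<gamma> t) (at t within {0..1} - {})"
    by (rule integral_has_vector_derivative_continuous_at[OF density_integrable])
      (use t c in \<open>auto intro: continuous_at_imp_continuous_at_within\<close>)
  then show ?thesis
    using t by (simp add: primitive_def[abs_def] has_real_derivative_iff_has_vector_derivative at_within_Icc_at)
qed

end

lemma smooth_liftI:
  assumes "lifts_to L c \<gamma>" "\<And>t. t \<in> {0..1} \<Longrightarrow> \<exists>p. c t = torus p"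
  obtains S where "smooth_lift \<gamma> S"
proof -
  obtain S where S: "finite S" "\<And>a b. 0 \<le> a \<Longrightarrow> a < b \<Longrightarrow> b \<le> 1 \<Longrightarrow> {a<..<b} \<inter> S = {} \<Longrightarrow>
      \<exists>g. smooth_on UNIV g \<and> (\<forall>t\<in>{a..b}. g t = \<gamma> t)"
    using assms(1) unfolding lifts_to_def piecewise_smooth_path_def by blast
  have "\<gamma> t $ j \<noteq> 0" if t: "t \<in> {0..1}" for t j
  proof
    assume 0: "\<gamma> t $ j = 0"
    have "arg_torus (\<gamma> t) = c t" using assms(1) t unfolding lifts_to_def by blast
    then obtain p where "arg_torus (\<gamma> t) = torus p" using assms(2)[OF t] by metis
    then have "arg_torus (\<gamma> t) $ j = cis (2 * pi * p $ j)" by (simp add: torus_def)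
    then show False using 0 by (simp add: arg_torus_def)
  qed
  then show ?thesis using S by (intro that[of S]) (simp add: smooth_lift_def)
qed

lemma piecewise_smooth_path_affine:
  assumes \<gamma>: "piecewise_smooth_path \<gamma>" and q: "q \<noteq> 0" and \<phi>: "\<And>t. t \<in> {0..1} \<Longrightarrow> p + q * t \<in> {0..1}"
  shows "piecewise_smooth_path (\<lambda>t. \<gamma> (p + q * t))"
proof -
  obtain S where S: "finite S" "\<And>a b. 0 \<le> a \<Longrightarrow> a < b \<Longrightarrow> b \<le> 1 \<Longrightarrow> {a<..<b} \<inter> S = {} \<Longrightarrow>
      \<exists>g. smooth_on UNIV g \<and> (\<forall>t\<in>{a..b}. g t = \<gamma> t)"
    using \<gamma> unfolding piecewise_smooth_path_def by blast
  have aff: "smooth_on UNIV (\<lambda>t. p + q * t)"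
    by (intro smooth_on_add smooth_on_mult smooth_on_const smooth_on_id open_UNIV)
  show ?thesis unfolding piecewise_smooth_path_def
  proof (intro exI[of _ "(\<lambda>t. (t - p) / q) ` S"] conjI allI impI)
    show "finite ((\<lambda>t. (t - p) / q) ` S)" using S(1) by simp
    fix a b assume ab: "0 \<le> a \<and> a < b \<and> b \<le> 1 \<and> {a<..<b} \<inter> (\<lambda>t. (t - p) / q) ` S = {}"
    \<comment> \<open>A negative \<open>q\<close> reverses the interval, hence minimum and
      maximum.\<close>
    define a' where "a' = min (p + q * a) (p + q * b)"
    define b' where "b' = max (p + q * a) (p + q * b)"
    have "q * a \<noteq> q * b" using ab q by simp
    then consider "q * a < q * b" | "q * b < q * a" by linarith
    then have lt: "a' < b'"
      by cases (auto simp: a'_def b'_def)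
    have rng: "0 \<le> a'" "b' \<le> 1" using \<phi>[of a] \<phi>[of b] ab by (auto simp: a'_def b'_def)
    have "{a'<..<b'} \<inter> S = {}"
    proof (rule ccontr)
      assume "{a'<..<b'} \<inter> S \<noteq> {}"
      then obtain s where s: "s \<in> S" "a' < s" "s < b'" by auto
      have "(s - p) / q \<in> {a<..<b}"
      proof (cases "0 < q")
        case True
        then have "q * a < q * b" using ab by (intro mult_strict_left_mono) auto
        then show ?thesis using s True by (auto simp: a'_def b'_def field_simps)
      next
        case False
        then have "q < 0" using q by simp
        then have "q * b < q * a" using ab by (intro mult_strict_left_mono_neg) auto
        then show ?thesis using s \<open>q < 0\<close> by (auto simp: a'_def b'_def field_simps)
      qed
      then show False using ab s(1) by blast
    qed
    from S(2)[OF rng(1) lt rng(2) this] obtain g where g: "smooth_on UNIV g" "\<forall>t\<in>{a'..b'}. g t = \<gamma> t" by blast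
    have "smooth_on UNIV (\<lambda>t. g (p + q * t))" by (rule smooth_on_compose[OF g(1) aff]) auto
    moreover have "p + q * t \<in> {a'..b'}" if "t \<in> {a..b}" for t
    proof (cases "0 < q")
      case True
      then have "q * a \<le> q * t" "q * t \<le> q * b" using that by auto
      then show ?thesis by (auto simp: a'_def b'_def)
    next
      case False
      then have "q * b \<le> q * t" "q * t \<le> q * a" using that q by (auto intro: mult_left_mono_neg)
      then show ?thesis by (auto simp: a'_def b'_def)
    qed
    ultimately show "\<exists>g. smooth_on UNIV g \<and> (\<forall>t\<in>{a..b}. g t = \<gamma> (p + q * t))" using g(2) by blast
  qed
qed

context smooth_lift
begin

lemma primitive_affine_has_derivative:
  assumes pt: "p + q * t \<in> {0<..<1} - S"
  shows "((\<lambda>t. primitive (p + q * t)) has_real_derivative eta_density (\<lambda>t. \<gamma> (p + q * t)) t) (at t)"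
proof -
  have aff: "((\<lambda>t. p + q * t) has_real_derivative q) (at t)" by (auto intro!: derivative_eq_intros)
  have "(\<gamma> has_vector_derivative vector_derivative \<gamma> (at (p + q * t))) (at (p + q * t))"
    using differentiable[OF pt] vector_derivative_works by blast
  from vector_diff_chain_at[OF aff[unfolded has_real_derivative_iff_has_vector_derivative] this]
  have d: "((\<lambda>t. \<gamma> (p + q * t)) has_vector_derivative q *\<^sub>R vector_derivative \<gamma> (at (p + q * t))) (at t)"
    unfolding o_def .
  have "eta_density (\<lambda>t. \<gamma> (p + q * t)) t = eta_density \<gamma> (p + q * t) * q"
    unfolding eta_density_def vector_derivative_at[OF d] dp_scaleR by simp
  then show ?thesis using DERIV_chain2[OF primitive_has_derivative[OF pt] aff] by simp
qed

lemma continuous_on_primitive_affine: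
  assumes "\<And>t. t \<in> {0..b} \<Longrightarrow> p + q * t \<in> {0..1}"
  shows "continuous_on {0..b} (\<lambda>t. primitive (p + q * t))"
proof (rule continuous_on_compose2[OF continuous_on_primitive])
  show "continuous_on {0..b} (\<lambda>t. p + q * t)" by (intro continuous_intros)
  show "(\<lambda>t. p + q * t) ` {0..b} \<subseteq> {0..1}" by (rule image_subsetI) (rule assms)
qed

text \<open>The weight of an edge is an integral over all of [0,1], whereas the cycle passes the
  edge during a subinterval, possibly backwards. The integral of a 1-form is invariant under this
  reparametrisation up to orientation, and the pulled back break points form the finite exceptional
  set for the fundamental theorem.\<close>

lemma eta_integral_affine:
  assumes q: "q \<noteq> 0" and \<phi>: "\<And>t. t \<in> {0..1} \<Longrightarrow> p + q * t \<in> {0..1}"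
  shows "eta_integral (\<lambda>t. \<gamma> (p + q * t)) = primitive (p + q) - primitive p"
proof -
  let ?S = "(\<lambda>t. (t - p) / q) ` S"
  have "(eta_density (\<lambda>t. \<gamma> (p + q * t)) has_integral primitive (p + q * 1) - primitive (p + q * 0)) {0..1}"
  proof (rule fundamental_theorem_of_calculus_interior_strong[of ?S])
    show "finite ?S" using finite_breaks by (rule finite_imageI)
    show "continuous_on {0..1} (\<lambda>t. primitive (p + q * t))"
      by (rule continuous_on_primitive_affine[OF \<phi>])
    fix t assume t: "t \<in> {0<..<1} - ?S"
    have "p + q * t \<notin> S"
    proof
      assume "p + q * t \<in> S"
      then have "(p + q * t - p) / q \<in> ?S" by (rule imageI)
      then show False using t q by simp
    qed
    moreover have "p + q * t \<in> {0<..<1}"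
    proof -
      have r: "0 \<le> p" "p \<le> 1" "0 \<le> p + q" "p + q \<le> 1" using \<phi>[of 0] \<phi>[of 1] by simp_all
      have t': "0 < t" "t < 1" using t by simp_all
      show ?thesis
      proof (cases "0 < q")
        case True
        then have "0 < q * t" "q * t < q * 1" using t' by (intro mult_pos_pos mult_strict_left_mono; simp)+
        then show ?thesis using r by simp
      next
        case False
        then have "q < 0" using q by simp
        then have "q * t < 0" "q * 1 < q * t" using t' by (intro mult_neg_pos mult_strict_left_mono_neg; simp)+
        then show ?thesis using r by simp
      qed
    qed
    ultimately have "p + q * t \<in> {0<..<1} - S" by blast
    from primitive_affine_has_derivative[OF this]
    show "((\<lambda>t. primitive (p + q * t)) has_vector_derivative eta_density (\<lambda>t. \<gamma> (p + q * t)) t) (at t)"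
      by (simp only: has_real_derivative_iff_has_vector_derivative)
  qed simp
  from integral_unique[OF this] show ?thesis unfolding eta_integral_density by simp
qed

text \<open>\<open>q\<close> is the direction of time: 1 gives the germ after \<open>p\<close>, and
  -1 the germ before \<open>p\<close> run backwards. Both sides of a corner are thus covered by one
  argument.\<close>

lemma smooth_arc_affine:
  assumes q: "q = 1 \<or> q = - 1" and b: "0 < b"
    and rng: "\<And>s. 0 \<le> s \<Longrightarrow> s \<le> b \<Longrightarrow> p + q * s \<in> {0..1}"
    and gap: "\<And>s. 0 < s \<Longrightarrow> s < b \<Longrightarrow> p + q * s \<notin> S"
    and \<alpha>: "smooth_on UNIV \<alpha>" "\<And>s. 0 \<le> s \<Longrightarrow> s \<le> b \<Longrightarrow> \<Gamma> (p + q * s) = \<alpha> s"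
    and lift: "\<And>t. t \<in> {0..1} \<Longrightarrow> arg_torus (\<gamma> t) = torus (\<Gamma> t)"
  shows "smooth_arc (\<lambda>s. \<Gamma> (p + q * s)) (\<lambda>s. val (\<gamma> (p + q * s))) (\<lambda>s. primitive (p + q * s))
    (vector_derivative \<alpha> (at 0))"
proof -
  define x where "x = min p (p + q * b)"
  have xy: "0 \<le> x" "x < x + b" "x + b \<le> 1" using q b rng[of 0] rng[of b] by (auto simp: x_def)
  have "{x<..<x + b} \<inter> S = {}"
  proof (rule equals0I)
    fix t assume t: "t \<in> {x<..<x + b} \<inter> S"
    have "p + q * (q * (t - p)) = t" using q by auto
    moreover have "0 < q * (t - p)" "q * (t - p) < b" using q t b by (auto simp: x_def)
    ultimately show False using gap[of "q * (t - p)"] t by simp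
  qed
  from smooth_piece[OF xy this] obtain g where g: "smooth_on UNIV g" "\<forall>t\<in>{x..x + b}. g t = \<gamma> t" by blast
  have aff: "smooth_on UNIV (\<lambda>s. p + q * s)"
    by (intro smooth_on_add smooth_on_mult smooth_on_const smooth_on_id open_UNIV)
  show ?thesis
  proof (rule smooth_arc_lift[OF b _ \<alpha>(1)])
    show "smooth_on UNIV (\<lambda>s. g (p + q * s))" by (rule smooth_on_compose[OF g(1) aff]) auto
    show "continuous_on {0..b} (\<lambda>s. primitive (p + q * s))"
      by (rule continuous_on_primitive_affine) (rule rng; simp)
    fix s
    show "((\<lambda>s. primitive (p + q * s)) has_real_derivative
        val (\<gamma> (p + q * s)) \<bullet> dp (\<gamma> (p + q * s)) (vector_derivative (\<lambda>s. \<gamma> (p + q * s)) (at s))) (at s)"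
      if s: "0 < s" "s < b"
    proof -
      have "p + q * s \<in> {0<..<1}" using q s rng[of 0] rng[of b] b by auto
      then have "p + q * s \<in> {0<..<1} - S" using gap[OF s] by blast
      from primitive_affine_has_derivative[OF this] show ?thesis unfolding eta_density_def .
    qed
    show "\<gamma> (p + q * s) = g (p + q * s) \<and> \<Gamma> (p + q * s) = \<alpha> s \<and>
        arg_torus (\<gamma> (p + q * s)) = torus (\<Gamma> (p + q * s)) \<and> (\<forall>j. \<gamma> (p + q * s) $ j \<noteq> 0)"
      if s: "0 \<le> s" "s \<le> b"
    proof -
      have "p + q * s \<in> {x..x + b}" using q s by (auto simp: x_def)
      then have "\<gamma> (p + q * s) = g (p + q * s)" using g(2) by metis
      then show ?thesis using \<alpha>(2)[OF s] lift[OF rng[OF s]] nonzero[OF rng[OF s]] by blast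
    qed
  qed
qed

end

section \<open>The boundary walk of a face\<close>

text \<open>Here \<open>fst e\<close> is the black end of the edge \<open>e\<close>, at parameter 0,
  and \<open>fst (snd (snd e))\<close> its white end, at parameter 1; this is why the cusp
  conditions are split by colour.\<close>

locale boundary_walk =
  fixes E :: "('v, 'w, 2) edge set" and epath :: "('v, 'w, 2) edge \<Rightarrow> real \<Rightarrow> real ^ 2"
    and c :: "(('v, 'w, 2) edge \<times> bool) list" and h :: "complex \<Rightarrow> real ^ 2"
  assumes smooth_edge: "\<And>e. e \<in> E \<Longrightarrow> smooth_on UNIV (epath e)"
    and regular_edge: "\<And>e t. e \<in> E \<Longrightarrow> t \<in> {0..1} \<Longrightarrow> vector_derivative (epath e) (at t) \<noteq> 0"
    and edges_meet: "\<And>e e' t t'. e \<in> E \<Longrightarrow> e' \<in> E \<Longrightarrow> t \<in> {0..1} \<Longrightarrow> t' \<in> {0..1} \<Longrightarrow>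
      torus (epath e t) = torus (epath e' t') \<Longrightarrow>
      e = e' \<and> t = t' \<or> fst e = fst e' \<and> t = 0 \<and> t' = 0 \<or>
      fst (snd (snd e)) = fst (snd (snd e')) \<and> t = 1 \<and> t' = 1"
    and no_cusp_black: "\<And>e e'. e \<in> E \<Longrightarrow> e' \<in> E \<Longrightarrow> e \<noteq> e' \<Longrightarrow> fst e = fst e' \<Longrightarrow>
      sgn (vector_derivative (epath e) (at 0)) \<noteq> sgn (vector_derivative (epath e') (at 0))"
    and no_cusp_white: "\<And>e e'. e \<in> E \<Longrightarrow> e' \<in> E \<Longrightarrow> e \<noteq> e' \<Longrightarrow>
      fst (snd (snd e)) = fst (snd (snd e')) \<Longrightarrow>
      sgn (vector_derivative (epath e) (at 1)) \<noteq> sgn (vector_derivative (epath e') (at 1))"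
    and walk: "closed_walk E epath c"
    and disk: "continuous_on (cball 0 1) h" "inj_on h (cball 0 1)"
    and boundary: "\<And>t. t \<in> {0..1} \<Longrightarrow> torus (h (cis (2 * pi * t))) = cycle_path epath c t"
begin

abbreviation m :: nat where "m \<equiv> length c"

definition loop :: "real \<Rightarrow> real ^ 2" where "loop t = h (cis (2 * pi * t))"

definition edge_path :: "nat \<Rightarrow> real \<Rightarrow> real ^ 2" where
  "edge_path i s = epath (fst (c ! i)) (if snd (c ! i) then s else 1 - s)"

lemma m_pos: "0 < m"
  using walk by (simp add: closed_walk_def)

lemma edge_in: "i < m \<Longrightarrow> fst (c ! i) \<in> E"
  using walk unfolding closed_walk_def by (meson image_subset_iff nth_mem)

lemma loop_eqD: "loop t = loop t' \<Longrightarrow> t - t' \<in> \<int>"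
  using inj_onD[OF disk(2), of "cis (2 * pi * t)" "cis (2 * pi * t')"] cis_2pi_eq_iff
  by (simp add: loop_def)

lemma loop_add_int: "n \<in> \<int> \<Longrightarrow> loop (t + n) = loop t"
  using cis_2pi_eq_iff[of "t + n" t] by (simp add: loop_def)

lemma continuous_on_loop: "continuous_on A loop"
  unfolding loop_def by (rule continuous_on_compose2[OF disk(1)]) (auto intro!: continuous_intros)

lemma vertex_matches:
  assumes "i < m"
  shows "torus (edge_path i 1) = torus (edge_path (Suc i mod m) 0)"
  using walk assms by (simp add: closed_walk_def step_path_def edge_path_def)

lemma cycle_path_step:
  assumes i: "i < m" and s: "s \<in> {0..1}"
  shows "cycle_path epath c ((real i + s) / real m) = torus (edge_path i s)"
proof -
  have x: "real m * ((real i + s) / real m) = real i + s" using m_pos by simp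
  show ?thesis
  proof (cases "s = 1")
    case True
    \<comment> \<open>At \<open>s = 1\<close> the floor has already moved on to the start of the
      next edge; both readings of the vertex agree because consecutive steps match.\<close>
    then have f: "nat \<lfloor>real i + s\<rfloor> = Suc i" "frac (real i + s) = 0" by (auto simp: frac_def)
    show ?thesis using vertex_matches[OF i] True
      unfolding cycle_path_def x Let_def f by (simp add: step_path_def edge_path_def)
  next
    case False
    then have f: "\<lfloor>real i + s\<rfloor> = int i" using s by (auto simp: floor_eq_iff)
    then have "frac (real i + s) = s" by (simp add: frac_def)
    then show ?thesis unfolding cycle_path_def x Let_def
      using f i by (simp add: step_path_def edge_path_def)
  qed
qed

lemma step_in: "i < m \<Longrightarrow> s \<in> {0..1} \<Longrightarrow> (real i + s) / real m \<in> {0..1}"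
  using m_pos by (auto simp: divide_le_eq)

lemma smooth_edge_path: "i < m \<Longrightarrow> smooth_on UNIV (edge_path i)"
proof -
  assume i: "i < m"
  have "smooth_on UNIV (\<lambda>s::real. if snd (c ! i) then s else 1 - s)"
    by (cases "snd (c ! i)") (auto intro!: smooth_on_id smooth_on_diff smooth_on_const)
  from smooth_on_compose[OF smooth_edge[OF edge_in[OF i]] this] show ?thesis
    by (simp add: edge_path_def[abs_def])
qed

lemma vector_derivative_edge_path:
  assumes "i < m"
  shows "vector_derivative (edge_path i) (at s) =
    (if snd (c ! i) then vector_derivative (epath (fst (c ! i))) (at s)
     else - vector_derivative (epath (fst (c ! i))) (at (1 - s)))"
proof (cases "snd (c ! i)")
  case False
  have "((\<lambda>s. 1 - s) has_vector_derivative - 1) (at s)" by (auto intro!: derivative_eq_intros)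
  from vector_diff_chain_at[OF this smooth_on_has_vector_derivative[OF smooth_edge[OF edge_in[OF assms]] UNIV_I]]
  show ?thesis using False by (intro vector_derivative_at) (simp add: edge_path_def[abs_def] o_def)
qed (simp add: edge_path_def[abs_def])

lemma edge_path_regular:
  "i < m \<Longrightarrow> s \<in> {0..1} \<Longrightarrow> vector_derivative (edge_path i) (at s) \<noteq> 0"
  using regular_edge[OF edge_in] by (simp add: vector_derivative_edge_path)

text \<open>Transfers smoothness from the edges to the lifted loop: over one step, the loop and the
  edge are lifts of the same path in the torus, so they differ by a constant.\<close>

lemma loop_step:
  assumes i: "i < m"
  obtains n where "\<And>s. s \<in> {0..1} \<Longrightarrow> loop ((real i + s) / real m) = edge_path i s + n"
proof (rule torus_eq_imp_translate[of "{0..1}" "\<lambda>s. loop ((real i + s) / real m)" "edge_path i"])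
  show "continuous_on {0..1} (\<lambda>s. loop ((real i + s) / real m))"
    by (rule continuous_on_compose2[OF continuous_on_loop[of UNIV]])
      (use m_pos in \<open>auto intro!: continuous_intros\<close>)
  show "continuous_on {0..1} (edge_path i)"
    using smooth_on_continuous_on[OF smooth_edge_path[OF i]] by (rule continuous_on_subset) simp
  show "torus (loop ((real i + s) / real m)) = torus (edge_path i s)" if "s \<in> {0..1}" for s
    using boundary[OF step_in[OF i that]] cycle_path_step[OF i that] by (simp add: loop_def)
qed (auto intro: that)

text \<open>Turning back along the same edge is impossible because the lifted loop is injective.\<close>

lemma corner:
  assumes j: "j < m" and k: "k = Suc j mod m"
  shows "sgn (vector_derivative (edge_path k) (at 0)) \<noteq> sgn (- vector_derivative (edge_path j) (at 1))"
proof -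
  have km: "k < m" using k m_pos by simp
  let ?ej = "fst (c ! j)" and ?ek = "fst (c ! k)"
  have meet: "torus (epath ?ej (if snd (c ! j) then 1 else 0)) = torus (epath ?ek (if snd (c ! k) then 0 else 1))"
    using vertex_matches[OF j] unfolding edge_path_def k[symmetric] by (simp split: if_splits)
  have ne: "\<not> (?ej = ?ek \<and> snd (c ! k) = (\<not> snd (c ! j)))"
  proof
    assume eq: "?ej = ?ek \<and> snd (c ! k) = (\<not> snd (c ! j))"
    obtain nj where nj: "\<And>s. s \<in> {0..1} \<Longrightarrow> loop ((real j + s) / real m) = edge_path j s + nj"
      using loop_step[OF j] by blast
    obtain nk where nk: "\<And>s. s \<in> {0..1} \<Longrightarrow> loop ((real k + s) / real m) = edge_path k s + nk"
      using loop_step[OF km] by blast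
    have flip: "edge_path k s = edge_path j (1 - s)" for s using eq by (auto simp: edge_path_def)
    \<comment> \<open>The end of step \<open>j\<close> is the start of step \<open>k\<close> modulo
      the period: the difference is 1 if the walk wraps around and 0 otherwise.\<close>
    have int: "(real j + 1) / real m - real k / real m \<in> \<int>"
    proof (cases "Suc j = m")
      case True
      then have "k = 0" "real j + 1 = real m" using k by auto
      then show ?thesis using m_pos by simp
    next
      case False
      then have "k = Suc j" using j k by simp
      then show ?thesis by (simp add: add.commute)
    qed
    have "loop ((real j + 1) / real m) = loop (real k / real m)"
      using loop_add_int[OF int, of "real k / real m"] by simp
    then have "nj = nk" using nj[of 1] nk[of 0] flip[of 0] by simp
    \<comment> \<open>A quarter of a step before and after the turn the loop would be at the same
      point, but modulo periods these times differ by 1 / (2 m), which is not an integer.\<close>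
    then have "loop ((real k + 1/4) / real m) = loop ((real j + 3/4) / real m)"
      using nj[of "3/4"] nk[of "1/4"] flip[of "1/4"] by simp
    then have "(real k + 1/4) / real m - (real j + 3/4) / real m \<in> \<int>" by (rule loop_eqD)
    then have "((real k + 1/4) / real m - (real j + 3/4) / real m) + ((real j + 1) / real m - real k / real m) \<in> \<int>"
      using int by (rule Ints_add)
    also have "((real k + 1/4) / real m - (real j + 3/4) / real m) + ((real j + 1) / real m - real k / real m) = 1 / (2 * real m)"
      using m_pos by (simp add: field_simps)
    finally obtain z :: int where z: "1 / (2 * real m) = of_int z" by (auto elim: Ints_cases)
    have "1 \<le> real m" using m_pos by linarith
    then have "0 < 2 * real m" "1 < 2 * real m" by linarith+
    then have "0 < 1 / (2 * real m)" "1 / (2 * real m) < 1"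
      by (simp_all only: zero_less_divide_1_iff divide_less_eq_1_pos)
    then show False unfolding z by simp
  qed
  \<comment> \<open>The parameter of the common end point is 0 or 1 on each edge and determines its
    colour: a step that arrives at a white vertex is followed by one that leaves from a white
    vertex, and likewise for black.\<close>
  have ends: "?ej = ?ek \<and> (if snd (c ! j) then 1 else 0) = (if snd (c ! k) then 0 else (1::real)) \<or>
      fst ?ej = fst ?ek \<and> (if snd (c ! j) then 1 else 0) = (0::real) \<and> (if snd (c ! k) then 0 else 1) = (0::real) \<or>
      fst (snd (snd ?ej)) = fst (snd (snd ?ek)) \<and> (if snd (c ! j) then 1 else 0) = (1::real) \<and>
        (if snd (c ! k) then 0 else 1) = (1::real)"
    by (rule edges_meet[OF edge_in[OF j] edge_in[OF km] _ _ meet]) auto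
  show ?thesis
  proof (cases "snd (c ! j)")
    case True
    then have "\<not> snd (c ! k)" "fst (snd (snd ?ej)) = fst (snd (snd ?ek))"
      using ends by (cases "snd (c ! k)"; auto)+
    moreover from this have "?ej \<noteq> ?ek" using ne True by auto
    ultimately show ?thesis
      using no_cusp_white[OF edge_in[OF j] edge_in[OF km]] True
      by (simp add: vector_derivative_edge_path j km sgn_minus)
  next
    case False
    then have "snd (c ! k)" "fst ?ej = fst ?ek"
      using ends by (cases "snd (c ! k)"; auto)+
    moreover from this have "?ej \<noteq> ?ek" using ne False by auto
    ultimately show ?thesis
      using no_cusp_black[OF edge_in[OF j] edge_in[OF km]] False
      by (simp add: vector_derivative_edge_path j km sgn_minus)
  qed
qed

lemma loop_affine:
  assumes i: "i < m" and q: "q = 1 \<or> q = - 1" and p: "p = (real i + s0) / real m" "s0 \<in> {0..1}"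
  obtains \<alpha> where "smooth_on UNIV \<alpha>"
    "vector_derivative \<alpha> (at 0) = (q * real m) *\<^sub>R vector_derivative (edge_path i) (at s0)"
    "\<And>s. s0 + q * real m * s \<in> {0..1} \<Longrightarrow> loop (p + q * s) = \<alpha> s"
proof -
  obtain n where n: "\<And>s. s \<in> {0..1} \<Longrightarrow> loop ((real i + s) / real m) = edge_path i s + n"
    using loop_step[OF i] by blast
  let ?\<alpha> = "\<lambda>s. edge_path i (s0 + q * real m * s) + n"
  have aff: "((\<lambda>s. s0 + q * real m * s) has_vector_derivative q * real m) (at 0)"
    by (auto intro!: derivative_eq_intros)
  show ?thesis
  proof (rule that[of ?\<alpha>])
    show "smooth_on UNIV ?\<alpha>"
      by (intro smooth_on_add smooth_on_compose[OF smooth_edge_path[OF i]] smooth_on_mult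
          smooth_on_const smooth_on_id) auto
    have "(edge_path i has_vector_derivative vector_derivative (edge_path i) (at s0)) (at (s0 + q * real m * 0))"
      using smooth_on_has_vector_derivative[OF smooth_edge_path[OF i], of s0] by simp
    from vector_diff_chain_at[OF aff this]
    have "((\<lambda>s. edge_path i (s0 + q * real m * s)) has_vector_derivative
        (q * real m) *\<^sub>R vector_derivative (edge_path i) (at s0)) (at 0)" unfolding o_def .
    then have "(?\<alpha> has_vector_derivative (q * real m) *\<^sub>R vector_derivative (edge_path i) (at s0)) (at 0)"
      using has_vector_derivative_add[OF _ has_vector_derivative_const[of n]] by fastforce
    then show "vector_derivative ?\<alpha> (at 0) = (q * real m) *\<^sub>R vector_derivative (edge_path i) (at s0)"
      by (rule vector_derivative_at)
    fix s assume s: "s0 + q * real m * s \<in> {0..1}"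
    have "p + q * s = (real i + (s0 + q * real m * s)) / real m"
      using m_pos by (simp add: p(1) field_simps)
    then show "loop (p + q * s) = ?\<alpha> s" using n[OF s] by simp
  qed
qed

end

section \<open>One-sided germs of the lifted boundary loop, and its weight\<close>

lemma smooth_arc_cong:
  assumes "smooth_arc \<Gamma> Q U d" "0 < b"
    "\<And>s. 0 \<le> s \<Longrightarrow> s < b \<Longrightarrow> \<Gamma>' s = \<Gamma> s \<and> Q' s = Q s \<and> U' s = U s"
  shows "smooth_arc \<Gamma>' Q' U' d"
proof -
  obtain \<delta> \<alpha> \<kappa> \<omega> where *: "0 < \<delta>" "smooth_on (ball 0 \<delta>) \<alpha>" "smooth_on (ball 0 \<delta>) \<kappa>" "smooth_on (ball 0 \<delta>) \<omega>"
    "\<And>s. s \<in> ball 0 \<delta> \<Longrightarrow> vector_derivative \<omega> (at s) = \<kappa> s \<bullet> vector_derivative \<alpha> (at s)"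
    "\<And>s. s \<in> {0..<\<delta>} \<Longrightarrow> \<Gamma> s = \<alpha> s \<and> Q s = \<kappa> s \<and> U s = \<omega> s" "vector_derivative \<alpha> (at 0) = d"
    using assms(1) unfolding smooth_arc_def by blast
  have sub: "ball 0 (min b \<delta>) \<subseteq> ball 0 \<delta>" by auto
  have 1: "\<forall>s\<in>ball 0 (min b \<delta>). vector_derivative \<omega> (at s) = \<kappa> s \<bullet> vector_derivative \<alpha> (at s)"
    using *(5) by simp
  have 2: "\<forall>s\<in>{0..<min b \<delta>}. \<Gamma>' s = \<alpha> s \<and> Q' s = \<kappa> s \<and> U' s = \<omega> s"
    using *(6) assms(3) by simp
  have 3: "0 < min b \<delta>" using *(1) assms(2) by simp
  show ?thesis unfolding smooth_arc_def
    using 1 2 3 *(7) smooth_on_subset[OF *(2) open_ball sub] smooth_on_subset[OF *(3) open_ball sub]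
      smooth_on_subset[OF *(4) open_ball sub] by blast
qed

locale boundary_lift = boundary_walk E epath c h + smooth_lift \<gamma> S
  for E :: "('v, 'w, 2) edge set" and epath :: "('v, 'w, 2) edge \<Rightarrow> real \<Rightarrow> real ^ 2"
    and c :: "(('v, 'w, 2) edge \<times> bool) list" and h :: "complex \<Rightarrow> real ^ 2"
    and \<gamma> :: "real \<Rightarrow> complex ^ 2" and S :: "real set" +
  fixes L :: "(complex ^ 2) set"
  assumes lift: "lifts_to L (cycle_path epath c) \<gamma>"
begin

lemma arg_lift: "t \<in> {0..1} \<Longrightarrow> arg_torus (\<gamma> t) = torus (loop t)"
  using lift boundary unfolding lifts_to_def loop_def by simp

lemma arc_from:
  assumes i: "i < m" and q: "q = 1 \<or> q = - 1" and p: "p = (real i + s0) / real m" "s0 \<in> {0..1}"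
    and s0: "if q = 1 then s0 < 1 else 0 < s0"
  shows "smooth_arc (\<lambda>s. loop (p + q * s)) (\<lambda>s. val (\<gamma> (p + q * s))) (\<lambda>s. primitive (p + q * s))
    ((q * real m) *\<^sub>R vector_derivative (edge_path i) (at s0))"
proof -
  obtain \<alpha> where \<alpha>: "smooth_on UNIV \<alpha>"
    "vector_derivative \<alpha> (at 0) = (q * real m) *\<^sub>R vector_derivative (edge_path i) (at s0)"
    "\<And>s. s0 + q * real m * s \<in> {0..1} \<Longrightarrow> loop (p + q * s) = \<alpha> s"
    by (rule loop_affine[OF i q p]) (rule that; assumption)
  \<comment> \<open>The time that remains from \<open>p\<close> to the end of the current edge in
    direction \<open>q\<close>; it is shortened afterwards so that no break point of the lift is
    passed.\<close>
  define b0 where "b0 = (if q = 1 then 1 - s0 else s0) / real m"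
  have b0: "0 < b0" using s0 m_pos by (simp add: b0_def)
  obtain b where b: "0 < b" "b \<le> b0" "\<And>s. 0 < s \<Longrightarrow> s < b \<Longrightarrow> p + q * s \<notin> S"
  proof (cases "q = 1")
    case True
    obtain t where t: "p < t" "t \<le> p + b0" "{p<..<t} \<inter> S = {}" using right_gap[of p "p + b0"] b0 by auto
    show ?thesis
    proof (rule that[of "t - p"])
      fix s assume "0 < s" "s < t - p"
      then have "p + q * s \<in> {p<..<t}" using True by simp
      then show "p + q * s \<notin> S" using t(3) by blast
    qed (use t in auto)
  next
    case False
    then have q': "q = - 1" using q by simp
    obtain t where t: "t < p" "p - b0 \<le> t" "{t<..<p} \<inter> S = {}" using left_gap[of "p - b0" p] b0 by auto
    show ?thesis
    proof (rule that[of "p - t"])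
      fix s assume "0 < s" "s < p - t"
      then have "p + q * s \<in> {t<..<p}" using q' by simp
      then show "p + q * s \<notin> S" using t(3) by blast
    qed (use t in auto)
  qed
  have s: "s0 + q * real m * s \<in> {0..1}" if "0 \<le> s" "s \<le> b" for s
  proof -
    have "real m * s \<le> real m * b0" using that b(2) by (intro mult_left_mono) auto
    also have "real m * b0 = (if q = 1 then 1 - s0 else s0)" using m_pos by (simp add: b0_def)
    finally have "real m * s \<le> (if q = 1 then 1 - s0 else s0)" .
    moreover have "0 \<le> real m * s" using that by simp
    ultimately show ?thesis using q p(2) by auto
  qed
  have rng: "p + q * s \<in> {0..1}" if "0 \<le> s" "s \<le> b" for s
  proof -
    have "p + q * s = (real i + (s0 + q * real m * s)) / real m"
      using m_pos by (simp add: p(1) field_simps)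
    then show ?thesis using step_in[OF i s[OF that]] by simp
  qed
  show ?thesis
    using smooth_arc_affine[OF q b(1) rng b(3) \<alpha>(1) \<alpha>(3)[OF s] arg_lift] unfolding \<alpha>(2) by blast
qed

text \<open>The lift is given on [0,1] only, so the germ to the left of time 0 is taken at time 1,
  which is \<open>t1\<close>. Inside an edge the two tangents are opposite; at a vertex the germs
  belong to consecutive edges and \<open>corner\<close> separates their directions.\<close>

lemma corner_arcs:
  assumes t: "0 \<le> t" "t < 1" and closed: "\<gamma> 0 = \<gamma> 1" "primitive 1 = 0"
  defines "t1 \<equiv> if t = 0 then 1 else t"
  obtains u v where
    "smooth_arc (\<lambda>s. loop (t + s)) (\<lambda>s. val (\<gamma> (t + s))) (\<lambda>s. primitive (t + s)) u"
    "smooth_arc (\<lambda>s. loop (t1 - s)) (\<lambda>s. val (\<gamma> (t1 - s))) (\<lambda>s. primitive (t1 - s)) v"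
    "u \<noteq> 0" "v \<noteq> 0" "sgn u \<noteq> sgn v"
proof -
  define i where "i = nat \<lfloor>real m * t\<rfloor>"
  define s0 where "s0 = real m * t - real i"
  have i_le: "real i \<le> real m * t" "real m * t < real i + 1"
    using t m_pos by (auto simp: i_def)
  have "real m * t < real m * 1" using t m_pos by (intro mult_strict_left_mono) auto
  then have i: "i < m" using i_le by simp
  have s0: "s0 \<in> {0..1}" "s0 < 1" using i_le by (auto simp: s0_def)
  have tp: "t = (real i + s0) / real m" using m_pos by (simp add: s0_def)
  have right: "smooth_arc (\<lambda>s. loop (t + 1 * s)) (\<lambda>s. val (\<gamma> (t + 1 * s))) (\<lambda>s. primitive (t + 1 * s))
      ((1 * real m) *\<^sub>R vector_derivative (edge_path i) (at s0))"
    by (rule arc_from[OF i _ tp s0(1)]) (use s0 in auto)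
  have pos: "sgn (real m) = 1" "0 < real m" using m_pos by auto
  have nzi: "vector_derivative (edge_path i) (at s0) \<noteq> 0" by (rule edge_path_regular[OF i s0(1)])
  show ?thesis
  proof (cases "s0 = 0")
    case False
    have "t \<noteq> 0"
    proof
      assume "t = 0"
      then have "real i + s0 = 0" using tp m_pos by simp
      then show False using s0 False by auto
    qed
    then have t1: "t1 = t" by (simp add: t1_def)
    have left: "smooth_arc (\<lambda>s. loop (t + - 1 * s)) (\<lambda>s. val (\<gamma> (t + - 1 * s))) (\<lambda>s. primitive (t + - 1 * s))
        ((- 1 * real m) *\<^sub>R vector_derivative (edge_path i) (at s0))"
      by (rule arc_from[OF i _ tp s0(1)]) (use s0 False in auto)
    let ?D = "vector_derivative (edge_path i) (at s0)"
    have "sgn ?D \<noteq> - sgn ?D"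
      unfolding eq_neg_iff_add_eq_0 using nzi by (simp add: scaleR_2[symmetric] sgn_zero_iff)
    then show ?thesis
      using left right nzi pos m_pos
      by (intro that[of "real m *\<^sub>R ?D" "- (real m *\<^sub>R ?D)"]) (simp_all add: sgn_scaleR sgn_minus t1)
  next
    case True
    define j where "j = (if i = 0 then m - 1 else i - 1)"
    have j: "j < m" "i = Suc j mod m" using i m_pos by (auto simp: j_def)
    have t1p: "t1 = (real j + 1) / real m"
    proof (cases "i = 0")
      case True
      then have "t = 0" using tp \<open>s0 = 0\<close> by simp
      moreover obtain m' where "m = Suc m'" using m_pos gr0_implies_Suc by blast
      ultimately show ?thesis using True by (simp add: t1_def j_def)
    next
      case False
      then have "t \<noteq> 0" using tp \<open>s0 = 0\<close> m_pos by simp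
      then show ?thesis using False tp \<open>s0 = 0\<close> by (simp add: t1_def j_def of_nat_diff)
    qed
    have left: "smooth_arc (\<lambda>s. loop (t1 + - 1 * s)) (\<lambda>s. val (\<gamma> (t1 + - 1 * s))) (\<lambda>s. primitive (t1 + - 1 * s))
        ((- 1 * real m) *\<^sub>R vector_derivative (edge_path j) (at 1))"
      by (rule arc_from[OF j(1) _ t1p]) auto
    let ?D = "vector_derivative (edge_path i) (at 0)" and ?D' = "vector_derivative (edge_path j) (at 1)"
    have "?D' \<noteq> 0" by (rule edge_path_regular[OF j(1)]) simp
    then show ?thesis
      using left right nzi pos m_pos corner[OF j] True
      by (intro that[of "real m *\<^sub>R ?D" "- (real m *\<^sub>R ?D')"]) (simp_all add: sgn_scaleR sgn_minus)
  qed
qed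

text \<open>The data on the loop are made periodic with \<open>frac\<close>. Its jump at the
  integers is harmless because the lift closes up, which matches \<open>Q\<close>, and because the
  integral of the Liouville form vanishes, which matches \<open>U\<close>.\<close>

lemma Lagrangian_disk_exists:
  assumes disj: "torus ` h ` ball 0 1 \<inter> torus ` h ` sphere 0 1 = {}"
    and closed: "\<gamma> 0 = \<gamma> 1" "eta_integral \<gamma> = 0"
  shows "\<exists>D. Lagrangian_disk D \<gamma>"
proof (rule Lagrangian_disk_of_loop[OF disk disj, of "\<lambda>t. val (\<gamma> (frac t))" "\<lambda>t. primitive (frac t)",
      folded loop_def])
  have p1: "primitive 1 = 0" using closed primitive_1 by simp
  show "val (\<gamma> (frac (t + n))) = val (\<gamma> (frac t)) \<and> primitive (frac (t + n)) = primitive (frac t)"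
    if "n \<in> \<int>" for t n :: real
  proof -
    have "frac (t + n) = frac t" using that by (auto elim!: Ints_cases simp: frac_def)
    then show ?thesis by simp
  qed
  show "\<gamma> t = from_coords (val (\<gamma> (frac t))) (loop t)" if t: "t \<in> {0..1}" for t
  proof -
    have "\<gamma> (frac t) = \<gamma> t"
    proof (cases "t = 1")
      case False
      then have "frac t = t" using t by (simp add: frac_eq)
      then show ?thesis by simp
    qed (use closed in \<open>simp add: frac_def\<close>)
    then show ?thesis using from_coords_val[OF nonzero[OF t] arg_lift[OF t]] by simp
  qed
  fix t :: real
  define t0 where "t0 = frac t"
  \<comment> \<open>At an integer time the left germ belongs to the end of a period, so the base
    time is 1 instead of 0 and the shift is smaller by 1.\<close>
  define n where "n = of_int \<lfloor>t\<rfloor> - (if t0 = 0 then 1 else (0::real))"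
  define t1 where "t1 = (if t0 = 0 then 1 else t0)"
  have t0: "0 \<le> t0" "t0 < 1" by (auto simp: t0_def frac_lt_1)
  have tt0: "t = t0 + of_int \<lfloor>t\<rfloor>" by (simp add: t0_def frac_def)
  have tt1: "t = t1 + n" using tt0 by (simp add: t1_def n_def)
  have nint: "n \<in> \<int>" by (simp add: n_def)
  obtain u v where uv:
    "smooth_arc (\<lambda>s. loop (t0 + s)) (\<lambda>s. val (\<gamma> (t0 + s))) (\<lambda>s. primitive (t0 + s)) u"
    "smooth_arc (\<lambda>s. loop (t1 - s)) (\<lambda>s. val (\<gamma> (t1 - s))) (\<lambda>s. primitive (t1 - s)) v"
    "u \<noteq> 0" "v \<noteq> 0" "sgn u \<noteq> sgn v"
    using corner_arcs[OF t0 closed(1) p1] unfolding t1_def by blast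
  have "smooth_arc (\<lambda>s. loop (t + s)) (\<lambda>s. val (\<gamma> (frac (t + s)))) (\<lambda>s. primitive (frac (t + s))) u"
  proof (rule smooth_arc_cong[OF uv(1), of "1 - t0"])
    fix s assume s: "0 \<le> s" "s < 1 - t0"
    have ts: "t + s = (t0 + s) + of_int \<lfloor>t\<rfloor>" using tt0 by simp
    have d: "t + s - (t0 + s) = of_int \<lfloor>t\<rfloor>" using tt0 by linarith
    then have "frac (t + s) = t0 + s" unfolding frac_unique_iff d using s t0 by simp
    moreover have "loop (t + s) = loop (t0 + s)" unfolding ts by (rule loop_add_int) simp
    ultimately show "loop (t + s) = loop (t0 + s) \<and> val (\<gamma> (frac (t + s))) = val (\<gamma> (t0 + s)) \<and>
        primitive (frac (t + s)) = primitive (t0 + s)"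
      by simp
  qed (use t0 in simp)
  moreover have "smooth_arc (\<lambda>s. loop (t - s)) (\<lambda>s. val (\<gamma> (frac (t - s)))) (\<lambda>s. primitive (frac (t - s))) v"
  proof (rule smooth_arc_cong[OF uv(2), of t1])
    show "0 < t1" using t0 by (simp add: t1_def)
    fix s assume s: "0 \<le> s" "s < t1"
    have ts: "t - s = (t1 - s) + n" using tt1 by simp
    have loop: "loop (t - s) = loop (t1 - s)" unfolding ts by (rule loop_add_int[OF nint])
    show "loop (t - s) = loop (t1 - s) \<and> val (\<gamma> (frac (t - s))) = val (\<gamma> (t1 - s)) \<and>
        primitive (frac (t - s)) = primitive (t1 - s)"
    proof (cases "t1 - s = 1")
      \<comment> \<open>This happens only for \<open>s = 0\<close> at an integer time:
        \<open>frac\<close> returns 0 while the left germ is based at time 1, and closedness of the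
        data identifies the two.\<close>
      case True
      then have "s = 0" "t1 = 1" using s t0 by (auto simp: t1_def split: if_splits)
      then have f0: "frac (t - s) = 0" using ts nint by simp
      show ?thesis unfolding loop f0 True using closed(1) p1 primitive_0 by simp
    next
      case False
      then have "t1 - s < 1" using s t0 by (auto simp: t1_def split: if_splits)
      then have "frac (t - s) = t1 - s" unfolding frac_unique_iff using s nint by (simp add: ts)
      then show ?thesis using loop by simp
    qed
  qed
  ultimately show "\<exists>u v. smooth_arc (\<lambda>s. loop (t + s)) (\<lambda>s. val (\<gamma> (frac (t + s)))) (\<lambda>s. primitive (frac (t + s))) u \<and>
      smooth_arc (\<lambda>s. loop (t - s)) (\<lambda>s. val (\<gamma> (frac (t - s)))) (\<lambda>s. primitive (frac (t - s))) v \<and>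
      u \<noteq> 0 \<and> v \<noteq> 0 \<and> sgn u \<noteq> sgn v"
    using uv(3-5) by blast
qed

text \<open>The part of \<gamma> over the i-th step, reparametrised affinely, is itself a lift of
  the edge, so \<open>edge_weights\<close> forces its integral to be the weight. The increments of
  \<open>primitive\<close> are arranged to telescope over the cycle.\<close>

lemma edge_weight:
  assumes w: "edge_weights E epath L \<ww>" and i: "i < m"
  shows "(case c ! i of (e, b) \<Rightarrow> if b then \<ww> e else - \<ww> e) =
    primitive (real (Suc i) / real m) - primitive (real i / real m)"
proof -
  have pw: "piecewise_smooth_path \<gamma>" and inL: "\<And>t. t \<in> {0..1} \<Longrightarrow> \<gamma> t \<in> L"
    using lift unfolding lifts_to_def by auto
  obtain e b where eb: "c ! i = (e, b)" by (cases "c ! i") auto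
  \<comment> \<open>The affine map always traverses the edge from black to white; it is decreasing
    when the cycle uses the edge backwards, which produces the minus sign.\<close>
  define q where "q = (if b then 1 else - 1) / real m"
  define p where "p = (if b then real i else real i + 1) / real m"
  have pq: "p + q * t = (real i + (if b then t else 1 - t)) / real m" for t
    using m_pos by (simp add: p_def q_def field_simps)
  have rng: "p + q * t \<in> {0..1}" if "t \<in> {0..1}" for t
    unfolding pq using that by (intro step_in[OF i]) auto
  have q0: "q \<noteq> 0" using m_pos by (simp add: q_def)
  have "lifts_to L (\<lambda>t. torus (epath e t)) (\<lambda>t. \<gamma> (p + q * t))"
    unfolding lifts_to_def
  proof (intro conjI ballI)
    show "piecewise_smooth_path (\<lambda>t. \<gamma> (p + q * t))"
      by (rule piecewise_smooth_path_affine[OF pw q0 rng])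
    fix t :: real assume t: "t \<in> {0..1}"
    show "\<gamma> (p + q * t) \<in> L" by (rule inL[OF rng[OF t]])
    have "arg_torus (\<gamma> (p + q * t)) = cycle_path epath c (p + q * t)"
      using lift rng[OF t] unfolding lifts_to_def by blast
    also have "\<dots> = torus (edge_path i (if b then t else 1 - t))"
      unfolding pq by (rule cycle_path_step[OF i]) (use t in auto)
    also have "\<dots> = torus (epath e t)" by (simp add: edge_path_def eb)
    finally show "arg_torus (\<gamma> (p + q * t)) = torus (epath e t)" .
  qed
  then have "\<ww> e = eta_integral (\<lambda>t. \<gamma> (p + q * t))"
    using w edge_in[OF i] unfolding edge_weights_def by (simp add: eb)
  also have "\<dots> = primitive (p + q) - primitive p" by (rule eta_integral_affine[OF q0 rng])
  finally have "\<ww> e = primitive (p + q) - primitive p" .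
  moreover have "p + q = (if b then real (Suc i) else real i) / real m"
    using pq[of 1] by simp
  ultimately show ?thesis by (simp add: eb p_def add.commute)
qed

lemma cycle_weight_eq:
  assumes "edge_weights E epath L \<ww>"
  shows "cycle_weight \<ww> c = eta_integral \<gamma>"
proof -
  have "cycle_weight \<ww> c = (\<Sum>i<m. case c ! i of (e, b) \<Rightarrow> if b then \<ww> e else - \<ww> e)"
    unfolding cycle_weight_def sum_list_sum_nth by (simp add: atLeast0LessThan)
  also have "\<dots> = (\<Sum>i<m. primitive (real (Suc i) / real m) - primitive (real i / real m))"
    by (intro sum.cong refl edge_weight[OF assms]) simp
  also have "\<dots> = primitive (real m / real m) - primitive (real 0 / real m)"
    by (rule sum_lessThan_telescope)
  also have "\<dots> = eta_integral \<gamma>" using m_pos by (simp add: primitive_0 primitive_1)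
  finally show ?thesis .
qed

end

theorem lemma3p3p1:
  fixes V :: "'v set" and Pw :: "'v \<Rightarrow> (real ^ 2) set"
    and W :: "'w set" and Pb :: "'w \<Rightarrow> (real ^ 2) set"
    and xw :: "'v \<Rightarrow> real ^ 2" and xb :: "'w \<Rightarrow> real ^ 2"
    and epath :: "('v, 'w, 2) edge \<Rightarrow> real \<Rightarrow> real ^ 2"
    and R :: real and \<rho> :: "real ^ 2 \<Rightarrow> real"
    and L :: "(complex ^ 2) set" and f :: "(complex ^ 2) set"
    and c :: "(('v, 'w, 2) edge \<times> bool) list"
    and \<ww> :: "('v, 'w, 2) edge \<Rightarrow> real"
    and \<gamma> :: "real \<Rightarrow> complex ^ 2"
  assumes "dual_dimer V Pw W Pb"
    and "embedded_graph V Pw W Pb xw xb epath"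
    and "smoothing_kernel R \<rho>"
    and "dimer_Lagrangian V Pw W Pb R \<rho> L"
    and "f \<in> faces (edges V Pw W Pb) epath"
    and "boundary_cycle (edges V Pw W Pb) epath f c"
    and "edge_weights (edges V Pw W Pb) epath L \<ww>"
    and "cycle_weight \<ww> c = 0"
    and "lifts_to L (cycle_path epath c) \<gamma>"
    and "\<gamma> 0 = \<gamma> 1"
  shows "\<exists>D. Lagrangian_disk D \<gamma>"
proof -
  let ?E = "edges V Pw W Pb"
  have arc: "edge_arc Pw Pb xw xb e (epath e)" if "e \<in> ?E" for e
    using assms(2) that unfolding embedded_graph_def by blast
  have meet: "(\<forall>t\<in>{0..1}. \<forall>t'\<in>{0..1}. torus (epath e t) = torus (epath e' t') \<longrightarrow>
           e = e' \<and> t = t' \<or> fst e = fst e' \<and> t = 0 \<and> t' = 0 \<or>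
           fst (snd (snd e)) = fst (snd (snd e')) \<and> t = 1 \<and> t' = 1) \<and>
        (e \<noteq> e' \<and> fst e = fst e' \<longrightarrow>
           sgn (vector_derivative (epath e) (at 0)) \<noteq> sgn (vector_derivative (epath e') (at 0))) \<and>
        (e \<noteq> e' \<and> fst (snd (snd e)) = fst (snd (snd e')) \<longrightarrow>
           sgn (vector_derivative (epath e) (at 1)) \<noteq> sgn (vector_derivative (epath e') (at 1)))"
    if "e \<in> ?E" "e' \<in> ?E" for e e'
  proof -
    obtain w p2 v p1 where e: "e = (w, p2, v, p1)" by (metis prod_cases4)
    obtain w' p2' v' p1' where e': "e' = (w', p2', v', p1')" by (metis prod_cases4)
    have "\<forall>(w, p2, v, p1)\<in>?E. \<forall>(w', p2', v', p1')\<in>?E.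
        let e = (w, p2, v, p1); e' = (w', p2', v', p1') in
        (\<forall>t\<in>{0..1}. \<forall>t'\<in>{0..1}. torus (epath e t) = torus (epath e' t') \<longrightarrow>
           e = e' \<and> t = t' \<or> w = w' \<and> t = 0 \<and> t' = 0 \<or> v = v' \<and> t = 1 \<and> t' = 1) \<and>
        (e \<noteq> e' \<and> w = w' \<longrightarrow>
           sgn (vector_derivative (epath e) (at 0)) \<noteq> sgn (vector_derivative (epath e') (at 0))) \<and>
        (e \<noteq> e' \<and> v = v' \<longrightarrow>
           sgn (vector_derivative (epath e) (at 1)) \<noteq> sgn (vector_derivative (epath e') (at 1)))"
      using assms(2) unfolding embedded_graph_def by blast
    from bspec[OF bspec[OF this that(1), unfolded e prod.case] that(2), unfolded e' prod.case Let_def]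
    show ?thesis unfolding e e' fst_conv snd_conv .
  qed
  obtain h :: "complex \<Rightarrow> real ^ 2" where walk: "closed_walk ?E epath c"
    and h: "continuous_on (cball 0 1) h" "inj_on h (cball 0 1)" "torus ` h ` ball 0 1 = f"
      "\<And>t. t \<in> {0..1} \<Longrightarrow> torus (h (cis (2 * pi * t))) = cycle_path epath c t"
    using assms(6) unfolding boundary_cycle_def by blast
  interpret boundary_walk ?E epath c h
  proof
    show "smooth_on UNIV (epath e)" if "e \<in> ?E" for e
      using arc[OF that] unfolding edge_arc_def by (auto split: prod.splits)
    show "vector_derivative (epath e) (at t) \<noteq> 0" if "e \<in> ?E" "t \<in> {0..1}" for e t
      using arc[OF that(1)] that(2) unfolding edge_arc_def by (auto split: prod.splits)
  qed (use meet walk h in blast)+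
  have on_graph: "torus (loop t) \<in> graph_set ?E epath" if "t \<in> {0..1}" for t
  proof -
    have "cycle_path epath c t \<in> graph_set ?E epath"
    proof -
      let ?i = "nat \<lfloor>real m * t\<rfloor> mod m"
      have "fst (c ! ?i) \<in> ?E" using m_pos by (intro edge_in) simp
      moreover have "frac (real m * t) \<in> {0..1}" "1 - frac (real m * t) \<in> {0..1}"
        using frac_lt_1[of "real m * t"] by (simp_all add: less_imp_le)
      ultimately show ?thesis
        unfolding cycle_path_def Let_def step_path_def graph_set_def by (intro UN_I imageI) auto
    qed
    then show ?thesis using h(4)[OF that] by (simp add: loop_def)
  qed
  \<comment> \<open>The open disk projects to a component of the complement of the graph, its
    boundary circle into the graph.\<close>
  have disj: "torus ` h ` ball 0 1 \<inter> torus ` h ` sphere 0 1 = {}"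
  proof -
    have f: "f \<inter> graph_set ?E epath = {}"
      using in_components_subset[OF assms(5)[unfolded faces_def]] by blast
    have on_sphere: "torus (h z) \<in> graph_set ?E epath" if "z \<in> sphere 0 1" for z
    proof -
      \<comment> \<open>The boundary condition is known for parameters in [0,1] only; the argument
        of \<open>z\<close>, divided by 2 pi, is brought there by subtracting an integer.\<close>
      define a where "a = Arg z"
      have "norm z = 1" using that by simp
      then have "z \<noteq> 0" "sgn z = z" by (auto simp: sgn_div_norm)
      then have "z = cis a" using cis_Arg by (simp add: a_def)
      then have "z = cis (2 * pi * (a / (2 * pi)))" by simp
      then have "h z = loop (frac (a / (2 * pi)) + of_int \<lfloor>a / (2 * pi)\<rfloor>)" by (simp add: loop_def frac_def)
      then have "h z = loop (frac (a / (2 * pi)))" by (simp add: loop_add_int)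
      then show ?thesis using on_graph[of "frac (a / (2 * pi))"] frac_lt_1[of "a / (2 * pi)"] by simp
    qed
    have gen: "A \<inter> C = {}" if "A \<inter> B = {}" "C \<subseteq> B" for A B C :: "(complex ^ 2) set"
      using that by blast
    show ?thesis unfolding h(3)
      by (rule gen[OF f]) (simp only: image_image, rule image_subsetI, rule on_sphere)
  qed
  obtain S where S: "smooth_lift \<gamma> S"
  proof (rule smooth_liftI[OF assms(9)])
    show "\<exists>p. cycle_path epath c t = torus p" if "t \<in> {0..1}" for t
      using h(4)[OF that] by metis
  qed
  interpret smooth_lift \<gamma> S by (rule S)
  interpret boundary_lift ?E epath c h \<gamma> S L by unfold_locales (rule assms(9))
  have "eta_integral \<gamma> = 0" using cycle_weight_eq[OF assms(7)] assms(8) by simp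
  then show ?thesis by (rule Lagrangian_disk_exists[OF disj assms(10)])
qed

end
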